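(* Suppose $\phi,\psi\in C_c^\infty((2M,\infty)\times\mathbb{S}^2)$. (1) Let $\tau_0\in\mathbb{R}$. If $\mathcal{R}_{E_1^+}(\phi,\psi)(\tau,\omega)$ vanishes for $\tau\le\tau_0$ and $\mathcal{R}_{E_1^-}(\phi,\psi)(\tau,\omega)$ vanishes for $\tau\ge-\tau_0$, then both $\phi$ and $\psi$ are supported in $[r_0,\infty)\times\mathbb{S}^2$, where $r_0\in(2M,\infty)$ is given implicitly by $r_0+2M\log(r_0-2M)=\tau_0$. (2) Let $\bar\tau_0\in\mathbb{R}$. If $\mathcal{R}_{S_1^+}(\phi,\psi)(\bar\tau,\omega)$ vanishes for $\bar\tau\le-\bar\tau_0$ and $\mathcal{R}_{S_1^-}(\phi,\psi)(\bar\tau,\omega)$ vanishes for $\bar\tau\ge\bar\tau_0$, then both $\phi$ and $\psi$ are supported in $(2M,r_0]\times\mathbb{S}^2$, where $r_0\in(2M,\infty)$ is given implicitly by $r_0+2M\log(r_0-2M)=\bar\tau_0$.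
   Context: Fix $M>0$. The Schwarzschild exterior is $\mathbb{R}_t\times(2M,\infty)_r\times\mathbb{S}^2_\omega$ with Lorentzian metric $g_S=-\frac{r-2M}{r}dt^2+\frac{r}{r-2M}dr^2+r^2d\omega^2$, where $d\omega^2$ is the round metric on the unit sphere. Its D'Alembertian is $\Box_S=-\frac{r}{r-2M}\partial_t^2+\frac{r-2M}{r}\partial_r^2+\frac1{r^2}\Delta_\omega+\frac{2(r-M)}{r^2}\partial_r$. Given $(\phi,\psi)$, $u=u(t,r,\omega)$ denotes the solution of $\Box_Su=0$, $(u,\partial_tu)|_{t=0}=(\phi,\psi)$. The components of the forward radiation field are $$\mathcal{R}_{E_1^+}(\phi,\psi)(\tau,\omega)=\lim_{r\to2M}\partial_tu(\tau-r-2M\log(r-2M),r,\omega),$$ $$\mathcal{R}_{S_1^+}(\phi,\psi)(\bar\tau,\omega)=\lim_{r\to\infty}r\,\partial_tu(\bar\tau+r+2M\log(r-2M),r,\omega),$$ and those of the backward radiation field are $$\mathcal{R}_{E_1^-}(\phi,\psi)(\tau,\omega)=\lim_{r\to2M}\partial_tu(\tau+r+2M\log(r-2M),r,\omega),$$ $$\mathcal{R}_{S_1^-}(\phi,\psi)(\bar\tau,\omega)=\lim_{r\to\infty}r\,\partial_tu(\bar\tau-r-2M\log(r-2M),r,\omega).$$ Here $E_1^\pm$ are the future/past event horizons and $S_1^\pm$ future/past null infinity. *)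

theory Defs
  imports "HOL-Analysis.Analysis"
begin

type_synonym vec3 = "real ^ 3"

abbreviation S2 :: "vec3 set" where
  "S2 \<equiv> sphere 0 1"

text \<open>
  The spatial slice of the exterior. Functions on it are total functions on the ambient
  space; their values off \<^term>\<open>{2*M<..} \<times> S2\<close> never matter.
\<close>

definition exterior :: "real \<Rightarrow> (real \<times> vec3) set" where
  "exterior M = {2*M<..} \<times> S2"

definition D1 :: "(real \<Rightarrow> 'a::real_normed_vector) \<Rightarrow> real \<Rightarrow> 'a" where
  "D1 f x = vector_derivative f (at x)"

text \<open>For open \<open>U\<close>: all iterated partial derivatives up to order \<open>k\<close> exist and are continuous.\<close>

primrec Ck_on :: "nat \<Rightarrow> 'a::euclidean_space set \<Rightarrow> ('a \<Rightarrow> 'b::real_normed_vector) \<Rightarrow> bool" where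
  "Ck_on 0 U f \<longleftrightarrow> continuous_on U f"
| "Ck_on (Suc k) U f \<longleftrightarrow>
     (\<forall>x\<in>U. f differentiable (at x)) \<and>
     (\<forall>b\<in>Basis. Ck_on k U (\<lambda>x. frechet_derivative f (at x) b))"

text \<open>
  Smoothness on an arbitrary subset of a Euclidean space: locally the restriction of a smooth
  function on an open set. On an embedded submanifold such as \<^term>\<open>exterior M\<close> this is the
  usual smoothness.
\<close>

definition smooth_on :: "'a::euclidean_space set \<Rightarrow> ('a \<Rightarrow> 'b::real_normed_vector) \<Rightarrow> bool" where
  "smooth_on S f \<longleftrightarrow>
     (\<forall>x\<in>S. \<exists>U g. open U \<and> x \<in> U \<and> (\<forall>k. Ck_on k U g) \<and> (\<forall>y\<in>S \<inter> U. f y = g y))"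

definition supp_in :: "'a::topological_space set \<Rightarrow> ('a \<Rightarrow> 'b::zero) \<Rightarrow> 'a set" where
  "supp_in S f = top_of_set S closure_of {x \<in> S. f x \<noteq> 0}"

definition Cc_infinity :: "'a::euclidean_space set \<Rightarrow> ('a \<Rightarrow> 'b::real_normed_vector) \<Rightarrow> bool" where
  "Cc_infinity S f \<longleftrightarrow> smooth_on S f \<and> compact (supp_in S f)"

definition laplacian :: "('a::euclidean_space \<Rightarrow> 'b::real_normed_vector) \<Rightarrow> 'a \<Rightarrow> 'b" where
  "laplacian f x = (\<Sum>b\<in>Basis. D1 (D1 (\<lambda>s. f (x + s *\<^sub>R b))) 0)"

text \<open>
  The Laplace-Beltrami operator of the round unit sphere. In polar coordinates the flat Laplacian
  is \<open>\<partial>\<^sub>\<rho>\<^sup>2 + (2/\<rho>) \<partial>\<^sub>\<rho> + \<rho>\<^sup>-\<^sup>2 \<Delta>\<^sub>\<omega>\<close>, so on \<open>\<rho> = 1\<close> it agrees with \<open>\<Delta>\<^sub>\<omega>\<close> on the extension of \<open>f\<close>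
  that is constant along rays.
\<close>

definition sphere_laplacian :: "(vec3 \<Rightarrow> 'b::real_normed_vector) \<Rightarrow> vec3 \<Rightarrow> 'b" where
  "sphere_laplacian f \<omega> = laplacian (\<lambda>x. f (x /\<^sub>R norm x)) \<omega>"

definition schwarzschild_box ::
  "real \<Rightarrow> (real \<times> real \<times> vec3 \<Rightarrow> complex) \<Rightarrow> real \<times> real \<times> vec3 \<Rightarrow> complex" where
  "schwarzschild_box M u = (\<lambda>(t, r, \<omega>).
       - (r / (r - 2*M)) *\<^sub>R D1 (D1 (\<lambda>s. u (s, r, \<omega>))) t
       + ((r - 2*M) / r) *\<^sub>R D1 (D1 (\<lambda>s. u (t, s, \<omega>))) r
       + (1 / r\<^sup>2) *\<^sub>R sphere_laplacian (\<lambda>x. u (t, r, x)) \<omega>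
       + (2 * (r - M) / r\<^sup>2) *\<^sub>R D1 (\<lambda>s. u (t, s, \<omega>)) r)"

definition cauchy_solution ::
  "real \<Rightarrow> (real \<times> vec3 \<Rightarrow> complex) \<Rightarrow> (real \<times> vec3 \<Rightarrow> complex)
     \<Rightarrow> (real \<times> real \<times> vec3 \<Rightarrow> complex) \<Rightarrow> bool" where
  "cauchy_solution M \<phi> \<psi> u \<longleftrightarrow>
     smooth_on (UNIV \<times> exterior M) u \<and>
     (\<forall>p \<in> UNIV \<times> exterior M. schwarzschild_box M u p = 0) \<and>
     (\<forall>(r, \<omega>) \<in> exterior M. u (0, r, \<omega>) = \<phi> (r, \<omega>) \<and> D1 (\<lambda>s. u (s, r, \<omega>)) 0 = \<psi> (r, \<omega>))"

definition tortoise :: "real \<Rightarrow> real \<Rightarrow> real" where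
  "tortoise M r = r + 2*M * ln (r - 2*M)"

text \<open>
  The radiation fields of the solution \<open>u\<close>, as relations in the style of \<^const>\<open>has_integral\<close>:
  the limit exists and has the value \<open>l\<close>.
\<close>

definition has_radiation_E_plus ::
  "real \<Rightarrow> (real \<times> real \<times> vec3 \<Rightarrow> complex) \<Rightarrow> real \<Rightarrow> vec3 \<Rightarrow> complex \<Rightarrow> bool" where
  "has_radiation_E_plus M u \<tau> \<omega> l \<longleftrightarrow>
     ((\<lambda>r. D1 (\<lambda>s. u (s, r, \<omega>)) (\<tau> - tortoise M r)) \<longlongrightarrow> l) (at_right (2*M))"

definition has_radiation_S_plus ::
  "real \<Rightarrow> (real \<times> real \<times> vec3 \<Rightarrow> complex) \<Rightarrow> real \<Rightarrow> vec3 \<Rightarrow> complex \<Rightarrow> bool" where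
  "has_radiation_S_plus M u \<tau> \<omega> l \<longleftrightarrow>
     ((\<lambda>r. r *\<^sub>R D1 (\<lambda>s. u (s, r, \<omega>)) (\<tau> + tortoise M r)) \<longlongrightarrow> l) at_top"

definition has_radiation_E_minus ::
  "real \<Rightarrow> (real \<times> real \<times> vec3 \<Rightarrow> complex) \<Rightarrow> real \<Rightarrow> vec3 \<Rightarrow> complex \<Rightarrow> bool" where
  "has_radiation_E_minus M u \<tau> \<omega> l \<longleftrightarrow>
     ((\<lambda>r. D1 (\<lambda>s. u (s, r, \<omega>)) (\<tau> + tortoise M r)) \<longlongrightarrow> l) (at_right (2*M))"

definition has_radiation_S_minus ::
  "real \<Rightarrow> (real \<times> real \<times> vec3 \<Rightarrow> complex) \<Rightarrow> real \<Rightarrow> vec3 \<Rightarrow> complex \<Rightarrow> bool" where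
  "has_radiation_S_minus M u \<tau> \<omega> l \<longleftrightarrow>
     ((\<lambda>r. r *\<^sub>R D1 (\<lambda>s. u (s, r, \<omega>)) (\<tau> - tortoise M r)) \<longlongrightarrow> l) at_top"

end

theory Submission imports Defs begin

text \<open>
  In the tortoise coordinate \<open>s = r + 2 M ln (r - 2 M)\<close> the function \<open>v = r u\<close> satisfies
  \<open>v\<^sub>t\<^sub>t = v\<^sub>s\<^sub>s - W v + V \<Delta> v\<close> with \<open>V = (1 - 2 M / r) / r\<^sup>2\<close> and \<open>W = 2 M (1 - 2 M / r) / r\<^sup>3\<close>.
  The moments of \<open>v\<close> against the monomials in the Cartesian coordinates of the sphere form a
  triangular system: by induction on the degree \<open>k\<close> the lower moments vanish in the region considered,
  and what is left is the equation \<open>w\<^sub>t\<^sub>t = w\<^sub>s\<^sub>s - q w\<close> on the line with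
  \<open>q = W + k (k + 1) V \<ge> 0\<close>. Since \<open>q\<close> is the derivative of the bounded function
  \<open>- M / r\<^sup>2 - k (k + 1) / r\<close>, it is integrable at both ends. A moment whose limits at the future
  and past horizon \<open>s = - \<infinity>\<close> vanish for \<open>t + s < \<tau>\<^sub>0\<close> and \<open>t - s > - \<tau>\<^sub>0\<close>
  therefore solves a Goursat problem with zero data and vanishes in that quadrant, hence so does
  \<open>v\<close> by the Weierstrass theorem. The statement at \<open>r = \<infinity>\<close> is the one at
  the horizon after \<open>s \<mapsto> - s\<close>.

  The radiation fields vanish only pointwise on the sphere. That the limits of the moments vanish
  follows because \<open>v\<^sub>t\<close> is bounded in mean square by energy conservation, and a bounded sequence
  in \<open>L\<^sup>2\<close> that tends to zero pointwise tends to zero weakly.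
\<close>

section \<open>Functions of class C^k\<close>

text \<open>Energy is conserved on time slices, whereas the horizon is approached along null lines.
  The mean-square bound there comes from averaging over unit intervals of \<open>s\<close>, and so
  holds only along a sequence \<open>sn\<close>. The argument at infinity is built for this weak
  input: it uses limits of moments along a sequence and none of their derivatives.

  The future condition gives vanishing for large \<open>t - s\<close>, the past condition for very
  negative \<open>t + s\<close>; the null rectangle in between then has zero data on two adjacent
  edges. Compact support supplies, by finite speed, a null line from which to start, and a finite
  energy.

  The poles are handled without extra charts. Integrals are taken in the angles, angular derivatives
  are expressed by Cartesian derivatives of the extension constant along rays, and the equation is
  multiplied by \<open>sin p\<close>, so that no denominators arise. Complex values are reduced to
  real ones by applying real-linear functionals.\<close>

lemma Ck_on_Suc_imp: "Ck_on (Suc k) U f \<Longrightarrow> Ck_on k U f"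
proof (induction k arbitrary: f)
  case 0
  then show ?case
    by (auto intro!: differentiable_imp_continuous_on simp: differentiable_on_def differentiable_at_withinI)
qed auto

lemma Ck_on_subset: "Ck_on k U f \<Longrightarrow> V \<subseteq> U \<Longrightarrow> Ck_on k V f"
  by (induction k arbitrary: f) (auto intro: continuous_on_subset)

lemma Ck_on_local:
  assumes "\<And>x. x \<in> U \<Longrightarrow> \<exists>V. open V \<and> x \<in> V \<and> Ck_on k V f"
  shows "Ck_on k U f"
  using assms
proof (induction k arbitrary: f)
  case 0
  show ?case
    unfolding Ck_on.simps
  proof (rule continuous_at_imp_continuous_on, rule ballI)
    fix x assume "x \<in> U"
    with 0 obtain V where "open V" "x \<in> V" "continuous_on V f" by auto
    then show "isCont f x" by (simp add: continuous_on_eq_continuous_at)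
  qed
next
  case (Suc k)
  have "f differentiable at x" if "x \<in> U" for x
    using Suc.prems[OF that] by auto
  moreover have "Ck_on k U (\<lambda>x. frechet_derivative f (at x) b)" if "b \<in> Basis" for b
    by (rule Suc.IH) (use Suc.prems that in fastforce)
  ultimately show ?case by simp
qed

lemma Ck_on_cong:
  assumes "open U" "\<And>x. x \<in> U \<Longrightarrow> f x = g x" "Ck_on k U f"
  shows "Ck_on k U g"
  using assms(2,3)
proof (induction k arbitrary: f g)
  case 0
  then show ?case using continuous_on_cong[of U U f g] by simp
next
  case (Suc k)
  have *: "(g has_derivative frechet_derivative f (at x)) (at x)" if "x \<in> U" for x
  proof -
    have "(f has_derivative frechet_derivative f (at x)) (at x)"
      using Suc.prems(2) that by (simp add: frechet_derivative_works[symmetric])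
    then show ?thesis
      by (rule has_derivative_transform_within_open[OF _ \<open>open U\<close> that]) (use Suc.prems in auto)
  qed
  have **: "frechet_derivative g (at x) = frechet_derivative f (at x)" if "x \<in> U" for x
    using frechet_derivative_at[OF *[OF that]] by simp
  show ?case
    using Suc.prems(2) * ** Suc.IH[of "\<lambda>x. frechet_derivative f (at x) b"
       "\<lambda>x. frechet_derivative g (at x) b" for b]
    by (auto simp: differentiable_def)
qed

lemma Ck_on_SucI:
  assumes "open U"
    and "\<And>x. x \<in> U \<Longrightarrow> (f has_derivative f' x) (at x)"
    and "\<And>b. b \<in> Basis \<Longrightarrow> Ck_on k U (\<lambda>x. f' x b)"
  shows "Ck_on (Suc k) U f"
proof -
  have "Ck_on k U (\<lambda>x. frechet_derivative f (at x) b)" if "b \<in> Basis" for b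
    by (rule Ck_on_cong[OF assms(1) _ assms(3)[OF that]])
       (simp add: frechet_derivative_at[OF assms(2), symmetric])
  then show ?thesis using assms(2) by (auto simp: differentiable_def)
qed

lemma Ck_on_SucD:
  assumes "Ck_on (Suc k) U f" "x \<in> U"
  shows "(f has_derivative frechet_derivative f (at x)) (at x)"
  using assms by (simp add: frechet_derivative_works[symmetric])

lemma Ck_on_const: "open U \<Longrightarrow> Ck_on k U (\<lambda>x. c)"
proof (induction k arbitrary: c)
  case (Suc k)
  show ?case by (rule Ck_on_SucI[OF Suc.prems, of _ "\<lambda>_ _. 0"]) (use Suc in auto)
qed auto

lemma Ck_on_add:
  assumes "open U" "Ck_on k U f" "Ck_on k U g"
  shows "Ck_on k U (\<lambda>x. f x + g x)"
  using assms(2,3)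
proof (induction k arbitrary: f g)
  case (Suc k)
  show ?case
    by (rule Ck_on_SucI[OF assms(1)], rule has_derivative_add[OF Ck_on_SucD[OF Suc.prems(1)] Ck_on_SucD[OF Suc.prems(2)]])
       (use Suc in auto)
qed (auto intro: continuous_intros)

lemma Ck_on_sum:
  assumes "open U" "\<And>i. i \<in> I \<Longrightarrow> Ck_on k U (f i)"
  shows "Ck_on k U (\<lambda>x. \<Sum>i\<in>I. f i x)"
  using assms(2)
proof (induction I rule: infinite_finite_induct)
  case (insert i I)
  then show ?case by (simp add: Ck_on_add[OF assms(1)])
qed (simp_all add: Ck_on_const[OF assms(1)])

lemma Ck_on_linear_compose:
  assumes "open U" "bounded_linear h" "Ck_on k U f"
  shows "Ck_on k U (\<lambda>x. h (f x))"
  using assms(3)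
proof (induction k arbitrary: f)
  case 0
  then show ?case using assms(2) by (auto intro: bounded_linear.continuous_on)
next
  case (Suc k)
  show ?case
    by (rule Ck_on_SucI[OF assms(1)], rule bounded_linear.has_derivative[OF assms(2) Ck_on_SucD[OF Suc.prems]])
       (use Suc in auto)
qed

lemma Ck_on_id: "open U \<Longrightarrow> Ck_on k U (\<lambda>x. x)"
  by (cases k) (auto intro!: Ck_on_SucI[of U _ "\<lambda>_ x. x"] Ck_on_const simp del: Ck_on.simps(2))

lemma Ck_on_bilinear:
  assumes "open U" "bounded_bilinear mul" "Ck_on k U f" "Ck_on k U g"
  shows "Ck_on k U (\<lambda>x. mul (f x) (g x))"
  using assms(3,4)
proof (induction k arbitrary: f g)
  case 0
  then show ?case using assms(2) by (auto intro: bounded_bilinear.continuous_on)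
next
  case (Suc k)
  show ?case
  proof (rule Ck_on_SucI[OF assms(1)])
    fix x assume "x \<in> U"
    then show "((\<lambda>x. mul (f x) (g x)) has_derivative
        (\<lambda>v. mul (f x) (frechet_derivative g (at x) v) + mul (frechet_derivative f (at x) v) (g x))) (at x)"
      by (intro bounded_bilinear.FDERIV[OF assms(2)] Ck_on_SucD[OF Suc.prems(1)] Ck_on_SucD[OF Suc.prems(2)])
  next
    fix b :: 'a assume "b \<in> Basis"
    then have "Ck_on k U (\<lambda>x. frechet_derivative f (at x) b)" "Ck_on k U (\<lambda>x. frechet_derivative g (at x) b)"
      using Suc.prems by auto
    then show "Ck_on k U (\<lambda>x. mul (f x) (frechet_derivative g (at x) b) + mul (frechet_derivative f (at x) b) (g x))"
      by (intro Ck_on_add assms(1) Suc.IH Ck_on_Suc_imp[OF Suc.prems(1)] Ck_on_Suc_imp[OF Suc.prems(2)])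
  qed
qed

text \<open>Expanding \<open>g' x v\<close> in the basis writes the derivative of the composite as a
  finite sum of products. One factor is a composition of lower order, the other a component of the
  derivative of \<open>g\<close>, so the sum and product rules close the induction on
  \<open>k\<close>.\<close>

lemma Ck_on_compose:
  fixes f :: "'b::euclidean_space \<Rightarrow> 'c::real_normed_vector" and g :: "'a::euclidean_space \<Rightarrow> 'b"
  assumes "open U" "Ck_on k V f" "Ck_on k U g" "g ` U \<subseteq> V"
  shows "Ck_on k U (\<lambda>x. f (g x))"
  using assms(2,3)
proof (induction k arbitrary: f)
  case 0
  then show ?case using assms(4) by (auto intro: continuous_on_compose2)
next
  case (Suc k)
  define f' g' where "f' y = frechet_derivative f (at y)" and "g' x = frechet_derivative g (at x)" for x y
  have f': "(f has_derivative f' (g x)) (at (g x))" if "x \<in> U" for x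
    unfolding f'_def using Ck_on_SucD[OF Suc.prems(1)] that assms(4) by blast
  have g': "(g has_derivative g' x) (at x)" if "x \<in> U" for x
    unfolding g'_def using Ck_on_SucD[OF Suc.prems(2)] that by blast
  have D: "((\<lambda>x. f (g x)) has_derivative (\<lambda>v. \<Sum>c\<in>Basis. (g' x v \<bullet> c) *\<^sub>R f' (g x) c)) (at x)"
    if "x \<in> U" for x
  proof -
    interpret bounded_linear "f' (g x)" using f'[OF that] by (rule has_derivative_bounded_linear)
    have "f' (g x) w = (\<Sum>c\<in>Basis. (w \<bullet> c) *\<^sub>R f' (g x) c)" for w
      by (subst euclidean_representation[of w, symmetric]) (simp only: sum scaleR)
    then show ?thesis
      by (intro has_derivative_eq_rhs[OF has_derivative_compose[OF g'[OF that] f'[OF that]]] ext)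
  qed
  show ?case
  proof (rule Ck_on_SucI[OF assms(1) D])
    fix b :: 'a assume b: "b \<in> Basis"
    show "Ck_on k U (\<lambda>x. \<Sum>c\<in>Basis. (g' x b \<bullet> c) *\<^sub>R f' (g x) c)"
    proof (rule Ck_on_sum[OF assms(1)], rule Ck_on_bilinear[OF assms(1) bounded_bilinear_scaleR])
      fix c :: 'b assume c: "c \<in> Basis"
      show "Ck_on k U (\<lambda>x. g' x b \<bullet> c)"
      proof (rule Ck_on_linear_compose[OF assms(1) bounded_linear_inner_left])
        show "Ck_on k U (\<lambda>x. g' x b)" using Suc.prems(2) b by (simp add: g'_def)
      qed
      show "Ck_on k U (\<lambda>x. f' (g x) c)"
      proof (rule Suc.IH[OF _ Ck_on_Suc_imp[OF Suc.prems(2)]])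
        show "Ck_on k V (\<lambda>y. f' y c)" using Suc.prems(1) c by (simp add: f'_def)
      qed
    qed
  qed
qed

lemma Ck_on_powr: "Ck_on k {0<..} (\<lambda>x::real. x powr a)"
proof (induction k arbitrary: a)
  case (Suc k)
  show ?case
  proof (rule Ck_on_SucI)
    fix x :: real assume "x \<in> {0<..}"
    then show "((\<lambda>x. x powr a) has_derivative (\<lambda>v. (a * x powr (a - 1)) * v)) (at x)"
      using has_real_derivative_powr[of x a] by (simp add: has_field_derivative_def)
  next
    show "Ck_on k {0<..} (\<lambda>x. a * x powr (a - 1) * b)" for b :: real
      by (intro Ck_on_bilinear[OF _ bounded_bilinear_mult] Ck_on_const Suc.IH) auto
  qed simp
qed (simp, intro continuous_intros, auto)

text \<open>The factor \<open>1 / norm\<close> is the power \<open>-1/2\<close> of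
  \<open>f x \<bullet> f x\<close>, so only the smoothness of real powers on the positive axis
  enters.\<close>

lemma Ck_on_normalize:
  fixes U :: "'a::euclidean_space set"
  assumes "open U" "Ck_on k U f" "\<And>x. x \<in> U \<Longrightarrow> f x \<noteq> 0"
  shows "Ck_on k U (\<lambda>x. f x /\<^sub>R norm (f x :: 'b::euclidean_space))"
proof -
  have "Ck_on k U (\<lambda>x. f x \<bullet> f x)"
    by (intro Ck_on_bilinear[OF assms(1) bounded_bilinear_inner] assms)
  then have "Ck_on k U (\<lambda>x. (f x \<bullet> f x) powr (-1/2))"
    by (rule Ck_on_compose[OF assms(1) Ck_on_powr]) (use assms(3) in auto)
  then have "Ck_on k U (\<lambda>x. ((f x \<bullet> f x) powr (-1/2)) *\<^sub>R f x)"
    by (intro Ck_on_bilinear[OF assms(1) bounded_bilinear_scaleR] assms)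
  then show ?thesis
  proof (rule Ck_on_cong[OF assms(1), rotated])
    fix x assume "x \<in> U"
    then show "((f x \<bullet> f x) powr (-1/2)) *\<^sub>R f x = f x /\<^sub>R norm (f x)"
      using assms(3) by (simp add: powr_minus powr_half_sqrt norm_eq_sqrt_inner inverse_eq_divide)
  qed
qed

text \<open>\<open>smooth_on\<close> provides local extensions that need not agree off
  \<open>S\<close>. Composing with a map \<open>n\<close> that lands in \<open>S\<close> removes the
  choice: near each point \<open>u (n x)\<close> equals \<open>g (n x)\<close> for the local
  extension \<open>g\<close>.\<close>

lemma smooth_on_retract:
  fixes u :: "'a::euclidean_space \<Rightarrow> 'b::real_normed_vector" and n :: "'c::euclidean_space \<Rightarrow> 'a"
  assumes "smooth_on S u" "open U" "\<And>k. Ck_on k U n" "n ` U \<subseteq> S"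
  shows "Ck_on k U (\<lambda>x. u (n x))"
proof (rule Ck_on_local)
  fix x assume x: "x \<in> U"
  then obtain X g where Xg: "open X" "n x \<in> X" "\<And>k. Ck_on k X g" "\<And>y. y \<in> S \<inter> X \<Longrightarrow> u y = g y"
  proof -
    from x assms(4) have "n x \<in> S" by blast
    with assms(1) show ?thesis using that unfolding smooth_on_def by metis
  qed
  have "continuous_on U n" using assms(3)[of 0] by simp
  then have o: "open (U \<inter> n -` X)" using \<open>open X\<close> assms(2) by (simp add: continuous_open_preimage)
  have "Ck_on k (U \<inter> n -` X) (\<lambda>x. g (n x))"
    by (rule Ck_on_compose[OF o Xg(3) Ck_on_subset[OF assms(3)]]) auto
  then have "Ck_on k (U \<inter> n -` X) (\<lambda>x. u (n x))"
    by (rule Ck_on_cong[OF o, rotated]) (use Xg assms(4) in force)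
  then show "\<exists>V. open V \<and> x \<in> V \<and> Ck_on k V (\<lambda>x. u (n x))" using o x Xg by blast
qed

section \<open>Characteristic problems in null coordinates\<close>

lemma abs_increment_le:
  fixes f g :: "real \<Rightarrow> real"
  assumes "a \<le> b"
    and f: "\<And>x. a \<le> x \<Longrightarrow> x \<le> b \<Longrightarrow> (f has_real_derivative f' x) (at x)"
    and g: "\<And>x. a \<le> x \<Longrightarrow> x \<le> b \<Longrightarrow> (g has_real_derivative g' x) (at x)"
    and le: "\<And>x. a \<le> x \<Longrightarrow> x \<le> b \<Longrightarrow> \<bar>f' x\<bar> \<le> g' x"
  shows "\<bar>f b - f a\<bar> \<le> g b - g a"
proof -
  have "g a - f a \<le> g b - f b"
    by (rule DERIV_nonneg_imp_nondecreasing[OF \<open>a \<le> b\<close>]) (use DERIV_diff[OF g f] le in fastforce)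
  moreover have "g a + f a \<le> g b + f b"
    by (rule DERIV_nonneg_imp_nondecreasing[OF \<open>a \<le> b\<close>]) (use DERIV_add[OF g f] le in fastforce)
  ultimately show ?thesis by linarith
qed

lemma exp_weight_deriv:
  fixes l :: real assumes "l \<noteq> 0"
  shows "((\<lambda>x. c * exp (l * (x + y)) / l) has_real_derivative c * exp (l * (x + y))) (at x)"
  using assms by (auto intro!: derivative_eq_intros)

text \<open>The weight \<open>exp (- l (x + y))\<close> makes the Volterra operator of the Goursat problem a contraction.\<close>

lemma goursat_zero:
  fixes Z Zx K :: "real \<Rightarrow> real \<Rightarrow> real"
  assumes T: "compact T" and cont: "continuous_on T (\<lambda>(x, y). Z x y)"
    and Dx: "\<And>x y. ((\<lambda>x. Z x y) has_real_derivative Zx x y) (at x)"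
    and Dy: "\<And>x y. ((\<lambda>y. Zx x y) has_real_derivative K x y) (at y)"
    and bound: "\<And>x y. (x, y) \<in> T \<Longrightarrow> \<bar>K x y\<bar> \<le> C * \<bar>Z x y\<bar>"
    and vert: "\<And>x y. (x, y) \<in> T \<Longrightarrow> \<exists>c\<le>y. Zx x c = 0 \<and> (\<forall>y'\<in>{c..y}. (x, y') \<in> T)"
    and hor: "\<And>x y. (x, y) \<in> T \<Longrightarrow> \<exists>a\<le>x. Z a y = 0 \<and> (\<forall>x'\<in>{a..x}. (x', y) \<in> T)"
    and xy: "(x, y) \<in> T"
  shows "Z x y = 0"
proof -
  \<comment> \<open>The integrations in \<open>y\<close> and in \<open>x\<close> each gain a factor
    \<open>1 / l\<close> against the weight, so all that is required is
    \<open>\<bar>C\<bar> < l * l\<close>.\<close>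
  define l where "l = \<bar>C\<bar> + 1"
  have l: "l > 0" "\<bar>C\<bar> < l * l" unfolding l_def by (auto simp: algebra_simps intro: add_pos_nonneg)
  define F where "F = (\<lambda>(x, y). \<bar>Z x y\<bar> * exp (- l * (x + y)))"
  have "continuous_on T F"
    using cont unfolding F_def case_prod_beta by (intro continuous_intros)
  then obtain x1 y1 where p1: "(x1, y1) \<in> T" "\<And>p. p \<in> T \<Longrightarrow> F p \<le> F (x1, y1)"
    using continuous_attains_sup[OF T] xy by fastforce
  define m where "m = F (x1, y1)"
  have m0: "m \<ge> 0" by (simp add: m_def F_def)
  have Zb: "\<bar>Z x y\<bar> \<le> m * exp (l * (x + y))" if "(x, y) \<in> T" for x y
  proof -
    have "\<bar>Z x y\<bar> * exp (- (l * (x + y))) \<le> m" using p1(2)[OF that] by (simp add: m_def F_def)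
    then show ?thesis by (simp only: exp_minus) (simp add: field_simps)
  qed
  have Zxb: "\<bar>Zx x y\<bar> \<le> \<bar>C\<bar> * m / l * exp (l * (x + y))" if xy: "(x, y) \<in> T" for x y
  proof -
    \<comment> \<open>The segment from this zero of \<open>Zx\<close> up to \<open>y\<close> stays
      in \<open>T\<close>. Stated this way, the argument serves triangles and rectangles
      alike.\<close>
    obtain c where c: "c \<le> y" "Zx x c = 0" "\<And>y'. y' \<in> {c..y} \<Longrightarrow> (x, y') \<in> T"
      using vert[OF xy] by blast
    have "\<bar>Zx x y - Zx x c\<bar> \<le> \<bar>C\<bar> * m * exp (l * (y + x)) / l - \<bar>C\<bar> * m * exp (l * (c + x)) / l"
    proof (rule abs_increment_le[OF c(1) Dy exp_weight_deriv])
      fix y' assume "c \<le> y'" "y' \<le> y"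
      then have T': "(x, y') \<in> T" using c by auto
      have "\<bar>K x y'\<bar> \<le> \<bar>C\<bar> * \<bar>Z x y'\<bar>"
        using bound[OF T'] by (meson abs_ge_self abs_ge_zero mult_right_mono order_trans)
      also have "\<dots> \<le> \<bar>C\<bar> * (m * exp (l * (y' + x)))"
        using Zb[OF T'] by (intro mult_left_mono) (auto simp: add.commute)
      finally show "\<bar>K x y'\<bar> \<le> \<bar>C\<bar> * m * exp (l * (y' + x))" by (simp add: mult.assoc)
    qed (use l in auto)
    moreover have "0 \<le> \<bar>C\<bar> * m * exp (l * (c + x)) / l" using l m0 by simp
    ultimately show ?thesis using c(2) by (simp add: add.commute)
  qed
  have "\<bar>Z x1 y1\<bar> \<le> \<bar>C\<bar> * m / l * exp (l * (x1 + y1)) / l"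
  proof -
    obtain a where a: "a \<le> x1" "Z a y1 = 0" "\<And>x'. x' \<in> {a..x1} \<Longrightarrow> (x', y1) \<in> T"
      using hor[OF p1(1)] by blast
    have "\<bar>Z x1 y1 - Z a y1\<bar> \<le> \<bar>C\<bar> * m / l * exp (l * (x1 + y1)) / l - \<bar>C\<bar> * m / l * exp (l * (a + y1)) / l"
      by (rule abs_increment_le[OF a(1) Dx exp_weight_deriv]) (use l a Zxb in auto)
    moreover have "0 \<le> \<bar>C\<bar> * m / l * exp (l * (a + y1)) / l" using l m0 by simp
    ultimately show ?thesis using a(2) by simp
  qed
  moreover have "\<bar>Z x1 y1\<bar> = m * exp (l * (x1 + y1))"
    by (simp add: m_def F_def mult.assoc flip: exp_add)
  \<comment> \<open>At the maximum point of the weighted function the upper bound and the exact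
    value meet, so \<open>m * (l * l) \<le> m * \<bar>C\<bar>\<close>, which forces
    \<open>m = 0\<close>.\<close>
  ultimately have "m * exp (l * (x1 + y1)) * (l * l) \<le> \<bar>C\<bar> * m * exp (l * (x1 + y1))"
    using l by (simp add: field_simps)
  then have "(m * (l * l)) * exp (l * (x1 + y1)) \<le> (m * \<bar>C\<bar>) * exp (l * (x1 + y1))"
    by (simp only: mult_ac)
  then have "m * (l * l) \<le> m * \<bar>C\<bar>" by (rule mult_right_le_imp_le) simp
  then have "m = 0" using m0 l by (cases "m = 0") auto
  then show ?thesis using Zb[OF xy] by simp
qed

text \<open>With \<open>x = t + s\<close> and \<open>y = t - s\<close> the line
  \<open>y = - x\<close> is the initial time. Vanishing of \<open>Z\<close> and \<open>Zx\<close> on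
  it amounts to zero Cauchy data.\<close>

lemma null_cauchy_zero:
  fixes Z Zx K Q :: "real \<Rightarrow> real \<Rightarrow> real"
  assumes cont: "continuous_on UNIV (\<lambda>(x, y). Z x y)" and contQ: "continuous_on UNIV (\<lambda>(x, y). Q x y)"
    and Dx: "\<And>x y. ((\<lambda>x. Z x y) has_real_derivative Zx x y) (at x)"
    and Dy: "\<And>x y. ((\<lambda>y. Zx x y) has_real_derivative K x y) (at y)"
    and K: "\<And>x y. x < r \<Longrightarrow> - x \<le> y \<Longrightarrow> K x y = Q x y * Z x y"
    and data: "\<And>x. x < r \<Longrightarrow> Z x (- x) = 0" "\<And>x. x < r \<Longrightarrow> Zx x (- x) = 0"
    and xy: "x < r" "- x \<le> y"
  shows "Z x y = 0"
proof -
  \<comment> \<open>The backward characteristic triangle of \<open>(x, y)\<close>: a segment running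
    down or to the left from one of its points stays inside until it meets the line
    \<open>y = - x\<close>.\<close>
  define T where "T = ({- y..x} \<times> {- x..y}) \<inter> {(x, y). - x \<le> y}"
  have "closed {(x::real, y). - x \<le> y}"
    unfolding case_prod_beta by (intro closed_Collect_le continuous_intros)
  then have T: "compact T" unfolding T_def by (intro compact_Int_closed compact_Times) auto
  have "compact ((\<lambda>(x, y). Q x y) ` T)"
    by (intro compact_continuous_image T continuous_on_subset[OF contQ]) auto
  then obtain C where C: "\<And>p. p \<in> T \<Longrightarrow> \<bar>case p of (x, y) \<Rightarrow> Q x y\<bar> \<le> C"
    using bounded_iff compact_imp_bounded by (metis imageI real_norm_def)
  show ?thesis
  proof (rule goursat_zero[OF T continuous_on_subset[OF cont] Dx Dy, of C])
    fix x' y' assume p: "(x', y') \<in> T"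
    show "\<bar>K x' y'\<bar> \<le> C * \<bar>Z x' y'\<bar>"
      using C[OF p] K[of x' y'] p xy by (auto simp: T_def abs_mult intro: mult_right_mono)
    show "\<exists>c\<le>y'. Zx x' c = 0 \<and> (\<forall>y''\<in>{c..y'}. (x', y'') \<in> T)"
      by (rule exI[of _ "- x'"]) (use p xy data(2)[of x'] in \<open>auto simp: T_def\<close>)
    show "\<exists>a\<le>x'. Z a y' = 0 \<and> (\<forall>x''\<in>{a..x'}. (x'', y') \<in> T)"
      by (rule exI[of _ "- y'"]) (use p xy data(1)[of "- y'"] in \<open>auto simp: T_def\<close>)
  qed (use xy in \<open>auto simp: T_def\<close>)
qed

lemma null_rectangle_zero:
  fixes Z Zx K Q :: "real \<Rightarrow> real \<Rightarrow> real"
  assumes cont: "continuous_on UNIV (\<lambda>(x, y). Z x y)" and contQ: "continuous_on UNIV (\<lambda>(x, y). Q x y)"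
    and Dx: "\<And>x y. ((\<lambda>x. Z x y) has_real_derivative Zx x y) (at x)"
    and Dy: "\<And>x y. ((\<lambda>y. Zx x y) has_real_derivative K x y) (at y)"
    and K: "\<And>x y. x \<le> x0 \<Longrightarrow> y0 \<le> y \<Longrightarrow> K x y = Q x y * Z x y"
    and top: "\<And>x. x \<le> x0 \<Longrightarrow> Zx x d = 0"
    and left: "\<And>y. y0 \<le> y \<Longrightarrow> Z a y = 0"
    and xy: "a \<le> x0" "y0 \<le> d"
  shows "Z x0 y0 = 0"
proof -
  define T where "T = {a..x0} \<times> {-d..-y0}"
  have T: "compact T" unfolding T_def by (intro compact_Times) auto
  have contm: "continuous_on T (\<lambda>(x, y). f x (- y))" if "continuous_on UNIV (\<lambda>(x, y). f x y)"
    for f :: "real \<Rightarrow> real \<Rightarrow> real"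
  proof -
    have "continuous_on T (\<lambda>p. (fst p, - snd p))" by (intro continuous_intros)
    from continuous_on_compose2[OF that this] show ?thesis by (simp add: case_prod_beta)
  qed
  have "compact ((\<lambda>(x, y). Q x (- y)) ` T)"
    by (intro compact_continuous_image T contm contQ)
  then obtain C where C: "\<And>p. p \<in> T \<Longrightarrow> \<bar>case p of (x, y) \<Rightarrow> Q x (- y)\<bar> \<le> C"
    using bounded_iff compact_imp_bounded by (metis imageI real_norm_def)
  \<comment> \<open>The zero data for \<open>Zx\<close> lie on the top edge \<open>y = d\<close>,
    while \<open>goursat_zero\<close> integrates upwards; reflecting \<open>y\<close> turns the top
    edge into the bottom one.\<close>
  have "Z x0 (- (- y0)) = 0"
  proof (rule goursat_zero[where Z = "\<lambda>x y. Z x (- y)" and Zx = "\<lambda>x y. Zx x (- y)"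
        and K = "\<lambda>x y. - K x (- y)", OF T contm[OF cont] Dx])
    fix x y
    show "((\<lambda>y. Zx x (- y)) has_real_derivative - K x (- y)) (at y)"
      using DERIV_chain2[OF Dy DERIV_minus[OF DERIV_ident]] by simp
  next
    fix x' y' assume p: "(x', y') \<in> T"
    show "\<bar>- K x' (- y')\<bar> \<le> C * \<bar>Z x' (- y')\<bar>"
      using C[OF p] K[of x' "- y'"] p xy by (auto simp: T_def abs_mult intro: mult_right_mono)
    show "\<exists>c\<le>y'. Zx x' (- c) = 0 \<and> (\<forall>y''\<in>{c..y'}. (x', y'') \<in> T)"
      by (rule exI[of _ "- d"]) (use p xy top[of x'] in \<open>auto simp: T_def\<close>)
    show "\<exists>a\<le>x'. Z a (- y') = 0 \<and> (\<forall>x''\<in>{a..x'}. (x'', y') \<in> T)"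
      by (rule exI[of _ a]) (use p xy left[of "- y'"] in \<open>auto simp: T_def\<close>)
  qed (use xy in \<open>auto simp: T_def\<close>)
  then show ?thesis by simp
qed

text \<open>
  A tail-integrable potential makes the Goursat problem with data on the null line \<open>y = \<infinity>\<close> a
  contraction for large \<open>y\<close>.
\<close>

lemma null_infinity_zero:
  fixes Z Zx K :: "real \<Rightarrow> real \<Rightarrow> real" and q H :: "real \<Rightarrow> real"
  assumes cont: "continuous_on UNIV (\<lambda>(x, y). Z x y)"
    and Dx: "\<And>x y. ((\<lambda>x. Z x y) has_real_derivative Zx x y) (at x)"
    and Dy: "\<And>x y. ((\<lambda>y. Zx x y) has_real_derivative K x y) (at y)"
    and K: "\<And>x y. a \<le> x \<Longrightarrow> x \<le> b \<Longrightarrow> Y0 \<le> y \<Longrightarrow> K x y = - (q ((x - y) / 2) / 4) * Z x y"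
    and H: "\<And>s. (H has_real_derivative q s) (at s)" "\<And>s. q s \<ge> 0" "\<And>s. H s \<ge> 0"
    and Hlim: "(H \<longlongrightarrow> 0) at_bot"
    and left: "\<And>y. Y0 \<le> y \<Longrightarrow> Z a y = 0" and ab: "a \<le> b"
    and yn: "\<And>x. filterlim (yn x) at_top sequentially"
    and Zlim: "\<And>x. a \<le> x \<Longrightarrow> x \<le> b \<Longrightarrow> (\<lambda>n. Z x (yn x n)) \<longlonglongrightarrow> 0"
  shows "\<exists>Y\<ge>Y0. \<forall>x\<in>{a..b}. \<forall>y\<ge>Y. Z x y = 0"
proof -
  \<comment> \<open>With this smallness the double integral of the potential over the strip
    \<open>a \<le> x \<le> b\<close>, \<open>y \<ge> Y\<close> is at most \<open>1 / 4\<close>. The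
    summand \<open>1\<close> covers the case \<open>a = b\<close>.\<close>
  have "eventually (\<lambda>s. H s < 1 / (2 * (b - a + 1))) at_bot"
    using Hlim ab by (intro order_tendstoD(2)) auto
  then obtain N where N: "\<And>s. s \<le> N \<Longrightarrow> H s < 1 / (2 * (b - a + 1))"
    unfolding eventually_at_bot_linorder by blast
  define Y where "Y = max Y0 (b - 2 * N)"
  have HY: "H ((b - Y) / 2) * (b - a) / 2 \<le> 1 / 4"
  proof -
    have h: "H ((b - Y) / 2) \<le> 1 / (2 * (b - a + 1))" by (rule less_imp_le[OF N]) (simp add: Y_def)
    have "H ((b - Y) / 2) * (b - a) \<le> 1 / (2 * (b - a + 1)) * (b - a)"
      using h ab by (intro mult_right_mono) auto
    also have "\<dots> \<le> 1 / 2" using ab by (simp add: field_simps)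
    finally show ?thesis by linarith
  qed
  have Hmono: "H s \<le> H s'" if "s \<le> s'" for s s'
    by (rule DERIV_nonneg_imp_nondecreasing[OF that]) (use H in blast)
  \<comment> \<open>Only increments in \<open>y\<close> are estimated, so the behaviour of
    \<open>Zx\<close> for large \<open>y\<close> never enters. Integrating \<open>K\<close> over
    \<open>{y..y'}\<close> and then in \<open>x\<close> from the line \<open>x = a\<close>, where
    \<open>Z\<close> vanishes, costs at most a quarter of the bound on \<open>Z\<close>.\<close>
  have key: "\<bar>Z x y' - Z x y\<bar> \<le> m / 4"
    if m: "\<And>x y''. x \<in> {a..b} \<Longrightarrow> y'' \<in> {y..y'} \<Longrightarrow> \<bar>Z x y''\<bar> \<le> m" and yy: "Y \<le> y" "y \<le> y'"
      and x: "x \<in> {a..b}" for x y y' m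
  proof -
    have m0: "m \<ge> 0" using m[OF x, of y] yy by (smt (verit) abs_ge_zero atLeastAtMost_iff)
    have Zxb: "\<bar>Zx x y' - Zx x y\<bar> \<le> m / 2 * H ((b - Y) / 2)" if x: "x \<in> {a..b}" for x
    proof -
      have "\<bar>Zx x y' - Zx x y\<bar> \<le> - (m / 2 * H ((x - y') / 2)) - - (m / 2 * H ((x - y) / 2))"
      proof (rule abs_increment_le[OF yy(2) Dy])
        fix v assume v: "y \<le> v" "v \<le> y'"
        show "((\<lambda>v. - (m / 2 * H ((x - v) / 2))) has_real_derivative m / 4 * q ((x - v) / 2)) (at v)"
          by (rule derivative_eq_intros DERIV_chain2[OF H(1)] refl | simp)+
        show "\<bar>K x v\<bar> \<le> m / 4 * q ((x - v) / 2)"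
          using K[of x v] m[OF x, of v] v x yy H(2)[of "(x - v) / 2"]
          by (auto simp: Y_def abs_mult mult.commute intro!: mult_right_mono)
      qed
      also have "\<dots> \<le> m / 2 * H ((x - y) / 2)" using m0 H(3) by simp
      also have "\<dots> \<le> m / 2 * H ((b - Y) / 2)"
        using x yy m0 by (intro mult_left_mono Hmono) auto
      finally show ?thesis .
    qed
    have "\<bar>(Z x y' - Z x y) - (Z a y' - Z a y)\<bar> \<le> m / 2 * H ((b - Y) / 2) * x - m / 2 * H ((b - Y) / 2) * a"
    proof (rule abs_increment_le[where f = "\<lambda>x. Z x y' - Z x y", OF _ DERIV_diff[OF Dx Dx]])
      show "((\<lambda>x. m / 2 * H ((b - Y) / 2) * x) has_real_derivative m / 2 * H ((b - Y) / 2)) (at v)" for v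
        by (auto intro!: derivative_eq_intros)
    qed (use x Zxb in auto)
    also have "\<dots> = m / 2 * H ((b - Y) / 2) * (x - a)" by (simp add: algebra_simps)
    also have "\<dots> \<le> m / 2 * H ((b - Y) / 2) * (b - a)"
      using x m0 H(3)[of "(b - Y) / 2"] by (intro mult_left_mono) auto
    also have "\<dots> = m * (H ((b - Y) / 2) * (b - a) / 2)" by simp
    also have "\<dots> \<le> m * (1 / 4)" using HY m0 by (intro mult_left_mono) auto
    finally show ?thesis using left yy unfolding Y_def by simp
  qed
  \<comment> \<open>The supremum over the unbounded strip is not yet known to be finite. At a
    maximum over a compact piece, \<open>key\<close> with lower end \<open>Y\<close> bounds the
    increment by a quarter of that maximum, which is absorbed on the left.\<close>
  have bdd: "\<exists>B. \<forall>x\<in>{a..b}. \<forall>y\<ge>Y. \<bar>Z x y\<bar> \<le> B"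
  proof -
    have "compact ((\<lambda>x. Z x Y) ` {a..b})"
      by (intro compact_continuous_image) (auto intro!: continuous_at_imp_continuous_on DERIV_isCont[OF Dx])
    then obtain B where B: "\<And>x. x \<in> {a..b} \<Longrightarrow> \<bar>Z x Y\<bar> \<le> B"
      using bounded_iff compact_imp_bounded by (metis imageI real_norm_def)
    have "\<bar>Z x y\<bar> \<le> 2 * B" if "x \<in> {a..b}" "Y \<le> y" for x y
    proof -
      have "continuous_on ({a..b} \<times> {Y..y}) (\<lambda>p. \<bar>case p of (x, y) \<Rightarrow> Z x y\<bar>)"
        by (intro continuous_intros continuous_on_subset[OF cont]) auto
      moreover have "compact ({a..b} \<times> {Y..y})" by (intro compact_Times) auto
      moreover have "{a..b} \<times> {Y..y} \<noteq> {}" using that by auto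
      ultimately obtain p where p: "p \<in> {a..b} \<times> {Y..y}"
        "\<forall>p'\<in>{a..b} \<times> {Y..y}. \<bar>case p' of (x, y) \<Rightarrow> Z x y\<bar> \<le> \<bar>case p of (x, y) \<Rightarrow> Z x y\<bar>"
        using continuous_attains_sup by blast
      obtain x1 y1 where "p = (x1, y1)" by fastforce
      with p have p1: "x1 \<in> {a..b}" "y1 \<in> {Y..y}"
        "\<And>x' y'. x' \<in> {a..b} \<Longrightarrow> y' \<in> {Y..y} \<Longrightarrow> \<bar>Z x' y'\<bar> \<le> \<bar>Z x1 y1\<bar>" by auto
      have "\<bar>Z x1 y1 - Z x1 Y\<bar> \<le> \<bar>Z x1 y1\<bar> / 4"
        by (rule key) (use p1 in auto)
      moreover have "\<bar>Z x y\<bar> \<le> \<bar>Z x1 y1\<bar>" using p1(3) that by auto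
      ultimately show ?thesis using B[OF p1(1)] by linarith
    qed
    then show ?thesis by blast
  qed
  define S where "S = (SUP p\<in>{a..b} \<times> {Y..}. \<bar>Z (fst p) (snd p)\<bar>)"
  have bdda: "bdd_above ((\<lambda>p. \<bar>Z (fst p) (snd p)\<bar>) ` ({a..b} \<times> {Y..}))"
  proof -
    obtain B where "\<forall>x\<in>{a..b}. \<forall>y\<ge>Y. \<bar>Z x y\<bar> \<le> B" using bdd by blast
    then show ?thesis by (intro bdd_aboveI[of _ B]) auto
  qed
  have SZ: "\<bar>Z x y\<bar> \<le> S" if "x \<in> {a..b}" "Y \<le> y" for x y
    unfolding S_def by (rule cSUP_upper2[OF bdda, of "(x, y)"]) (use that in auto)
  \<comment> \<open>Comparison with far points on the same line of constant \<open>x\<close>, where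
    \<open>Z\<close> tends to zero along \<open>yn x\<close>, improves the bound \<open>S\<close> to
    \<open>S / 4\<close>.\<close>
  have Zle: "\<bar>Z x y\<bar> \<le> S / 4" if xy: "x \<in> {a..b}" "Y \<le> y" for x y
  proof (rule tendsto_le[OF sequentially_bot])
    show "(\<lambda>n. \<bar>Z x (yn x n)\<bar> + S / 4) \<longlonglongrightarrow> S / 4"
      using tendsto_add[OF tendsto_rabs[OF Zlim] tendsto_const[of "S/4"], of x] xy by simp
    have "eventually (\<lambda>n. y \<le> yn x n) sequentially" using yn[of x] by (simp add: filterlim_at_top)
    then show "eventually (\<lambda>n. \<bar>Z x y\<bar> \<le> \<bar>Z x (yn x n)\<bar> + S / 4) sequentially"
    proof eventually_elim
      case (elim n)
      have "\<bar>Z x (yn x n) - Z x y\<bar> \<le> S / 4" by (rule key) (use SZ elim xy in auto)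
      then show ?case by linarith
    qed
  qed simp
  have "S \<le> S / 4"
    unfolding S_def[symmetric]
    by (subst S_def, rule cSUP_least) (use Zle ab in auto)
  moreover have "0 \<le> S" using SZ[of a Y] ab by (smt (verit) atLeastAtMost_iff)
  ultimately have "S = 0" by linarith
  then show ?thesis using SZ by (intro exI[of _ Y]) (auto simp: Y_def)
qed

section \<open>Waves on the plane in null coordinates\<close>

lemma DERIV_two_variables:
  fixes f ft fs :: "real \<Rightarrow> real \<Rightarrow> real"
  assumes t: "\<And>t s. ((\<lambda>t. f t s) has_real_derivative ft t s) (at t)"
    and s: "\<And>t s. ((\<lambda>s. f t s) has_real_derivative fs t s) (at s)"
    and cont: "continuous_on UNIV (\<lambda>(t, s). fs t s)"
    and a: "(a has_real_derivative a') (at x)" and b: "(b has_real_derivative b') (at x)"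
  shows "((\<lambda>x. f (a x) (b x)) has_real_derivative ft (a x) (b x) * a' + fs (a x) (b x) * b') (at x)"
proof -
  have c: "isCont (\<lambda>(t, s). blinfun_mult_right (fs t s)) (a x, b x)"
  proof -
    have "continuous_on UNIV (\<lambda>(t, s). blinfun_mult_right (fs t s))"
      using bounded_linear.continuous_on[OF bounded_linear_blinfun_mult_right cont]
      by (simp add: case_prod_beta)
    then show ?thesis by (simp add: continuous_on_eq_continuous_at)
  qed
  have "((\<lambda>(t, s). f t s) has_derivative (\<lambda>(u, v). ft (a x) (b x) * u + blinfun_mult_right (fs (a x) (b x)) v))
      (at (a x, b x) within UNIV \<times> UNIV)"
    by (rule has_derivative_partialsI)
       (use t s c in \<open>simp_all add: has_field_derivative_def\<close>)
  then have "((\<lambda>(t, s). f t s) has_derivative (\<lambda>(u, v). ft (a x) (b x) * u + fs (a x) (b x) * v)) (at (a x, b x))"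
    by simp
  moreover have "((\<lambda>x. (a x, b x)) has_derivative (\<lambda>h. (a' * h, b' * h))) (at x)"
    using a b by (intro has_derivative_Pair) (simp_all add: has_field_derivative_def)
  ultimately have "((\<lambda>x. (\<lambda>(t, s). f t s) (a x, b x)) has_derivative
      (\<lambda>h. (\<lambda>(u, v). ft (a x) (b x) * u + fs (a x) (b x) * v) (a' * h, b' * h))) (at x)"
    by (rule has_derivative_compose[rotated])
  then show ?thesis
    unfolding has_field_derivative_def prod.case
    by (rule has_derivative_eq_rhs) (auto simp: algebra_simps)
qed

locale C2_plane =
  fixes w wt ws wtt wts wss :: "real \<Rightarrow> real \<Rightarrow> real"
  assumes w_t: "((\<lambda>t. w t s) has_real_derivative wt t s) (at t)"
    and w_s: "((\<lambda>s. w t s) has_real_derivative ws t s) (at s)"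
    and wt_t: "((\<lambda>t. wt t s) has_real_derivative wtt t s) (at t)"
    and wt_s: "((\<lambda>s. wt t s) has_real_derivative wts t s) (at s)"
    and ws_t: "((\<lambda>t. ws t s) has_real_derivative wts t s) (at t)"
    and ws_s: "((\<lambda>s. ws t s) has_real_derivative wss t s) (at s)"
    and cont_w: "continuous_on UNIV (\<lambda>(t, s). w t s)"
    and cont_ws: "continuous_on UNIV (\<lambda>(t, s). ws t s)"
    and cont_wts: "continuous_on UNIV (\<lambda>(t, s). wts t s)"
    and cont_wss: "continuous_on UNIV (\<lambda>(t, s). wss t s)"
begin

text \<open>Null coordinates \<open>x = t + s\<close> and \<open>y = t - s\<close>: the mixed
  derivative is a quarter of the wave operator, and letting \<open>s\<close> tend to minus infinity
  at fixed \<open>x\<close> sends \<open>y\<close> to plus infinity.\<close>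

definition Z where "Z x y = w ((x + y) / 2) ((x - y) / 2)"
definition Zx where "Zx x y = (wt ((x + y) / 2) ((x - y) / 2) + ws ((x + y) / 2) ((x - y) / 2)) / 2"
definition Zxy where "Zxy x y = (wtt ((x + y) / 2) ((x - y) / 2) - wss ((x + y) / 2) ((x - y) / 2)) / 4"

lemma DERIV_Z: "((\<lambda>x. Z x y) has_real_derivative Zx x y) (at x)"
  unfolding Z_def Zx_def
  by (rule DERIV_cong, rule DERIV_two_variables[OF w_t w_s cont_ws, where a' = "1/2" and b' = "1/2"])
     (auto intro!: derivative_eq_intros)

lemma DERIV_Zx: "((\<lambda>y. Zx x y) has_real_derivative Zxy x y) (at y)"
proof -
  have a: "((\<lambda>y. (x + y) / 2) has_real_derivative 1/2) (at y)" for y :: real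
    by (auto intro!: derivative_eq_intros)
  have b: "((\<lambda>y. (x - y) / 2) has_real_derivative -1/2) (at y)" for y :: real
    by (auto intro!: derivative_eq_intros)
  have "((\<lambda>y. (wt ((x + y) / 2) ((x - y) / 2) + ws ((x + y) / 2) ((x - y) / 2)) / 2) has_real_derivative Zxy x y) (at y)"
    by (rule DERIV_cong, rule DERIV_cdivide[OF DERIV_add[OF
         DERIV_two_variables[OF wt_t wt_s cont_wts a b] DERIV_two_variables[OF ws_t ws_s cont_wss a b]]])
       (simp add: Zxy_def)
  then show ?thesis by (simp add: Zx_def[abs_def])
qed

lemma w_eq_Z: "w t s = Z (t + s) (t - s)"
  by (simp add: Z_def)

lemma continuous_Z: "continuous_on UNIV (\<lambda>(x, y). Z x y)"
proof -
  have "continuous_on UNIV (\<lambda>p. ((fst p + snd p) / 2, (fst p - snd p) / 2 :: real))"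
    by (intro continuous_intros) auto
  from continuous_on_compose2[OF cont_w this] show ?thesis by (simp add: case_prod_beta Z_def)
qed

text \<open>Statements about the past horizon and about negative times are obtained from their
  future counterparts by this reversal.\<close>

lemma time_reversed:
  "C2_plane (\<lambda>t s. w (- t) s) (\<lambda>t s. - wt (- t) s) (\<lambda>t s. ws (- t) s)
     (\<lambda>t s. wtt (- t) s) (\<lambda>t s. - wts (- t) s) (\<lambda>t s. wss (- t) s)"
proof -
  have c: "continuous_on UNIV (\<lambda>(t, s). f (- t) s)" if "continuous_on UNIV (\<lambda>(t, s). f t s)"
    for f :: "real \<Rightarrow> real \<Rightarrow> real"
  proof -
    have "continuous_on UNIV (\<lambda>p :: real \<times> real. (- fst p, snd p))" by (intro continuous_intros)
    from continuous_on_compose2[OF that this] show ?thesis by (simp add: case_prod_beta)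
  qed
  have d: "((\<lambda>t. f (- t) s) has_real_derivative - f' (- t) s) (at t)"
    if "\<And>t s. ((\<lambda>t. f t s) has_real_derivative f' t s) (at t)" for f f' :: "real \<Rightarrow> real \<Rightarrow> real" and t s
    using DERIV_chain2[OF that[of s "- t"] DERIV_minus[OF DERIV_ident]] by simp
  show ?thesis
  proof unfold_locales
    fix t s
    show "((\<lambda>t. w (- t) s) has_real_derivative - wt (- t) s) (at t)" by (rule d[OF w_t])
    show "((\<lambda>s. w (- t) s) has_real_derivative ws (- t) s) (at s)" by (rule w_s)
    show "((\<lambda>t. - wt (- t) s) has_real_derivative wtt (- t) s) (at t)"
      using DERIV_minus[OF d[OF wt_t]] by simp
    show "((\<lambda>s. - wt (- t) s) has_real_derivative - wts (- t) s) (at s)" by (rule DERIV_minus[OF wt_s])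
    show "((\<lambda>t. ws (- t) s) has_real_derivative - wts (- t) s) (at t)" by (rule d[OF ws_t])
    show "((\<lambda>s. ws (- t) s) has_real_derivative wss (- t) s) (at s)" by (rule ws_s)
    show "continuous_on UNIV (\<lambda>(t, s). - wts (- t) s)"
      using continuous_on_minus[OF c[OF cont_wts]] by (simp add: case_prod_beta)
  qed (rule c cont_w cont_ws cont_wss)+
qed

end

lemma continuous_potential:
  fixes q :: "real \<Rightarrow> real"
  assumes "continuous_on UNIV q"
  shows "continuous_on UNIV (\<lambda>(x, y). - (q ((x - y) / 2) / 4))"
proof -
  have "continuous_on UNIV (\<lambda>p :: real \<times> real. (fst p - snd p) / 2)" by (intro continuous_intros) auto
  from continuous_on_compose2[OF assms this] have "continuous_on UNIV (\<lambda>p :: real \<times> real. q ((fst p - snd p) / 2))"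
    by auto
  then show ?thesis unfolding case_prod_beta by (intro continuous_intros) auto
qed

lemma (in C2_plane) finite_propagation_future:
  assumes q: "continuous_on UNIV q"
    and eq: "\<And>t s. t + s < r \<Longrightarrow> - r < t - s \<Longrightarrow> wtt t s - wss t s = - q s * w t s"
    and data: "\<And>s. s < r \<Longrightarrow> w 0 s = 0" "\<And>s. s < r \<Longrightarrow> wt 0 s = 0"
    and ts: "t + s < r" "0 \<le> t"
  shows "w t s = 0"
proof -
  \<comment> \<open>\<open>Zx\<close> contains \<open>ws\<close> as well as \<open>wt\<close>. This
    tangential derivative vanishes because the data vanish on an open half-line.\<close>
  have ws0: "ws 0 s = 0" if "s < r" for s
  proof -
    have "((\<lambda>s. 0) has_real_derivative ws 0 s) (at s)"
      by (rule has_field_derivative_transform_within_open[OF w_s, of "{..<r}"]) (use that data in auto)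
    then show ?thesis by (rule DERIV_unique) simp
  qed
  have "Z (t + s) (t - s) = 0"
  proof (rule null_cauchy_zero[OF continuous_Z continuous_potential[OF q] DERIV_Z DERIV_Zx])
    show "Zxy x y = - (q ((x - y) / 2) / 4) * Z x y" if "x < r" "- x \<le> y" for x y
      using eq[of "(x + y) / 2" "(x - y) / 2"] that by (simp add: Zxy_def Z_def field_simps)
    show "Zx x (- x) = 0" if "x < r" for x using ws0[OF that] data(2)[OF that] by (simp add: Zx_def)
  qed (use data ts in \<open>auto simp: Z_def\<close>)
  then show ?thesis by (simp add: w_eq_Z)
qed

text \<open>The region is the set \<open>\<bar>t\<bar> + s < r\<close>, hence invariant under time
  reversal, which reduces negative times to positive ones.\<close>

lemma (in C2_plane) finite_propagation:
  assumes q: "continuous_on UNIV q"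
    and eq: "\<And>t s. t + s < r \<Longrightarrow> - r < t - s \<Longrightarrow> wtt t s - wss t s = - q s * w t s"
    and data: "\<And>s. s < r \<Longrightarrow> w 0 s = 0" "\<And>s. s < r \<Longrightarrow> wt 0 s = 0"
    and ts: "t + s < r" "- r < t - s"
  shows "w t s = 0"
proof (cases "0 \<le> t")
  case True
  then show ?thesis using finite_propagation_future[OF q eq data] ts by blast
next
  case False
  have "w (- (- t)) s = 0"
    by (rule C2_plane.finite_propagation_future[OF time_reversed q]) (use eq data ts False in auto)
  then show ?thesis by simp
qed

lemma (in C2_plane) vanishing_near_horizon:
  assumes eq: "\<And>t s. t + s < \<tau>0 \<Longrightarrow> - \<tau>0 < t - s \<Longrightarrow> wtt t s - wss t s = - q s * w t s"
    and H: "\<And>s. (H has_real_derivative q s) (at s)" "\<And>s. q s \<ge> 0" "(H \<longlongrightarrow> L) at_bot"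
    and left: "\<And>t s. t + s < r \<Longrightarrow> - r < t - s \<Longrightarrow> w t s = 0"
    and b: "b < \<tau>0"
    and sn: "filterlim sn at_bot sequentially"
    and wlim: "\<And>x. r - 1 \<le> x \<Longrightarrow> x \<le> b \<Longrightarrow> (\<lambda>n. w (x - sn n) (sn n)) \<longlonglongrightarrow> 0"
  shows "\<exists>Y. \<forall>x\<le>b. \<forall>y\<ge>Y. Z x y = 0"
proof -
  \<comment> \<open>One unit inside the region \<open>x < r\<close> where \<open>left\<close>
    applies, so the line \<open>x = a\<close> carries zero data. \<open>Y0\<close> keeps
    \<open>y\<close> above both \<open>- r\<close> and \<open>- \<tau>0\<close>.\<close>
  define a where "a = r - 1"
  define Y0 where "Y0 = max (- r) (- \<tau>0) + 1"
  have Zleft: "Z x y = 0" if "x < r" "- r < y" for x y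
    using left[of "(x + y) / 2" "(x - y) / 2"] that by (simp add: Z_def field_simps)
  have HL: "L \<le> H s" for s
  proof (rule tendsto_upperbound[OF H(3)])
    have "H s' \<le> H s" if "s' \<le> s" for s'
      by (rule DERIV_nonneg_imp_nondecreasing[OF that]) (use H in blast)
    then show "eventually (\<lambda>s'. H s' \<le> H s) at_bot" by (auto simp: eventually_at_bot_linorder)
  qed simp
  show ?thesis
  proof (cases "a \<le> b")
    case True
    have "\<exists>Y\<ge>Y0. \<forall>x\<in>{a..b}. \<forall>y\<ge>Y. Z x y = 0"
    proof (rule null_infinity_zero[OF continuous_Z DERIV_Z DERIV_Zx])
      show "Zxy x y = - (q ((x - y) / 2) / 4) * Z x y" if "a \<le> x" "x \<le> b" "Y0 \<le> y" for x y
        using eq[of "(x + y) / 2" "(x - y) / 2"] that b by (simp add: Zxy_def Z_def Y0_def field_simps)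
      show "((\<lambda>s. H s - L) \<longlongrightarrow> 0) at_bot" using tendsto_diff[OF H(3) tendsto_const[of L]] by simp
      show "((\<lambda>s. H s - L) has_real_derivative q s) (at s)" for s
        using H(1) by (auto intro!: derivative_eq_intros)
      show "Z a y = 0" if "Y0 \<le> y" for y by (rule Zleft) (use that in \<open>auto simp: a_def Y0_def\<close>)
      \<comment> \<open>On the line of constant \<open>x\<close>, the point with space coordinate
        \<open>sn n\<close> has \<open>y = x - 2 * sn n\<close>.\<close>
      show "filterlim (\<lambda>n. x + 2 * - sn n) at_top sequentially" for x
        using sn by (intro filterlim_tendsto_add_at_top[OF tendsto_const] filterlim_tendsto_pos_mult_at_top[OF tendsto_const])
          (auto simp: filterlim_uminus_at_top)
      show "(\<lambda>n. Z x (x + 2 * - sn n)) \<longlonglongrightarrow> 0" if "a \<le> x" "x \<le> b" for x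
        using wlim[of x] that by (simp add: Z_def a_def diff_divide_distrib)
    qed (use True H(2) HL in auto)
    then obtain Y where Y: "Y \<ge> Y0" "\<And>x y. x \<in> {a..b} \<Longrightarrow> y \<ge> Y \<Longrightarrow> Z x y = 0" by blast
    have "Z x y = 0" if "x \<le> b" "y \<ge> Y" for x y
    proof (cases "a \<le> x")
      case True
      then show ?thesis using Y(2) that by auto
    next
      case False
      then show ?thesis using Zleft[of x y] Y(1) that by (auto simp: a_def Y0_def)
    qed
    then show ?thesis by blast
  next
    case False
    have "Z x y = 0" if "x \<le> b" "y \<ge> Y0" for x y
      using Zleft[of x y] False that by (auto simp: a_def Y0_def)
    then show ?thesis by blast
  qed
qed

text \<open>The future limits make \<open>Z\<close> vanish for large \<open>y\<close>, the past
  limits for very negative \<open>x\<close>. Between the given point and these two regions there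
  remains a rectangle with zero data on its top and left edges.\<close>

lemma (in C2_plane) quadrant_zero:
  assumes q: "continuous_on UNIV q"
    and eq: "\<And>t s. t + s < \<tau>0 \<Longrightarrow> - \<tau>0 < t - s \<Longrightarrow> wtt t s - wss t s = - q s * w t s"
    and H: "\<And>s. (H has_real_derivative q s) (at s)" "\<And>s. q s \<ge> 0" "(H \<longlongrightarrow> L) at_bot"
    and left: "\<And>t s. t + s < r \<Longrightarrow> - r < t - s \<Longrightarrow> w t s = 0"
    and future: "\<And>b. b < \<tau>0 \<Longrightarrow> \<exists>sn. filterlim sn at_bot sequentially \<and>
        (\<forall>x\<in>{r - 1..b}. (\<lambda>n. w (x - sn n) (sn n)) \<longlonglongrightarrow> 0)"
    and past: "\<And>b. b < \<tau>0 \<Longrightarrow> \<exists>sn. filterlim sn at_bot sequentially \<and>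
        (\<forall>x\<in>{r - 1..b}. (\<lambda>n. w (- (x - sn n)) (sn n)) \<longlonglongrightarrow> 0)"
    and ts: "t + s < \<tau>0" "- \<tau>0 < t - s"
  shows "w t s = 0"
proof -
  \<comment> \<open>The midpoint leaves room on both sides: the limits are only available for
    \<open>b < \<tau>0\<close>, and \<open>t + s < b\<close> must be strict so that
    \<open>Zx\<close> can be computed from zeros on an open set.\<close>
  define b where "b = (max (t + s) (s - t) + \<tau>0) / 2"
  have b: "b < \<tau>0" "t + s < b" "s - t < b" using ts by (auto simp: b_def max_def)
  obtain sn where sn: "filterlim sn at_bot sequentially"
    "\<And>x. x \<in> {r - 1..b} \<Longrightarrow> (\<lambda>n. w (x - sn n) (sn n)) \<longlonglongrightarrow> 0" using future[OF b(1)] by blast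
  obtain Y where Y: "\<And>x y. x \<le> b \<Longrightarrow> y \<ge> Y \<Longrightarrow> Z x y = 0"
    using vanishing_near_horizon[OF eq H left b(1) sn(1), of r] sn(2) by fastforce
  obtain sn' where sn': "filterlim sn' at_bot sequentially"
    "\<And>x. x \<in> {r - 1..b} \<Longrightarrow> (\<lambda>n. w (- (x - sn' n)) (sn' n)) \<longlonglongrightarrow> 0" using past[OF b(1)] by blast
  interpret rev: C2_plane "\<lambda>t s. w (- t) s" "\<lambda>t s. - wt (- t) s" "\<lambda>t s. ws (- t) s"
     "\<lambda>t s. wtt (- t) s" "\<lambda>t s. - wts (- t) s" "\<lambda>t s. wss (- t) s"
    by (rule time_reversed)
  have "\<exists>Y. \<forall>x\<le>b. \<forall>y\<ge>Y. rev.Z x y = 0"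
    by (rule rev.vanishing_near_horizon[OF _ H, of \<tau>0 r b sn'])
       (use eq left b sn' in auto)
  then obtain X where X: "\<And>x y. x \<le> b \<Longrightarrow> y \<ge> X \<Longrightarrow> rev.Z x y = 0" by blast
  \<comment> \<open>Time reversal acts on null coordinates by
    \<open>(x, y) \<mapsto> (- y, - x)\<close>.\<close>
  have X': "Z x y = 0" if "x \<le> - X" "- b \<le> y" for x y
    using X[of "- y" "- x"] that by (simp add: Z_def rev.Z_def minus_divide_left add.commute)
  define d where "d = max Y (t - s)"
  have "Z (t + s) (t - s) = 0"
  proof (rule null_rectangle_zero[OF continuous_Z continuous_potential[OF q] DERIV_Z DERIV_Zx,
        where d = d and a = "min (- X) (t + s)"])
    show "Zxy x y = - (q ((x - y) / 2) / 4) * Z x y" if "x \<le> t + s" "t - s \<le> y" for x y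
      using eq[of "(x + y) / 2" "(x - y) / 2"] that ts by (simp add: Zxy_def Z_def field_simps)
    show "Zx x d = 0" if "x \<le> t + s" for x
    proof -
      have "((\<lambda>x. 0) has_real_derivative Zx x d) (at x)"
        by (rule has_field_derivative_transform_within_open[OF DERIV_Z, of "{..<b}"])
           (use that b Y in \<open>auto simp: d_def\<close>)
      then show ?thesis by (rule DERIV_unique) simp
    qed
    show "Z (min (- X) (t + s)) y = 0" if "t - s \<le> y" for y
      by (rule X') (use that b in auto)
  qed (auto simp: d_def)
  then show ?thesis by (simp add: w_eq_Z)
qed

section \<open>Integration over the sphere in polar angles\<close>

text \<open>\<open>f x y - f x c\<close> is the integral of \<open>fy\<close> over
  \<open>{c..y}\<close>; differentiating under the integral sign in \<open>x\<close> and then in the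
  upper limit gives the other order. One continuous mixed derivative thus yields both.\<close>

lemma mixed_derivative_swap:
  fixes f fx fy fyx :: "real \<Rightarrow> real \<Rightarrow> real"
  assumes x: "\<And>x y. ((\<lambda>x. f x y) has_real_derivative fx x y) (at x)"
    and y: "\<And>x y. ((\<lambda>y. f x y) has_real_derivative fy x y) (at y)"
    and yx: "\<And>x y. ((\<lambda>x. fy x y) has_real_derivative fyx x y) (at x)"
    and cont: "continuous_on UNIV (\<lambda>(x, y). fy x y)" "continuous_on UNIV (\<lambda>(x, y). fyx x y)"
  shows "((\<lambda>y. fx x y) has_real_derivative fyx x y) (at y)"
proof -
  define c where "c = y - 1"
  have cy: "continuous_on A (\<lambda>y. g x y)" if "continuous_on UNIV (\<lambda>(x, y). g x y)"
    for g :: "real \<Rightarrow> real \<Rightarrow> real" and x A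
  proof -
    have "continuous_on A (\<lambda>y :: real. (x, y))" by (intro continuous_intros)
    from continuous_on_compose2[OF that this] show ?thesis by simp
  qed
  have f: "f x y - f x c = integral {c..y} (fy x)" if "c \<le> y" for x y
    using fundamental_theorem_of_calculus[OF that, of "f x" "fy x"] y
    by (metis has_real_derivative_iff_has_vector_derivative has_vector_derivative_at_within integral_unique)
  have fx: "fx x y - fx x c = integral {c..y} (fyx x)" if "c \<le> y" for y
  proof -
    have "((\<lambda>x. integral (cbox c y) (fy x)) has_real_derivative integral (cbox c y) (fyx x)) (at x within UNIV)"
      by (rule leibniz_rule_field_derivative)
         (use yx in \<open>auto intro!: integrable_continuous_real cy cont continuous_on_subset[OF cont(2)]\<close>)
    then have "((\<lambda>x. f x y - f x c) has_real_derivative integral {c..y} (fyx x)) (at x)"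
      by (simp add: f[OF that])
    moreover have "((\<lambda>x. f x y - f x c) has_real_derivative fx x y - fx x c) (at x)"
      by (rule DERIV_diff[OF x x])
    ultimately show ?thesis by (rule DERIV_unique[symmetric])
  qed
  have "((\<lambda>y. integral {c..y} (fyx x)) has_real_derivative fyx x y) (at y within {c..y + 1})"
    by (rule integral_has_real_derivative) (auto intro: cy cont simp: c_def)
  moreover have "at y within {c..y + 1} = at y"
    by (rule at_within_interior) (auto simp: c_def)
  ultimately have "((\<lambda>y. fx x c + integral {c..y} (fyx x)) has_real_derivative fyx x y) (at y)"
    by (auto intro!: derivative_eq_intros)
  then show ?thesis
  proof (rule has_field_derivative_transform_within_open[of _ _ _ "{c<..}"])
    show "fx x c + integral {c..y} (fyx x) = fx x y" if "y \<in> {c<..}" for y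
      using fx[of y] that by simp
  qed (auto simp: c_def)
qed

section \<open>Polar angles and integration over the sphere\<close>

definition polar :: "real \<times> real \<Rightarrow> vec3" where
  "polar z = vector [sin (fst z) * cos (snd z), sin (fst z) * sin (snd z), cos (fst z)]"

abbreviation polar_box :: "(real \<times> real) set" where
  "polar_box \<equiv> cbox (0, 0) (pi, 2 * pi)"

text \<open>Integrands are functions of the angles and not of points of \<open>S2\<close>, because
  angular derivatives in the polar frame still depend on \<open>q\<close> at the poles.\<close>

definition sphere_integral :: "(real \<times> real \<Rightarrow> real) \<Rightarrow> real" where
  "sphere_integral f = integral polar_box (\<lambda>z. f z * sin (fst z))"

lemma polar_nth [simp]:
  "polar z $ 1 = sin (fst z) * cos (snd z)" "polar z $ 2 = sin (fst z) * sin (snd z)" "polar z $ 3 = cos (fst z)"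
  by (simp_all add: polar_def)

lemma norm_vec3: "norm (v :: vec3) = sqrt ((v $ 1)\<^sup>2 + (v $ 2)\<^sup>2 + (v $ 3)\<^sup>2)"
  by (simp add: norm_vec_def L2_set_def sum_3)

lemma polar_in_sphere: "polar z \<in> S2"
proof -
  have "(sin (fst z) * cos (snd z))\<^sup>2 + (sin (fst z) * sin (snd z))\<^sup>2 + (cos (fst z))\<^sup>2
      = (sin (fst z))\<^sup>2 * ((sin (snd z))\<^sup>2 + (cos (snd z))\<^sup>2) + (cos (fst z))\<^sup>2"
    by (simp only: power_mult_distrib distrib_left add_ac)
  then show ?thesis by (simp add: norm_vec3)
qed

lemma continuous_polar:
  "continuous_on A polar"
proof -
  have "polar = (\<lambda>z. \<Sum>i\<in>UNIV. polar z $ i *\<^sub>R axis i 1)"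
    by (simp add: fun_eq_iff vec_eq_iff axis_def sum_3 forall_3)
  moreover have "continuous_on A (\<lambda>z. \<Sum>i\<in>UNIV. polar z $ i *\<^sub>R (axis i 1 :: vec3))"
    unfolding sum_3 polar_nth by (intro continuous_intros)
  ultimately show ?thesis by metis
qed

lemma polar_surj:
  assumes "v \<in> S2"
  obtains p q where "0 \<le> p" "p \<le> pi" "0 \<le> q" "q < 2 * pi" "v = polar (p, q)"
proof -
  have n: "(v $ 1)\<^sup>2 + (v $ 2)\<^sup>2 + (v $ 3)\<^sup>2 = 1" using assms by (simp add: norm_vec3)
  then have "(v $ 3)\<^sup>2 \<le> 1\<^sup>2" by (smt (verit) one_power2 zero_le_power2)
  then have "\<bar>v $ 3\<bar> \<le> 1" using abs_le_square_iff[of "v $ 3" 1] by simp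
  then have b: "-1 \<le> v $ 3" "v $ 3 \<le> 1" by auto
  define p where "p = arccos (v $ 3)"
  have p: "0 \<le> p" "p \<le> pi" "cos p = v $ 3" "sin p = sqrt (1 - (v $ 3)\<^sup>2)"
    using b by (auto simp: p_def arccos_lbound arccos_ubound sin_arccos_abs)
  have sp: "(sin p)\<^sup>2 = (v $ 1)\<^sup>2 + (v $ 2)\<^sup>2"
    using n p(3) sin_squared_eq[of p] by simp
  show ?thesis
  proof (cases "sin p = 0")
    case True
    then have "v $ 1 = 0" "v $ 2 = 0" using sp by (auto simp: sum_power2_eq_zero_iff)
    then have "v = polar (p, 0)" using True p by (simp add: vec_eq_iff forall_3)
    then show ?thesis using that[of p 0] p by simp
  next
    case False
    then have "(v $ 1 / sin p)\<^sup>2 + (v $ 2 / sin p)\<^sup>2 = 1"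
      by (simp add: power_divide add_divide_distrib[symmetric] flip: sp)
    then obtain q where q: "0 \<le> q" "q < 2 * pi" "v $ 1 / sin p = cos q" "v $ 2 / sin p = sin q"
      using sincos_total_2pi by metis
    then have "v = polar (p, q)" using False p by (simp add: vec_eq_iff forall_3 field_simps)
    then show ?thesis using that p q by blast
  qed
qed

lemma continuous_sphere_weight:
  fixes f :: "'a::t2_space \<Rightarrow> real \<times> real \<Rightarrow> real"
  assumes "continuous_on UNIV (\<lambda>(x, z). f x z)"
  shows "continuous_on (UNIV \<times> polar_box) (\<lambda>(x, z). f x z * sin (fst z))"
proof -
  have "continuous_on UNIV (\<lambda>p. f (fst p) (snd p) * sin (fst (snd p)))"
    using assms unfolding case_prod_beta by (intro continuous_intros)
  then show ?thesis unfolding case_prod_beta by (rule continuous_on_subset) simp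
qed

lemma continuous_sphere_integral:
  fixes f :: "'a::t2_space \<Rightarrow> real \<times> real \<Rightarrow> real"
  assumes "continuous_on UNIV (\<lambda>(x, z). f x z)"
  shows "continuous_on UNIV (\<lambda>x. sphere_integral (f x))"
  unfolding sphere_integral_def
  by (rule integral_continuous_on_param[OF continuous_sphere_weight[OF assms]])

lemma DERIV_sphere_integral:
  fixes f f' :: "real \<Rightarrow> real \<times> real \<Rightarrow> real"
  assumes D: "\<And>x z. ((\<lambda>x. f x z) has_real_derivative f' x z) (at x)"
    and c: "\<And>x. continuous_on UNIV (f x)" and c': "continuous_on UNIV (\<lambda>(x, z). f' x z)"
  shows "((\<lambda>x. sphere_integral (f x)) has_real_derivative sphere_integral (f' x)) (at x)"
proof -
  have "((\<lambda>x. integral polar_box (\<lambda>z. f x z * sin (fst z))) has_real_derivative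
      integral polar_box (\<lambda>z. f' x z * sin (fst z))) (at x within UNIV)"
    by (intro leibniz_rule_field_derivative)
       (auto intro!: DERIV_cmult_right D integrable_continuous continuous_intros continuous_on_subset[OF c]
         continuous_sphere_weight[OF c'])
  then show ?thesis by (simp add: sphere_integral_def)
qed

lemma integrable_polar: "continuous_on UNIV f \<Longrightarrow> (f :: real \<times> real \<Rightarrow> real) integrable_on polar_box"
  by (rule integrable_continuous, rule continuous_on_subset) auto

lemma sphere_integrable:
  "continuous_on UNIV f \<Longrightarrow> (\<lambda>z. f z * sin (fst z)) integrable_on polar_box"
  by (intro integrable_polar continuous_intros)

lemma sphere_integral_add:
  "continuous_on UNIV f \<Longrightarrow> continuous_on UNIV g \<Longrightarrow>
     sphere_integral (\<lambda>z. f z + g z) = sphere_integral f + sphere_integral g"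
  unfolding sphere_integral_def distrib_right
  by (rule Henstock_Kurzweil_Integration.integral_add; rule sphere_integrable)

lemma sphere_integral_cmult: "sphere_integral (\<lambda>z. c * f z) = c * sphere_integral f"
  unfolding sphere_integral_def mult.assoc by (rule integral_mult_right)

lemma sin_polar_nonneg:
  assumes "z \<in> polar_box"
  shows "0 \<le> sin (fst z)"
proof (rule sin_ge_zero)
  show "0 \<le> fst z" "fst z \<le> pi" using assms by (cases z, simp only: cbox_Pair_iff, simp)+
qed

lemma sphere_integral_mono:
  assumes "continuous_on UNIV f" "continuous_on UNIV g" "\<And>z. f z \<le> g z"
  shows "sphere_integral f \<le> sphere_integral g"
  unfolding sphere_integral_def
proof (rule integral_le)
  fix z :: "real \<times> real" assume "z \<in> polar_box"
  with assms(3) show "f z * sin (fst z) \<le> g z * sin (fst z)"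
    by (intro mult_right_mono sin_polar_nonneg)
qed (rule sphere_integrable assms(1,2))+

lemma integral_DERIV_fst_zero:
  fixes a A :: "real \<times> real \<Rightarrow> real"
  assumes "continuous_on UNIV A" and D: "\<And>p q. ((\<lambda>p. a (p, q)) has_real_derivative A (p, q)) (at p)"
    and z: "\<And>q. a (0, q) = a (pi, q)"
  shows "integral polar_box A = 0"
proof -
  have c: "continuous_on (cbox (0, 0) (pi, 2 * pi)) A" using assms(1) by (rule continuous_on_subset) auto
  have "integral polar_box A = integral (cbox 0 pi) (\<lambda>p. integral (cbox 0 (2 * pi)) (\<lambda>q. A (p, q)))"
    by (rule integral_prod_continuous[OF c])
  also have "\<dots> = integral (cbox 0 (2 * pi)) (\<lambda>q. integral (cbox 0 pi) (\<lambda>p. A (p, q)))"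
    by (rule integral_swap_continuous) (use c in \<open>simp add: case_prod_beta\<close>)
  also have "\<dots> = integral (cbox 0 (2 * pi)) (\<lambda>q. 0)"
  proof (rule integral_cong)
    fix q :: real
    have "((\<lambda>p. A (p, q)) has_integral a (pi, q) - a (0, q)) {0..pi}"
      by (rule fundamental_theorem_of_calculus)
         (use D in \<open>auto simp: has_real_derivative_iff_has_vector_derivative intro: has_vector_derivative_at_within\<close>)
    then show "integral (cbox 0 pi) (\<lambda>p. A (p, q)) = 0" using z by (simp add: integral_unique)
  qed
  finally show ?thesis by simp
qed

lemma integral_DERIV_snd_zero:
  fixes a A :: "real \<times> real \<Rightarrow> real"
  assumes "continuous_on UNIV A" and D: "\<And>p q. ((\<lambda>q. a (p, q)) has_real_derivative A (p, q)) (at q)"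
    and z: "\<And>p. a (p, 0) = a (p, 2 * pi)"
  shows "integral polar_box A = 0"
proof -
  have c: "continuous_on (cbox (0, 0) (pi, 2 * pi)) A" using assms(1) by (rule continuous_on_subset) auto
  have "integral polar_box A = integral (cbox 0 pi) (\<lambda>p. integral (cbox 0 (2 * pi)) (\<lambda>q. A (p, q)))"
    by (rule integral_prod_continuous[OF c])
  also have "\<dots> = integral (cbox 0 pi) (\<lambda>p. 0)"
  proof (rule integral_cong)
    fix p :: real
    have "((\<lambda>q. A (p, q)) has_integral a (p, 2 * pi) - a (p, 0)) {0..2 * pi}"
      by (rule fundamental_theorem_of_calculus)
         (use D in \<open>auto simp: has_real_derivative_iff_has_vector_derivative intro: has_vector_derivative_at_within\<close>)
    then show "integral (cbox 0 (2 * pi)) (\<lambda>q. A (p, q)) = 0" using z by (simp add: integral_unique)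
  qed
  finally show ?thesis by simp
qed

text \<open>
  With \<open>h = f\<^sub>q / sin p\<close>, \<open>sin p\<close> times the spherical Laplacian has the divergence form
  \<open>\<partial>\<^sub>p (sin p f\<^sub>p) + \<partial>\<^sub>q h\<close>. For smooth functions on the sphere, \<open>h\<close> stays smooth at the poles.
\<close>

lemma green_polar:
  fixes f fp fpp h hq g gp k :: "real \<times> real \<Rightarrow> real"
  assumes c: "continuous_on UNIV fp" "continuous_on UNIV fpp" "continuous_on UNIV h" "continuous_on UNIV hq"
      "continuous_on UNIV g" "continuous_on UNIV gp" "continuous_on UNIV k"
    and D: "\<And>p q. ((\<lambda>p. fp (p, q)) has_real_derivative fpp (p, q)) (at p)"
      "\<And>p q. ((\<lambda>q. h (p, q)) has_real_derivative hq (p, q)) (at q)"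
      "\<And>p q. ((\<lambda>p. g (p, q)) has_real_derivative gp (p, q)) (at p)"
      "\<And>p q. ((\<lambda>q. g (p, q)) has_real_derivative sin p * k (p, q)) (at q)"
    and per: "\<And>p. h (p, 0) = h (p, 2 * pi)" "\<And>p. g (p, 0) = g (p, 2 * pi)"
  shows "integral polar_box (\<lambda>z. (cos (fst z) * fp z + sin (fst z) * fpp z + hq z) * g z)
      = - sphere_integral (\<lambda>z. fp z * gp z + h z * k z)"
proof -
  define A where "A z = (cos (fst z) * fp z + sin (fst z) * fpp z) * g z + sin (fst z) * fp z * gp z" for z
  define B where "B z = hq z * g z + h z * (sin (fst z) * k z)" for z
  have cont: "continuous_on UNIV A" "continuous_on UNIV B"
    unfolding A_def B_def by (intro continuous_intros c)+
  have "integral polar_box A = 0"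
  \<comment> \<open>\<open>sin p\<close> vanishes at both poles, so the boundary terms in
    \<open>p\<close> drop out whatever \<open>fp\<close> and \<open>g\<close> are there.\<close>
  proof (rule integral_DERIV_fst_zero[OF cont(1), where a = "\<lambda>z. sin (fst z) * fp z * g z"])
    show "((\<lambda>p. sin (fst (p, q)) * fp (p, q) * g (p, q)) has_real_derivative A (p, q)) (at p)" for p q
      unfolding A_def fst_conv
      by (rule DERIV_cong, rule DERIV_mult[OF DERIV_mult[OF DERIV_sin D(1)] D(3)]) (simp add: algebra_simps)
  qed simp
  moreover have "integral polar_box B = 0"
  proof (rule integral_DERIV_snd_zero[OF cont(2), where a = "\<lambda>z. h z * g z"])
    show "((\<lambda>q. h (p, q) * g (p, q)) has_real_derivative B (p, q)) (at q)" for p q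
      unfolding B_def fst_conv
      by (rule DERIV_cong, rule DERIV_mult[OF D(2) D(4)]) (simp add: algebra_simps)
  qed (use per in simp)
  ultimately have "integral polar_box (\<lambda>z. A z + B z) = 0"
    by (simp add: Henstock_Kurzweil_Integration.integral_add integrable_polar cont)
  moreover have "(\<lambda>z. A z + B z) = (\<lambda>z. (cos (fst z) * fp z + sin (fst z) * fpp z + hq z) * g z
      + (fp z * gp z + h z * k z) * sin (fst z))"
    by (auto simp: A_def B_def algebra_simps)
  moreover have "integral polar_box (\<lambda>z. (cos (fst z) * fp z + sin (fst z) * fpp z + hq z) * g z
      + (fp z * gp z + h z * k z) * sin (fst z))
    = integral polar_box (\<lambda>z. (cos (fst z) * fp z + sin (fst z) * fpp z + hq z) * g z)
      + sphere_integral (\<lambda>z. fp z * gp z + h z * k z)"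
    unfolding sphere_integral_def
    by (intro Henstock_Kurzweil_Integration.integral_add integrable_polar continuous_intros c)
  ultimately show ?thesis by simp
qed

section \<open>Monomials as test functions on the sphere\<close>

definition monom3 :: "nat \<Rightarrow> nat \<Rightarrow> nat \<Rightarrow> vec3 \<Rightarrow> real" where
  "monom3 a b c v = (v $ 1) ^ a * (v $ 2) ^ b * (v $ 3) ^ c"

lemma continuous_monom3: "continuous_on A (monom3 a b c)"
  unfolding monom3_def by (intro continuous_intros)

text \<open>The extra factor \<open>g\<close> makes the product case work: the second polynomial is
  absorbed into \<open>g\<close> before the first is treated. Linear factors are absorbed by raising
  an exponent of the monomial, hence the induction over arbitrary \<open>g\<close>,
  \<open>a\<close>, \<open>b\<close> and \<open>c\<close>.\<close>

lemma real_polynomial_orthogonal: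
  assumes "real_polynomial_function p" "continuous_on UNIV f" "continuous_on UNIV g"
    and "\<And>a b c. sphere_integral (\<lambda>z. f z * g (polar z) * monom3 a b c (polar z)) = 0"
  shows "sphere_integral (\<lambda>z. f z * (p (polar z) * g (polar z)) * monom3 a b c (polar z)) = 0"
  using assms(1,3,4)
proof (induction arbitrary: g a b c rule: real_polynomial_function.induct)
  case (linear p)
  interpret bounded_linear p by fact
  have p: "p v = v $ 1 * p (axis 1 1) + v $ 2 * p (axis 2 1) + v $ 3 * p (axis 3 1)" for v :: vec3
  proof -
    have "v = (\<Sum>i\<in>UNIV. v $ i *\<^sub>R axis i 1)" by (simp add: vec_eq_iff axis_def sum_3 forall_3)
    then have "p v = p (\<Sum>i\<in>UNIV. v $ i *\<^sub>R axis i 1)" by simp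
    also have "\<dots> = v $ 1 * p (axis 1 1) + v $ 2 * p (axis 2 1) + v $ 3 * p (axis 3 1)"
      by (simp add: sum_3 add scaleR)
    finally show ?thesis .
  qed
  have eq: "(\<lambda>z. f z * (p (polar z) * g (polar z)) * monom3 a b c (polar z)) =
     (\<lambda>z. p (axis 1 1) * (f z * g (polar z) * monom3 (Suc a) b c (polar z)) +
          p (axis 2 1) * (f z * g (polar z) * monom3 a (Suc b) c (polar z)) +
          p (axis 3 1) * (f z * g (polar z) * monom3 a b (Suc c) (polar z)))"
    by (subst p) (simp add: monom3_def fun_eq_iff algebra_simps)
  have c: "continuous_on UNIV (\<lambda>z. f z * g (polar z) * monom3 a b c (polar z))" for a b c
    by (intro continuous_intros assms(2) continuous_on_compose2[OF linear.prems(1)]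
        continuous_on_compose2[OF continuous_monom3] continuous_polar) auto
  show ?case
    unfolding eq by (subst sphere_integral_add, intro continuous_intros c, intro continuous_intros c)+
      (simp add: sphere_integral_cmult linear.prems(2))
next
  case (const k)
  have "(\<lambda>z. f z * (k * g (polar z)) * monom3 a b c (polar z)) = (\<lambda>z. k * (f z * g (polar z) * monom3 a b c (polar z)))"
    by (simp add: fun_eq_iff)
  then show ?case using const.prems(2) by (simp add: sphere_integral_cmult)
next
  case (add p1 p2)
  have eq: "(\<lambda>z. f z * ((p1 (polar z) + p2 (polar z)) * g (polar z)) * monom3 a b c (polar z)) =
     (\<lambda>z. f z * (p1 (polar z) * g (polar z)) * monom3 a b c (polar z) +
        f z * (p2 (polar z) * g (polar z)) * monom3 a b c (polar z))"
    by (simp add: fun_eq_iff algebra_simps)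
  have c: "continuous_on UNIV (\<lambda>z. f z * (p (polar z) * g (polar z)) * monom3 a b c (polar z))"
    if "real_polynomial_function p" for p
    by (intro continuous_intros assms(2) continuous_on_compose2[OF add.prems(1)]
        continuous_on_compose2[OF continuous_monom3] continuous_polar
        continuous_on_compose2[OF continuous_on_polymonial_function[of p]])
       (use that in \<open>auto simp: real_polynomial_function_eq\<close>)
  show ?case
    unfolding eq by (simp add: sphere_integral_add c add)
next
  case (mult p1 p2)
  have "sphere_integral (\<lambda>z. f z * (p1 (polar z) * (\<lambda>v. p2 v * g v) (polar z)) * monom3 a b c (polar z)) = 0"
  proof (rule mult.IH(1))
    show "continuous_on UNIV (\<lambda>v. p2 v * g v)"
      by (intro continuous_intros mult.prems continuous_on_polymonial_function)
         (use mult.hyps in \<open>simp add: real_polynomial_function_eq\<close>)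
  qed (rule mult.IH(2)[OF mult.prems])
  then show ?case by (simp add: mult.assoc)
qed

text \<open>Orthogonality to a polynomial uniformly \<open>e\<close>-close to \<open>F\<close>
  bounds the integral of the square of \<open>F\<close> by \<open>e\<close> times that of its
  absolute value. Hence the square integrates to zero, and continuity gives pointwise vanishing
  where the weight is positive.\<close>

lemma sphere_moments_zero:
  assumes F: "continuous_on S2 F"
    and z: "\<And>a b c. sphere_integral (\<lambda>z. F (polar z) * monom3 a b c (polar z)) = 0"
    and v: "v \<in> S2"
  shows "F v = 0"
proof -
  define f where "f z = F (polar z)" for z
  have cf: "continuous_on UNIV f" unfolding f_def
    by (intro continuous_on_compose2[OF F] continuous_polar) (auto intro: polar_in_sphere)
  have poly0: "sphere_integral (\<lambda>z. f z * p (polar z)) = 0" if "real_polynomial_function p" for p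
    using real_polynomial_orthogonal[OF that cf, of "\<lambda>_. 1" 0 0 0] z
    by (simp add: f_def monom3_def)
  define I where "I = sphere_integral (\<lambda>z. \<bar>f z\<bar>)"
  have I0: "0 \<le> I" using sphere_integral_mono[of "\<lambda>z. 0" "\<lambda>z. \<bar>f z\<bar>"] cf
    by (simp add: I_def sphere_integral_def continuous_on_rabs)
  have small: "sphere_integral (\<lambda>z. f z * f z) \<le> e * I" if "e > 0" for e
  proof -
    obtain p where p: "real_polynomial_function p" "\<And>x. x \<in> S2 \<Longrightarrow> \<bar>F x - p x\<bar> < e"
      using Stone_Weierstrass_real_polynomial_function[OF compact_sphere F \<open>e > 0\<close>] by blast
    have cp: "continuous_on UNIV (\<lambda>z. p (polar z))"
      by (intro continuous_on_compose2[OF continuous_on_polymonial_function[of p UNIV]] continuous_polar)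
         (use p(1) in \<open>auto simp: real_polynomial_function_eq\<close>)
    have "sphere_integral (\<lambda>z. f z * f z) = sphere_integral (\<lambda>z. f z * (f z - p (polar z)) + f z * p (polar z))"
      by (simp add: algebra_simps)
    also have "\<dots> = sphere_integral (\<lambda>z. f z * (f z - p (polar z)))"
      by (subst sphere_integral_add) (auto simp: poly0 p intro!: continuous_intros cf cp)
    also have "\<dots> \<le> sphere_integral (\<lambda>z. e * \<bar>f z\<bar>)"
    proof (rule sphere_integral_mono)
      fix z
      have "f z * (f z - p (polar z)) \<le> \<bar>f z\<bar> * \<bar>f z - p (polar z)\<bar>" by (metis abs_ge_self abs_mult)
      also have "\<dots> \<le> \<bar>f z\<bar> * e"
        using p(2)[OF polar_in_sphere, of z] by (intro mult_left_mono) (auto simp: f_def)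
      finally show "f z * (f z - p (polar z)) \<le> e * \<bar>f z\<bar>" by (simp add: mult.commute)
    qed (intro continuous_intros cf cp)+
    also have "\<dots> = e * I" by (simp add: sphere_integral_cmult I_def)
    finally show ?thesis .
  qed
  have "sphere_integral (\<lambda>z. f z * f z) \<le> 0"
  proof (rule field_le_epsilon)
    fix e :: real assume "e > 0"
    then have "sphere_integral (\<lambda>z. f z * f z) \<le> e / (I + 1) * I" using I0 by (intro small) auto
    also have "\<dots> \<le> e" using I0 \<open>e > 0\<close> by (simp add: field_simps)
    finally show "sphere_integral (\<lambda>z. f z * f z) \<le> 0 + e" by simp
  qed
  moreover have "0 \<le> sphere_integral (\<lambda>z. f z * f z)"
    using sphere_integral_mono[of "\<lambda>z. 0" "\<lambda>z. f z * f z"] cf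
    by (simp add: sphere_integral_def continuous_on_mult)
  ultimately have I2: "sphere_integral (\<lambda>z. f z * f z) = 0" by simp
  have f0: "f (p, q) = 0" if "0 < p" "p < pi" "0 \<le> q" "q \<le> 2 * pi" for p q
  proof -
    have "f (p, q) * f (p, q) * sin (fst (p, q)) = 0"
    proof (rule has_integral_0_cbox_imp_0[where a = "(0, 0)" and b = "(pi, 2 * pi)"
          and f = "\<lambda>z. f z * f z * sin (fst z)"])
      show "((\<lambda>z. f z * f z * sin (fst z)) has_integral 0) polar_box"
        using I2 sphere_integrable[of "\<lambda>z. f z * f z"] cf
        by (simp add: sphere_integral_def has_integral_iff continuous_on_mult)
      show "continuous_on polar_box (\<lambda>z. f z * f z * sin (fst z))"
        by (intro continuous_intros continuous_on_subset[OF cf]) auto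
      show "box (0, 0) (pi, 2 * pi) \<noteq> {}"
        by (auto simp: box_ne_empty Basis_prod_def)
      show "0 \<le> f z * f z * sin (fst z)" if "z \<in> box (0, 0) (pi, 2 * pi)" for z
        using that box_subset_cbox[of "(0, 0)" "(pi, 2 * pi)"]
        by (intro mult_nonneg_nonneg[OF zero_le_square sin_polar_nonneg]) auto
    qed (use that in \<open>auto simp: cbox_Pair_eq\<close>)
    moreover have "sin p \<noteq> 0" using sin_gt_zero[OF that(1,2)] by simp
    ultimately show ?thesis by simp
  qed
  obtain p q where pq: "0 \<le> p" "p \<le> pi" "0 \<le> q" "q < 2 * pi" "v = polar (p, q)"
    using polar_surj[OF v] .
  \<comment> \<open>The weight \<open>sin p\<close> is zero at the poles, so these are reached by
    continuity in \<open>p\<close>.\<close>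
  have "f (p, q) = 0"
  proof (rule continuous_constant_on_closure[of "{0<..<pi}" "\<lambda>p. f (p, q)"])
    have "continuous_on (closure {0<..<pi}) (\<lambda>p. (p, q))" by (intro continuous_intros)
    from continuous_on_compose2[OF cf this] show "continuous_on (closure {0<..<pi}) (\<lambda>p. f (p, q))" by simp
  qed (use pq f0 in auto)
  then show ?thesis by (simp add: f_def pq)
qed

section \<open>Angular derivatives in terms of Cartesian ones\<close>

definition has_grad3 :: "(vec3 \<Rightarrow> real) \<Rightarrow> (vec3 \<Rightarrow> real) \<Rightarrow> (vec3 \<Rightarrow> real) \<Rightarrow> (vec3 \<Rightarrow> real) \<Rightarrow> bool" where
  "has_grad3 f f1 f2 f3 \<longleftrightarrow>
     (\<forall>v\<in>S2. (f has_derivative (\<lambda>d. d $ 1 * f1 v + d $ 2 * f2 v + d $ 3 * f3 v)) (at v))"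

definition polar_dp :: "(vec3 \<Rightarrow> real) \<Rightarrow> (vec3 \<Rightarrow> real) \<Rightarrow> (vec3 \<Rightarrow> real) \<Rightarrow> real \<times> real \<Rightarrow> real" where
  "polar_dp f1 f2 f3 z = cos (fst z) * cos (snd z) * f1 (polar z) + cos (fst z) * sin (snd z) * f2 (polar z)
     - sin (fst z) * f3 (polar z)"

text \<open>The derivative along the unit vector \<open>(- sin q, cos q, 0)\<close>. It is the
  \<open>q\<close>-derivative divided by \<open>sin p\<close>, but written without a division and
  therefore meaningful at the poles.\<close>

definition polar_h :: "(vec3 \<Rightarrow> real) \<Rightarrow> (vec3 \<Rightarrow> real) \<Rightarrow> real \<times> real \<Rightarrow> real" where
  "polar_h f1 f2 z = cos (snd z) * f2 (polar z) - sin (snd z) * f1 (polar z)"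

lemma has_derivative_vec3:
  assumes "(a has_real_derivative a') (at x)" "(b has_real_derivative b') (at x)" "(c has_real_derivative c') (at x)"
  shows "((\<lambda>x. vector [a x, b x, c x] :: vec3) has_derivative (\<lambda>h. h *\<^sub>R vector [a', b', c'])) (at x)"
proof -
  have e: "(vector [u, v, w] :: vec3) = u *\<^sub>R axis 1 1 + v *\<^sub>R axis 2 1 + w *\<^sub>R axis 3 1" for u v w
    by (simp add: vec_eq_iff axis_def forall_3)
  show ?thesis
    unfolding e
    by (rule has_derivative_eq_rhs, (rule has_derivative_add has_derivative_scaleR_left
          assms[unfolded has_field_derivative_def])+) (simp add: scaleR_add_right mult.commute)
qed

lemma DERIV_polar:
  assumes "has_grad3 f f1 f2 f3"
  shows "((\<lambda>p. f (polar (p, q))) has_real_derivative polar_dp f1 f2 f3 (p, q)) (at p)"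
    and "((\<lambda>q. f (polar (p, q))) has_real_derivative sin p * polar_h f1 f2 (p, q)) (at q)"
proof -
  let ?v = "polar (p, q)"
  have f: "(f has_derivative (\<lambda>d. d $ 1 * f1 ?v + d $ 2 * f2 ?v + d $ 3 * f3 ?v)) (at ?v)"
    using assms polar_in_sphere unfolding has_grad3_def by blast
  have p: "((\<lambda>p. polar (p, q)) has_derivative (\<lambda>h. h *\<^sub>R vector [cos p * cos q, cos p * sin q, - sin p])) (at p)"
    unfolding polar_def fst_conv snd_conv
    by (rule has_derivative_vec3) (auto intro!: derivative_eq_intros)
  have q: "((\<lambda>q. polar (p, q)) has_derivative (\<lambda>h. h *\<^sub>R vector [- sin p * sin q, sin p * cos q, 0])) (at q)"
    unfolding polar_def fst_conv snd_conv
    by (rule has_derivative_vec3) (auto intro!: derivative_eq_intros)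
  show "((\<lambda>p. f (polar (p, q))) has_real_derivative polar_dp f1 f2 f3 (p, q)) (at p)"
    unfolding has_field_derivative_def
    by (rule has_derivative_eq_rhs[OF has_derivative_compose[OF p f]])
       (simp add: polar_dp_def fun_eq_iff algebra_simps)
  show "((\<lambda>q. f (polar (p, q))) has_real_derivative sin p * polar_h f1 f2 (p, q)) (at q)"
    unfolding has_field_derivative_def
    by (rule has_derivative_eq_rhs[OF has_derivative_compose[OF q f]])
       (simp add: polar_h_def fun_eq_iff algebra_simps)
qed

text \<open>The Hessian on the tangent of the meridian, plus the gradient on the acceleration of the
  meridian, which is \<open>- polar z\<close>. In \<open>polar_hq\<close> the Hessian carries
  \<open>sin p\<close>, the speed along a circle of latitude, and the remaining terms come from the
  rotation of the vector \<open>(- sin q, cos q, 0)\<close>.\<close>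

definition polar_dpp where
  "polar_dpp f1 f2 f3 f11 f12 f13 f21 f22 f23 f31 f32 f33 z =
     cos (fst z) * cos (snd z) * polar_dp f11 f12 f13 z + cos (fst z) * sin (snd z) * polar_dp f21 f22 f23 z
     - sin (fst z) * polar_dp f31 f32 f33 z
     - sin (fst z) * cos (snd z) * f1 (polar z) - sin (fst z) * sin (snd z) * f2 (polar z) - cos (fst z) * f3 (polar z)"

definition polar_hq where
  "polar_hq f1 f2 f11 f12 f21 f22 z =
     sin (fst z) * (cos (snd z) * polar_h f21 f22 z - sin (snd z) * polar_h f11 f12 z)
     - sin (snd z) * f2 (polar z) - cos (snd z) * f1 (polar z)"

lemma DERIV_polar_dp:
  assumes "has_grad3 f1 f11 f12 f13" "has_grad3 f2 f21 f22 f23" "has_grad3 f3 f31 f32 f33"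
  shows "((\<lambda>p. polar_dp f1 f2 f3 (p, q)) has_real_derivative
      polar_dpp f1 f2 f3 f11 f12 f13 f21 f22 f23 f31 f32 f33 (p, q)) (at p)"
  unfolding polar_dp_def[of f1] fst_conv snd_conv
  by (rule derivative_eq_intros DERIV_polar assms refl)+ (simp add: polar_dpp_def algebra_simps)

lemma DERIV_polar_h:
  assumes "has_grad3 f1 f11 f12 f13" "has_grad3 f2 f21 f22 f23"
  shows "((\<lambda>q. polar_h f1 f2 (p, q)) has_real_derivative polar_hq f1 f2 f11 f12 f21 f22 (p, q)) (at q)"
  unfolding polar_h_def[of f1] fst_conv snd_conv
  by (rule derivative_eq_intros DERIV_polar assms refl)+ (simp add: polar_hq_def algebra_simps)

text \<open>The Hessian terms combine because \<open>\<partial>\<^sub>p polar\<close>, \<open>\<partial>\<^sub>q polar / sin p\<close> and \<open>polar\<close> form an orthonormal frame.\<close>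

lemma polar_laplacian:
  fixes z :: "real \<times> real"
  defines "v \<equiv> polar z"
  shows "cos (fst z) * polar_dp f1 f2 f3 z
      + sin (fst z) * polar_dpp f1 f2 f3 f11 f12 f13 f21 f22 f23 f31 f32 f33 z + polar_hq f1 f2 f11 f12 f21 f22 z
    = sin (fst z) * (f11 v + f22 v + f33 v
        - (v $ 1 * (v $ 1 * f11 v + v $ 2 * f12 v + v $ 3 * f13 v) + v $ 2 * (v $ 1 * f21 v + v $ 2 * f22 v + v $ 3 * f23 v)
           + v $ 3 * (v $ 1 * f31 v + v $ 2 * f32 v + v $ 3 * f33 v))
        - 2 * (v $ 1 * f1 v + v $ 2 * f2 v + v $ 3 * f3 v))"
proof -
  define a b c d where "a = sin (fst z)" and "b = cos (fst z)" and "c = sin (snd z)" and "d = cos (snd z)"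
  have b2: "b * b = 1 - a * a" and d2: "d * d = 1 - c * c"
    unfolding a_def b_def c_def d_def by (simp_all add: cos_squared_eq flip: power2_eq_square)
  have v: "v $ 1 = a * d" "v $ 2 = a * c" "v $ 3 = b"
    by (simp_all add: v_def a_def b_def c_def d_def)
  \<comment> \<open>The same reductions under a further factor, for squares that occur inside longer
    right-nested products.\<close>
  have b2': "b * (b * x) = x - a * (a * x)" and d2': "d * (d * x) = x - c * (c * x)" for x
    by (simp_all add: b2 d2 left_diff_distrib flip: mult.assoc)
  show ?thesis
    unfolding polar_dp_def polar_dpp_def polar_h_def polar_hq_def v_def[symmetric] v
    unfolding a_def[symmetric] b_def[symmetric] c_def[symmetric] d_def[symmetric]
    by (simp add: algebra_simps b2 d2 b2' d2')
qed

lemma has_grad3_cmult: "has_grad3 f f1 f2 f3 \<Longrightarrow> has_grad3 (\<lambda>v. k * f v) (\<lambda>v. k * f1 v) (\<lambda>v. k * f2 v) (\<lambda>v. k * f3 v)"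
  unfolding has_grad3_def
  by (auto intro!: has_derivative_eq_rhs[OF has_derivative_mult_right] simp: fun_eq_iff algebra_simps)

lemma has_grad3_monom3:
  "has_grad3 (monom3 a b c) (\<lambda>v. real a * monom3 (a - 1) b c v) (\<lambda>v. real b * monom3 a (b - 1) c v)
     (\<lambda>v. real c * monom3 a b (c - 1) v)"
proof -
  have nth: "((\<lambda>v :: vec3. v $ i) has_derivative (\<lambda>d. d $ i)) (at v)" for i v
    by (rule bounded_linear.has_derivative[OF bounded_linear_vec_nth has_derivative_ident])
  show ?thesis
    unfolding has_grad3_def monom3_def
    by (intro ballI, rule has_derivative_eq_rhs,
        (rule has_derivative_mult has_derivative_power nth)+) (simp add: fun_eq_iff algebra_simps)
qed

definition monom3_p where
  "monom3_p a b c = polar_dp (\<lambda>v. real a * monom3 (a - 1) b c v) (\<lambda>v. real b * monom3 a (b - 1) c v)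
     (\<lambda>v. real c * monom3 a b (c - 1) v)"
definition monom3_h where
  "monom3_h a b c = polar_h (\<lambda>v. real a * monom3 (a - 1) b c v) (\<lambda>v. real b * monom3 a (b - 1) c v)"

definition monom3_pp where
  "monom3_pp a b c = polar_dpp (\<lambda>v. real a * monom3 (a - 1) b c v) (\<lambda>v. real b * monom3 a (b - 1) c v)
     (\<lambda>v. real c * monom3 a b (c - 1) v)
     (\<lambda>v. real a * (real (a - 1) * monom3 (a - 1 - 1) b c v)) (\<lambda>v. real a * (real b * monom3 (a - 1) (b - 1) c v))
     (\<lambda>v. real a * (real c * monom3 (a - 1) b (c - 1) v))
     (\<lambda>v. real b * (real a * monom3 (a - 1) (b - 1) c v)) (\<lambda>v. real b * (real (b - 1) * monom3 a (b - 1 - 1) c v))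
     (\<lambda>v. real b * (real c * monom3 a (b - 1) (c - 1) v))
     (\<lambda>v. real c * (real a * monom3 (a - 1) b (c - 1) v)) (\<lambda>v. real c * (real b * monom3 a (b - 1) (c - 1) v))
     (\<lambda>v. real c * (real (c - 1) * monom3 a b (c - 1 - 1) v))"

definition monom3_hq where
  "monom3_hq a b c = polar_hq (\<lambda>v. real a * monom3 (a - 1) b c v) (\<lambda>v. real b * monom3 a (b - 1) c v)
     (\<lambda>v. real a * (real (a - 1) * monom3 (a - 1 - 1) b c v)) (\<lambda>v. real a * (real b * monom3 (a - 1) (b - 1) c v))
     (\<lambda>v. real b * (real a * monom3 (a - 1) (b - 1) c v)) (\<lambda>v. real b * (real (b - 1) * monom3 a (b - 1 - 1) c v))"

lemma DERIV_monom3: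
  "((\<lambda>p. monom3 a b c (polar (p, q))) has_real_derivative monom3_p a b c (p, q)) (at p)"
  "((\<lambda>q. monom3 a b c (polar (p, q))) has_real_derivative sin p * monom3_h a b c (p, q)) (at q)"
  "((\<lambda>p. monom3_p a b c (p, q)) has_real_derivative monom3_pp a b c (p, q)) (at p)"
  "((\<lambda>q. monom3_h a b c (p, q)) has_real_derivative monom3_hq a b c (p, q)) (at q)"
  unfolding monom3_p_def monom3_pp_def monom3_h_def monom3_hq_def
  by (rule DERIV_polar[OF has_grad3_monom3],
      rule DERIV_polar(2)[OF has_grad3_monom3],
      rule DERIV_polar_dp[OF has_grad3_cmult[OF has_grad3_monom3] has_grad3_cmult[OF has_grad3_monom3]
        has_grad3_cmult[OF has_grad3_monom3]],
      rule DERIV_polar_h[OF has_grad3_cmult[OF has_grad3_monom3] has_grad3_cmult[OF has_grad3_monom3]])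

lemma continuous_polar_compose [continuous_intros]:
  "continuous_on A f \<Longrightarrow> continuous_on A (\<lambda>x. monom3 a b c (polar (f x)))"
  by (rule continuous_on_compose2[OF continuous_monom3 continuous_on_compose2[OF continuous_polar]]) auto

lemma continuous_monom3_polar:
  "continuous_on A (\<lambda>z. monom3 a b c (polar z))" "continuous_on A (monom3_p a b c)" "continuous_on A (monom3_h a b c)"
  "continuous_on A (monom3_pp a b c)" "continuous_on A (monom3_hq a b c)"
  unfolding monom3_p_def monom3_pp_def monom3_h_def monom3_hq_def polar_dp_def polar_h_def polar_dpp_def polar_hq_def
  by (intro continuous_intros)+

lemma polar_periodic:
  "polar (p, 2 * pi) = polar (p, 0)" "monom3_h a b c (p, 2 * pi) = monom3_h a b c (p, 0)"
proof -
  show p: "polar (p, 2 * pi) = polar (p, 0)" by (simp add: polar_def)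
  show "monom3_h a b c (p, 2 * pi) = monom3_h a b c (p, 0)" by (simp add: monom3_h_def polar_h_def p)
qed

text \<open>Truncated subtraction does no harm: at exponent \<open>0\<close> the factor in front
  vanishes.\<close>

lemma monom3_Suc_times:
  "v $ 1 * (real a * monom3 (a - 1) b c v) = real a * monom3 a b c v"
  "v $ 2 * (real b * monom3 a (b - 1) c v) = real b * monom3 a b c v"
  "v $ 3 * (real c * monom3 a b (c - 1) v) = real c * monom3 a b c v"
  subgoal by (cases a) (simp_all add: monom3_def)
  subgoal by (cases b) (simp_all add: monom3_def)
  subgoal by (cases c) (simp_all add: monom3_def)
  done

text \<open>The spherical Laplacian of a homogeneous \<open>m\<close> of degree \<open>k\<close> is \<open>\<Delta> m - k (k + 1) m\<close>.\<close>

lemma monom3_laplacian: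
  "cos (fst z) * monom3_p a b c z + sin (fst z) * monom3_pp a b c z + monom3_hq a b c z
   = sin (fst z) * (real a * real (a - 1) * monom3 (a - 2) b c (polar z) + real b * real (b - 1) * monom3 a (b - 2) c (polar z)
       + real c * real (c - 1) * monom3 a b (c - 2) (polar z)
       - real (a + b + c) * (real (a + b + c) + 1) * monom3 a b c (polar z))"
proof -
  define v where "v = polar z"
  \<comment> \<open>Euler's identity for homogeneous functions. The version with a constant
    \<open>k\<close> is needed for the first derivatives of the monomial, which are multiples of
    monomials of one degree less.\<close>
  have 1: "v $ 1 * (real a * monom3 (a - 1) b c v) + v $ 2 * (real b * monom3 a (b - 1) c v) + v $ 3 * (real c * monom3 a b (c - 1) v)
     = real (a + b + c) * monom3 a b c v" for a b c
    unfolding monom3_Suc_times by (simp add: algebra_simps)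
  have euler: "v $ 1 * (k * (real a * monom3 (a - 1) b c v)) + v $ 2 * (k * (real b * monom3 a (b - 1) c v))
      + v $ 3 * (k * (real c * monom3 a b (c - 1) v)) = k * (real (a + b + c) * monom3 a b c v)" for a b c k
    unfolding 1[symmetric] by (simp add: algebra_simps)
  have nz: "real a * (real (a - 1 + b + c) * x) = real a * ((real (a + b + c) - 1) * x)"
     "real b * (real (a + (b - 1) + c) * x) = real b * ((real (a + b + c) - 1) * x)"
     "real c * (real (a + b + (c - 1)) * x) = real c * ((real (a + b + c) - 1) * x)" for x
    subgoal by (cases a) simp_all
    subgoal by (cases b) simp_all
    subgoal by (cases c) simp_all
    done
  have "v $ 1 * (real a * ((real (a + b + c) - 1) * monom3 (a - 1) b c v))
      + v $ 2 * (real b * ((real (a + b + c) - 1) * monom3 a (b - 1) c v))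
      + v $ 3 * (real c * ((real (a + b + c) - 1) * monom3 a b (c - 1) v))
    = (real (a + b + c) - 1) * (real (a + b + c) * monom3 a b c v)"
    unfolding 1[symmetric] by (simp add: algebra_simps)
  moreover have "m - 1 - 1 = m - 2" for m :: nat by simp
  ultimately show ?thesis
    unfolding monom3_p_def monom3_pp_def monom3_hq_def polar_laplacian v_def[symmetric] euler 1 nz
    by (simp only:) (simp only: algebra_simps)
qed

section \<open>Waves on the line with values in functions on the sphere\<close>

definition cont3 :: "(real \<Rightarrow> real \<Rightarrow> real \<times> real \<Rightarrow> real) \<Rightarrow> bool" where
  "cont3 F \<longleftrightarrow> continuous_on UNIV (\<lambda>(t, s, z). F t s z)"

lemma cont3_compose:
  assumes "cont3 F" "continuous_on A a" "continuous_on A b" "continuous_on A c"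
  shows "continuous_on A (\<lambda>x. F (a x) (b x) (c x))"
proof -
  have "continuous_on A (\<lambda>x. (a x, b x, c x))" by (intro continuous_intros assms)
  from continuous_on_compose2[OF assms(1)[unfolded cont3_def] this] show ?thesis by simp
qed

lemma cont3I: "continuous_on UNIV (\<lambda>x. F (fst x) (fst (snd x)) (snd (snd x))) \<Longrightarrow> cont3 F"
  by (simp add: cont3_def case_prod_beta)

lemma DERIV_mirror_arg:
  assumes "\<And>x. (f has_real_derivative f' x) (at x)"
  shows "((\<lambda>x. f (- x)) has_real_derivative - f' (- x)) (at x)"
  using DERIV_chain2[OF assms[of "- x"] DERIV_minus[OF DERIV_ident]] by simp

text \<open>
  \<open>U\<close> is \<open>r u\<close> in the coordinates \<open>(t, s)\<close>, with \<open>s\<close> the tortoise coordinate, and polar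
  angles \<open>(p, q)\<close>; \<open>Up\<close> and \<open>h = U\<^sub>q / sin p\<close> are the components of the angular gradient.
\<close>

locale wave_field =
  fixes W V HW HV :: "real \<Rightarrow> real"
    and U Ut Us Utt Uts Uss Up Upp Utp h hq ht :: "real \<Rightarrow> real \<Rightarrow> real \<times> real \<Rightarrow> real"
  assumes cont_W: "continuous_on UNIV W" and cont_V: "continuous_on UNIV V"
    and W_nonneg: "W s \<ge> 0" and V_nonneg: "V s \<ge> 0"
    and HW: "(HW has_real_derivative W s) (at s)" and HV: "(HV has_real_derivative V s) (at s)"
    and lim_bot: "\<exists>L. (HW \<longlongrightarrow> L) at_bot" "\<exists>L. (HV \<longlongrightarrow> L) at_bot"
    and lim_top: "\<exists>L. (HW \<longlongrightarrow> L) at_top" "\<exists>L. (HV \<longlongrightarrow> L) at_top"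
    and cont: "cont3 U" "cont3 Ut" "cont3 Us" "cont3 Utt" "cont3 Uts" "cont3 Uss" "cont3 Up" "cont3 Upp" "cont3 Utp"
      "cont3 h" "cont3 hq" "cont3 ht"
    and U_t: "((\<lambda>t. U t s z) has_real_derivative Ut t s z) (at t)"
    and Ut_t: "((\<lambda>t. Ut t s z) has_real_derivative Utt t s z) (at t)"
    and U_s: "((\<lambda>s. U t s z) has_real_derivative Us t s z) (at s)"
    and Us_s: "((\<lambda>s. Us t s z) has_real_derivative Uss t s z) (at s)"
    and Us_t: "((\<lambda>t. Us t s z) has_real_derivative Uts t s z) (at t)"
    and U_p: "((\<lambda>p. U t s (p, q)) has_real_derivative Up t s (p, q)) (at p)"
    and Up_p: "((\<lambda>p. Up t s (p, q)) has_real_derivative Upp t s (p, q)) (at p)"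
    and Up_t: "((\<lambda>t. Up t s z) has_real_derivative Utp t s z) (at t)"
    and U_q: "((\<lambda>q. U t s (p, q)) has_real_derivative sin p * h t s (p, q)) (at q)"
    and h_q: "((\<lambda>q. h t s (p, q)) has_real_derivative hq t s (p, q)) (at q)"
    and h_t: "((\<lambda>t. h t s z) has_real_derivative ht t s z) (at t)"
    and periodic: "U t s (p, 2 * pi) = U t s (p, 0)" "h t s (p, 2 * pi) = h t s (p, 0)"
    and wave_eq: "sin (fst z) * (Utt t s z - Uss t s z + W s * U t s z)
        = V s * (cos (fst z) * Up t s z + sin (fst z) * Upp t s z + hq t s z)"
    and on_sphere: "\<exists>F. continuous_on S2 F \<and> (\<forall>z. U t s z = F (polar z))"
begin

lemmas cont3_intros = cont[THEN cont3_compose]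

lemma Ut_s: "((\<lambda>s. Ut t s z) has_real_derivative Uts t s z) (at s)"
  by (rule mixed_derivative_swap[OF U_t U_s Us_t])
     (auto simp: case_prod_beta intro!: continuous_intros cont3_intros)

lemma Ut_p: "((\<lambda>p. Ut t s (p, q)) has_real_derivative Utp t s (p, q)) (at p)"
  by (rule mixed_derivative_swap[OF U_t U_p Up_t])
     (auto simp: case_prod_beta intro!: continuous_intros cont3_intros)

lemma Ut_q: "((\<lambda>q. Ut t s (p, q)) has_real_derivative sin p * ht t s (p, q)) (at q)"
  by (rule mixed_derivative_swap[OF U_t U_q DERIV_cmult[OF h_t]])
     (auto simp: case_prod_beta intro!: continuous_intros cont3_intros)

lemma time_reversed:
  "wave_field W V HW HV (\<lambda>t s. U (- t) s) (\<lambda>t s z. - Ut (- t) s z) (\<lambda>t s. Us (- t) s) (\<lambda>t s. Utt (- t) s)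
    (\<lambda>t s z. - Uts (- t) s z) (\<lambda>t s. Uss (- t) s) (\<lambda>t s. Up (- t) s) (\<lambda>t s. Upp (- t) s) (\<lambda>t s z. - Utp (- t) s z)
    (\<lambda>t s. h (- t) s) (\<lambda>t s. hq (- t) s) (\<lambda>t s z. - ht (- t) s z)"
proof unfold_locales
  show "((\<lambda>t. - Ut (- t) s z) has_real_derivative Utt (- t) s z) (at t)" for t s z
    using DERIV_minus[OF DERIV_mirror_arg[of "\<lambda>t. Ut t s z", OF Ut_t]] by simp
qed (rule cont_W cont_V W_nonneg V_nonneg HW HV lim_bot lim_top
    DERIV_mirror_arg[OF U_t] U_s Us_s DERIV_mirror_arg[OF Us_t] U_p Up_p DERIV_mirror_arg[OF Up_t]
    U_q h_q DERIV_mirror_arg[OF h_t] periodic wave_eq on_sphere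
  | rule cont3I, intro continuous_intros cont3_intros)+

text \<open>This exchanges the horizon end \<open>s = - \<infinity>\<close> with the end at null
  infinity. The antiderivatives become \<open>- HW (- s)\<close> and \<open>- HV (- s)\<close>, so
  limits at one end become limits at the other; hence the locale asks for both.\<close>

lemma space_reflected:
  "wave_field (\<lambda>s. W (- s)) (\<lambda>s. V (- s)) (\<lambda>s. - HW (- s)) (\<lambda>s. - HV (- s))
    (\<lambda>t s. U t (- s)) (\<lambda>t s z. Ut t (- s) z) (\<lambda>t s z. - Us t (- s) z) (\<lambda>t s. Utt t (- s))
    (\<lambda>t s z. - Uts t (- s) z) (\<lambda>t s. Uss t (- s)) (\<lambda>t s. Up t (- s)) (\<lambda>t s. Upp t (- s)) (\<lambda>t s z. Utp t (- s) z)
    (\<lambda>t s. h t (- s)) (\<lambda>t s. hq t (- s)) (\<lambda>t s z. ht t (- s) z)"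
proof unfold_locales
  show "((\<lambda>s. - Us t (- s) z) has_real_derivative Uss t (- s) z) (at s)" for t s z
    using DERIV_minus[OF DERIV_mirror_arg[of "\<lambda>s. Us t s z", OF Us_s]] by simp
  show "((\<lambda>s. - HW (- s)) has_real_derivative W (- s)) (at s)" for s
    using DERIV_minus[OF DERIV_mirror_arg[OF HW]] by simp
  show "((\<lambda>s. - HV (- s)) has_real_derivative V (- s)) (at s)" for s
    using DERIV_minus[OF DERIV_mirror_arg[OF HV]] by simp
  have b: "\<exists>L. ((\<lambda>s. - H (- s)) \<longlongrightarrow> L) at_bot" if "\<exists>L. (H \<longlongrightarrow> L) at_top" for H :: "real \<Rightarrow> real"
    using that filterlim_compose[OF _ filterlim_uminus_at_top_at_bot] tendsto_minus by blast
  show "\<exists>L. ((\<lambda>s. - HW (- s)) \<longlongrightarrow> L) at_bot" "\<exists>L. ((\<lambda>s. - HV (- s)) \<longlongrightarrow> L) at_bot"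
    by (rule b lim_top)+
  have t: "\<exists>L. ((\<lambda>s. - H (- s)) \<longlongrightarrow> L) at_top" if "\<exists>L. (H \<longlongrightarrow> L) at_bot" for H :: "real \<Rightarrow> real"
    using that filterlim_compose[OF _ filterlim_uminus_at_bot_at_top] tendsto_minus by blast
  show "\<exists>L. ((\<lambda>s. - HW (- s)) \<longlongrightarrow> L) at_top" "\<exists>L. ((\<lambda>s. - HV (- s)) \<longlongrightarrow> L) at_top"
    by (rule t lim_bot)+
  have c: "continuous_on UNIV (\<lambda>s. f (- s))" if "continuous_on UNIV f" for f :: "real \<Rightarrow> real"
    by (rule continuous_on_compose2[OF that]) (auto intro!: continuous_intros)
  show "continuous_on UNIV (\<lambda>s. W (- s))" "continuous_on UNIV (\<lambda>s. V (- s))"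
    by (rule c cont_W cont_V)+
qed (rule W_nonneg V_nonneg
    U_t Ut_t DERIV_mirror_arg[OF U_s] DERIV_minus[OF Us_t] U_p Up_p Up_t
    U_q h_q h_t periodic wave_eq on_sphere
  | rule cont3I, intro continuous_intros cont3_intros)+

definition moment ::
  "(real \<Rightarrow> real \<Rightarrow> real \<times> real \<Rightarrow> real) \<Rightarrow> nat \<Rightarrow> nat \<Rightarrow> nat \<Rightarrow> real \<Rightarrow> real \<Rightarrow> real" where
  "moment F a b c t s = sphere_integral (\<lambda>z. F t s z * monom3 a b c (polar z))"

lemma moment_t:
  assumes "\<And>t s z. ((\<lambda>t. F t s z) has_real_derivative F' t s z) (at t)" "cont3 F" "cont3 F'"
  shows "((\<lambda>t. moment F a b c t s) has_real_derivative moment F' a b c t s) (at t)"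
  unfolding moment_def
  by (rule DERIV_sphere_integral)
     (auto simp: case_prod_beta intro!: DERIV_cmult_right assms(1) continuous_intros cont3_compose[OF assms(2)]
       cont3_compose[OF assms(3)])

lemma moment_s:
  assumes "\<And>t s z. ((\<lambda>s. F t s z) has_real_derivative F' t s z) (at s)" "cont3 F" "cont3 F'"
  shows "((\<lambda>s. moment F a b c t s) has_real_derivative moment F' a b c t s) (at s)"
  unfolding moment_def
  by (rule DERIV_sphere_integral)
     (auto simp: case_prod_beta intro!: DERIV_cmult_right assms(1) continuous_intros cont3_compose[OF assms(2)]
       cont3_compose[OF assms(3)])

lemma continuous_moment:
  assumes "cont3 F"
  shows "continuous_on UNIV (\<lambda>(t, s). moment F a b c t s)"
  unfolding moment_def case_prod_beta
  by (rule continuous_sphere_integral)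
     (auto simp: case_prod_beta intro!: continuous_intros cont3_compose[OF assms])

lemma moment_C2_plane:
  "C2_plane (moment U a b c) (moment Ut a b c) (moment Us a b c) (moment Utt a b c) (moment Uts a b c) (moment Uss a b c)"
  by unfold_locales
     (intro moment_t moment_s continuous_moment cont U_t Ut_t U_s Us_s Us_t Ut_s)+

text \<open>Green's formula, used once with the field and once with the monomial as the twice
  differentiated function, moves the spherical Laplacian onto the monomial. There it produces the
  eigenvalue term and monomials of degree lower by two.\<close>

lemma moment_wave_eq:
  "moment Utt a b c t s - moment Uss a b c t s =
     - (W s + real (a + b + c) * (real (a + b + c) + 1) * V s) * moment U a b c t s
     + V s * (real a * real (a - 1) * moment U (a - 2) b c t s + real b * real (b - 1) * moment U a (b - 2) c t s
       + real c * real (c - 1) * moment U a b (c - 2) t s)"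
proof -
  define m where "m z = monom3 a b c (polar z)" for z
  define Lm where "Lm z = real a * real (a - 1) * monom3 (a - 2) b c (polar z) + real b * real (b - 1) * monom3 a (b - 2) c (polar z)
       + real c * real (c - 1) * monom3 a b (c - 2) (polar z)" for z
  define n where "n = real (a + b + c) * (real (a + b + c) + 1)"
  have c1: "continuous_on A (\<lambda>z. F t s z)" if "cont3 F" for F A
    by (rule cont3_compose[OF that]) (intro continuous_intros)+
  note c1s = cont[THEN c1]
  have cm: "continuous_on A m" "continuous_on A Lm" for A
    unfolding m_def[abs_def] Lm_def[abs_def] by (intro continuous_intros)+
  have "integral polar_box (\<lambda>z. (cos (fst z) * Up t s z + sin (fst z) * Upp t s z + hq t s z) * m z)
      = - sphere_integral (\<lambda>z. Up t s z * monom3_p a b c z + h t s z * monom3_h a b c z)"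
    unfolding m_def
    by (rule green_polar) (auto intro: c1s continuous_monom3_polar Up_p h_q DERIV_monom3 simp: periodic polar_periodic)
  moreover have "integral polar_box (\<lambda>z. (cos (fst z) * monom3_p a b c z + sin (fst z) * monom3_pp a b c z + monom3_hq a b c z) * U t s z)
      = - sphere_integral (\<lambda>z. monom3_p a b c z * Up t s z + monom3_h a b c z * h t s z)"
    by (rule green_polar)
       (auto intro: c1s continuous_monom3_polar U_p U_q DERIV_monom3 simp: periodic polar_periodic)
  ultimately have "integral polar_box (\<lambda>z. (cos (fst z) * Up t s z + sin (fst z) * Upp t s z + hq t s z) * m z)
      = integral polar_box (\<lambda>z. (sin (fst z) * (Lm z - n * m z)) * U t s z)"
    unfolding monom3_laplacian by (simp add: mult.commute Lm_def n_def m_def)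
  also have "\<dots> = sphere_integral (\<lambda>z. U t s z * Lm z + - n * (U t s z * m z))"
    unfolding sphere_integral_def by (simp add: algebra_simps)
  also have "\<dots> = sphere_integral (\<lambda>z. U t s z * Lm z) - n * moment U a b c t s"
    by (subst sphere_integral_add, intro continuous_intros c1s cm, intro continuous_intros c1s cm)
       (subst sphere_integral_cmult, simp add: moment_def m_def)
  also have "sphere_integral (\<lambda>z. U t s z * Lm z) = real a * real (a - 1) * moment U (a - 2) b c t s
       + real b * real (b - 1) * moment U a (b - 2) c t s + real c * real (c - 1) * moment U a b (c - 2) t s"
  proof -
    have "(\<lambda>z. U t s z * Lm z) = (\<lambda>z. real a * real (a - 1) * (U t s z * monom3 (a - 2) b c (polar z))
       + real b * real (b - 1) * (U t s z * monom3 a (b - 2) c (polar z))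
       + real c * real (c - 1) * (U t s z * monom3 a b (c - 2) (polar z)))"
      by (simp add: Lm_def fun_eq_iff algebra_simps)
    then show ?thesis
      by (simp only: moment_def) (subst sphere_integral_add, intro continuous_intros c1s, intro continuous_intros c1s,
        subst sphere_integral_add, intro continuous_intros c1s, intro continuous_intros c1s, simp only: sphere_integral_cmult)
  qed
  finally have ang: "integral polar_box (\<lambda>z. (cos (fst z) * Up t s z + sin (fst z) * Upp t s z + hq t s z) * m z)
     = real a * real (a - 1) * moment U (a - 2) b c t s
       + real b * real (b - 1) * moment U a (b - 2) c t s + real c * real (c - 1) * moment U a b (c - 2) t s
       - n * moment U a b c t s" .
  have "moment Utt a b c t s - moment Uss a b c t s + W s * moment U a b c t s
    = sphere_integral (\<lambda>z. (Utt t s z * m z + - 1 * (Uss t s z * m z)) + W s * (U t s z * m z))"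
    by (subst sphere_integral_add, intro continuous_intros c1s cm, intro continuous_intros c1s cm,
        subst sphere_integral_add, intro continuous_intros c1s cm, intro continuous_intros c1s cm,
        simp only: sphere_integral_cmult) (simp add: moment_def m_def)
  also have "\<dots> = integral polar_box (\<lambda>z. V s * ((cos (fst z) * Up t s z + sin (fst z) * Upp t s z + hq t s z) * m z))"
    unfolding sphere_integral_def
  proof (rule integral_cong)
    fix z
    have "((Utt t s z * m z + - 1 * (Uss t s z * m z)) + W s * (U t s z * m z)) * sin (fst z)
       = (sin (fst z) * (Utt t s z - Uss t s z + W s * U t s z)) * m z" by (simp add: algebra_simps)
    then show "((Utt t s z * m z + - 1 * (Uss t s z * m z)) + W s * (U t s z * m z)) * sin (fst z)
       = V s * ((cos (fst z) * Up t s z + sin (fst z) * Upp t s z + hq t s z) * m z)"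
      unfolding wave_eq by simp
  qed
  also have "\<dots> = V s * integral polar_box (\<lambda>z. (cos (fst z) * Up t s z + sin (fst z) * Upp t s z + hq t s z) * m z)"
    by (rule integral_mult_right)
  finally show ?thesis unfolding ang n_def by (simp add: algebra_simps)
qed

text \<open>Once the moments of lower degree vanish on \<open>D\<close>, the source terms drop out
  and a scalar wave equation remains. The assumption says that this scalar problem forces the moment
  to vanish on \<open>D\<close>.\<close>

lemma moments_zero_induct:
  assumes "\<And>a b c. (\<And>t s. D t s \<Longrightarrow> moment Utt a b c t s - moment Uss a b c t s =
      - (W s + real (a + b + c) * (real (a + b + c) + 1) * V s) * moment U a b c t s) \<Longrightarrow>
      (\<And>t s. D t s \<Longrightarrow> moment U a b c t s = 0)"
    and "D t s"
  shows "moment U a b c t s = 0"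
  using assms(2)
proof (induction "a + b + c" arbitrary: a b c t s rule: less_induct)
  case less
  show ?case
  proof (rule assms(1)[OF _ less.prems])
    fix t s assume D: "D t s"
    \<comment> \<open>For \<open>a < 2\<close> the coefficient is zero. This case is split off
      because \<open>a - 2\<close> is then truncated and the degree need not drop by two, or at
      all.\<close>
    have 1: "real a * real (a - 1) * moment U (a - 2) b c t s = 0"
      using less.hyps[of "a - 2" b c t s] D by (cases "2 \<le> a") auto
    have 2: "real b * real (b - 1) * moment U a (b - 2) c t s = 0"
      using less.hyps[of a "b - 2" c t s] D by (cases "2 \<le> b") auto
    have 3: "real c * real (c - 1) * moment U a b (c - 2) t s = 0"
      using less.hyps[of a b "c - 2" t s] D by (cases "2 \<le> c") auto
    show "moment Utt a b c t s - moment Uss a b c t s =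
      - (W s + real (a + b + c) * (real (a + b + c) + 1) * V s) * moment U a b c t s"
      unfolding moment_wave_eq 1 2 3 by simp
  qed
qed

lemma zero_if_moments_zero:
  assumes "\<And>a b c. moment U a b c t s = 0"
  shows "U t s z = 0"
proof -
  obtain F where F: "continuous_on S2 F" "\<And>z. U t s z = F (polar z)" using on_sphere by blast
  have "F (polar z) = 0"
    by (rule sphere_moments_zero[OF F(1) _ polar_in_sphere]) (use assms in \<open>simp add: moment_def F(2)\<close>)
  then show ?thesis by (simp add: F(2))
qed

lemma continuous_total_potential: "continuous_on UNIV (\<lambda>s. W s + n * V s)"
  by (intro continuous_intros cont_W cont_V)

lemma left_propagation:
  assumes data: "\<And>s z. s < r \<Longrightarrow> U 0 s z = 0" "\<And>s z. s < r \<Longrightarrow> Ut 0 s z = 0"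
    and ts: "t + s < r" "- r < t - s"
  shows "U t s z = 0"
proof (rule zero_if_moments_zero)
  fix a b c
  show "moment U a b c t s = 0"
  proof (rule moments_zero_induct[where D = "\<lambda>t s. t + s < r \<and> - r < t - s"])
    fix a b c t s
    assume *: "\<And>t s. t + s < r \<and> - r < t - s \<Longrightarrow> moment Utt a b c t s - moment Uss a b c t s =
      - (W s + real (a + b + c) * (real (a + b + c) + 1) * V s) * moment U a b c t s"
      and ts: "t + s < r \<and> - r < t - s"
    show "moment U a b c t s = 0"
    proof (rule C2_plane.finite_propagation[OF moment_C2_plane continuous_total_potential])
      show "moment U a b c 0 s = 0" "moment Ut a b c 0 s = 0" if "s < r" for s
        using data that by (simp_all add: moment_def sphere_integral_def)
    qed (use * ts in blast)+
  qed (use ts in auto)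
qed

text \<open>One sequence \<open>sn\<close> serves all moments, since it will come from an energy
  bound that does not involve the test monomial.\<close>

lemma quadrant_vanishing:
  assumes data: "\<And>s z. s < r \<Longrightarrow> U 0 s z = 0" "\<And>s z. s < r \<Longrightarrow> Ut 0 s z = 0"
    and future: "\<And>b. b < \<tau>0 \<Longrightarrow> \<exists>sn. filterlim sn at_bot sequentially \<and>
        (\<forall>i j k. \<forall>x\<in>{r - 1..b}. (\<lambda>n. moment U i j k (x - sn n) (sn n)) \<longlonglongrightarrow> 0)"
    and past: "\<And>b. b < \<tau>0 \<Longrightarrow> \<exists>sn. filterlim sn at_bot sequentially \<and>
        (\<forall>i j k. \<forall>x\<in>{r - 1..b}. (\<lambda>n. moment U i j k (- (x - sn n)) (sn n)) \<longlonglongrightarrow> 0)"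
    and ts: "t + s < \<tau>0" "- \<tau>0 < t - s"
  shows "U t s z = 0"
proof (rule zero_if_moments_zero)
  fix a b c
  show "moment U a b c t s = 0"
  proof (rule moments_zero_induct[where D = "\<lambda>t s. t + s < \<tau>0 \<and> - \<tau>0 < t - s"])
    fix a b c t s
    assume *: "\<And>t s. t + s < \<tau>0 \<and> - \<tau>0 < t - s \<Longrightarrow> moment Utt a b c t s - moment Uss a b c t s =
      - (W s + real (a + b + c) * (real (a + b + c) + 1) * V s) * moment U a b c t s"
      and ts: "t + s < \<tau>0 \<and> - \<tau>0 < t - s"
    define n where "n = real (a + b + c) * (real (a + b + c) + 1)"
    obtain LW LV where L: "(HW \<longlongrightarrow> LW) at_bot" "(HV \<longlongrightarrow> LV) at_bot" using lim_bot by blast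
    show "moment U a b c t s = 0"
    proof (rule C2_plane.quadrant_zero[OF moment_C2_plane continuous_total_potential[of n]])
      show "((\<lambda>s. HW s + n * HV s) has_real_derivative W s + n * V s) (at s)" for s
        by (intro DERIV_add DERIV_cmult HW HV)
      show "((\<lambda>s. HW s + n * HV s) \<longlongrightarrow> LW + n * LV) at_bot" by (intro tendsto_intros L)
      show "0 \<le> W s + n * V s" for s using W_nonneg V_nonneg by (simp add: n_def)
      show "moment U a b c t s = 0" if "t + s < r" "- r < t - s" for t s
        using left_propagation[OF data] that by (simp add: moment_def sphere_integral_def)
      show "moment Utt a b c t s - moment Uss a b c t s = - (W s + n * V s) * moment U a b c t s"
        if "t + s < \<tau>0" "- \<tau>0 < t - s" for t s unfolding n_def by (rule *) (use that in simp)
      show "\<exists>sn. filterlim sn at_bot sequentially \<and> (\<forall>x\<in>{r - 1..b'}. (\<lambda>n. moment U a b c (x - sn n) (sn n)) \<longlonglongrightarrow> 0)"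
        if "b' < \<tau>0" for b' using future[OF that] by blast
      show "\<exists>sn. filterlim sn at_bot sequentially \<and> (\<forall>x\<in>{r - 1..b'}. (\<lambda>n. moment U a b c (- (x - sn n)) (sn n)) \<longlonglongrightarrow> 0)"
        if "b' < \<tau>0" for b' using past[OF that] by blast
    qed (use ts in auto)
  qed (use ts in auto)
qed

end

section \<open>Energy\<close>

lemma continuous_on_curry:
  assumes "continuous_on UNIV (\<lambda>(t, s). f t s)" "continuous_on A a" "continuous_on A b"
  shows "continuous_on A (\<lambda>x. f (a x) (b x))"
proof -
  have "continuous_on A (\<lambda>x. (a x, b x))" by (intro continuous_intros assms)
  from continuous_on_compose2[OF assms(1) this] show ?thesis by simp
qed

lemma integral_conserved:
  fixes e et f :: "real \<Rightarrow> real \<Rightarrow> real"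
  assumes ce: "continuous_on UNIV (\<lambda>(t, s). e t s)" and cet: "continuous_on UNIV (\<lambda>(t, s). et t s)"
    and e: "\<And>t s. ((\<lambda>t. e t s) has_real_derivative et t s) (at t)"
    and f: "\<And>t s. ((\<lambda>s. f t s) has_real_derivative et t s) (at s)"
    and bdry: "\<And>t. \<bar>t\<bar> \<le> T \<Longrightarrow> f t (- A) = f t A" and A: "0 \<le> A" and t: "\<bar>t\<bar> \<le> T"
  shows "integral {- A..A} (e t) = integral {- A..A} (e 0)"
proof -
  let ?I = "\<lambda>t. integral {- A..A} (e t)"
  have "((\<lambda>t. integral (cbox (- A) A) (e t)) has_real_derivative integral (cbox (- A) A) (et t)) (at t within UNIV)" for t
    by (rule leibniz_rule_field_derivative)
       (auto intro!: e integrable_continuous_real continuous_on_curry[OF ce] continuous_on_subset[OF cet] continuous_intros)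
  then have D: "(?I has_real_derivative integral {- A..A} (et t)) (at t)" for t by simp
  have "integral {- A..A} (et t) = 0" if "\<bar>t\<bar> \<le> T" for t
  proof -
    have "(et t has_integral f t A - f t (- A)) {- A..A}"
      by (rule fundamental_theorem_of_calculus)
         (use A f in \<open>auto simp: has_real_derivative_iff_has_vector_derivative intro: has_vector_derivative_at_within\<close>)
    then show ?thesis using bdry[OF that] by (simp add: integral_unique)
  qed
  then have D0: "(?I has_real_derivative 0) (at t)" if "\<bar>t\<bar> \<le> T" for t using D[of t] that by simp
  show ?thesis
  proof (cases "0 \<le> t")
    case True
    have "\<bar>?I t - ?I 0\<bar> \<le> 0 - 0"
      by (rule abs_increment_le[OF True, where f' = "\<lambda>_. 0" and g' = "\<lambda>_. 0" and g = "\<lambda>_. 0"]) (use D0 t in auto)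
    then show ?thesis by simp
  next
    case False
    have "\<bar>?I 0 - ?I t\<bar> \<le> 0 - 0"
      by (rule abs_increment_le[of t 0, where f' = "\<lambda>_. 0" and g' = "\<lambda>_. 0" and g = "\<lambda>_. 0"]) (use D0 t False in auto)
    then show ?thesis by simp
  qed
qed

text \<open>The bound \<open>\<bar>f\<bar> \<le> min \<bar>f\<bar> (1 / \<epsilon>) + \<epsilon> *
  (f * f)\<close> splits the integral: the truncated part tends to zero by dominated convergence,
  the rest is at most \<open>\<epsilon> * C\<close> for all \<open>n\<close>.\<close>

lemma L2_bounded_limit:
  fixes f :: "nat \<Rightarrow> 'a::euclidean_space \<Rightarrow> real"
  assumes f: "\<And>n. continuous_on (cbox a b) (f n)" and m: "continuous_on (cbox a b) m" and w: "continuous_on (cbox a b) w"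
    and w0: "\<And>x. x \<in> cbox a b \<Longrightarrow> 0 \<le> w x" and m1: "\<And>x. x \<in> cbox a b \<Longrightarrow> \<bar>m x\<bar> \<le> 1"
    and lim: "\<And>x. x \<in> cbox a b \<Longrightarrow> (\<lambda>n. f n x) \<longlonglongrightarrow> 0"
    and bdd: "\<And>n. integral (cbox a b) (\<lambda>x. f n x * f n x * w x) \<le> C"
  shows "(\<lambda>n. integral (cbox a b) (\<lambda>x. f n x * m x * w x)) \<longlonglongrightarrow> 0"
proof (rule LIMSEQ_I)
  fix r :: real assume r: "r > 0"
  define \<epsilon> where "\<epsilon> = r / (2 * (\<bar>C\<bar> + 1))"
  have \<epsilon>: "\<epsilon> > 0" using r unfolding \<epsilon>_def by simp
  have \<epsilon>C: "\<epsilon> * C \<le> r / 2"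
  proof -
    have "\<epsilon> * C \<le> \<epsilon> * (\<bar>C\<bar> + 1)" using \<epsilon> by (intro mult_left_mono) auto
    also have "\<dots> = r / 2" by (simp add: \<epsilon>_def field_simps)
    finally show ?thesis .
  qed
  let ?g = "\<lambda>n x. min \<bar>f n x\<bar> (1 / \<epsilon>) * w x"
  have "(\<lambda>n. integral (cbox a b) (?g n)) \<longlonglongrightarrow> integral (cbox a b) (\<lambda>x. 0)"
  proof (rule dominated_convergence(2))
    show "?g n integrable_on cbox a b" for n
      by (intro integrable_continuous continuous_intros f w)
    show "(\<lambda>x. 1 / \<epsilon> * w x) integrable_on cbox a b"
      by (intro integrable_continuous continuous_intros w)
    show "norm (?g n x) \<le> 1 / \<epsilon> * w x" if "x \<in> cbox a b" for n x
    proof -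
      have "?g n x \<le> 1 / \<epsilon> * w x" using w0[OF that] by (intro mult_right_mono) auto
      moreover have "0 \<le> ?g n x" using w0[OF that] \<epsilon> by simp
      ultimately show ?thesis by simp
    qed
    show "(\<lambda>n. ?g n x) \<longlonglongrightarrow> 0" if "x \<in> cbox a b" for x
    proof -
      have "(\<lambda>n. ?g n x) \<longlonglongrightarrow> min \<bar>0\<bar> (1 / \<epsilon>) * w x" by (intro tendsto_intros lim that)
      then show ?thesis using \<epsilon> by simp
    qed
  qed
  then have "(\<lambda>n. integral (cbox a b) (?g n)) \<longlonglongrightarrow> 0" by simp
  then have "eventually (\<lambda>n. integral (cbox a b) (?g n) < r / 2) sequentially"
    using r by (intro order_tendstoD(2)) auto
  then obtain N where N: "\<And>n. n \<ge> N \<Longrightarrow> integral (cbox a b) (?g n) < r / 2"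
    unfolding eventually_sequentially by blast
  show "\<exists>no. \<forall>n\<ge>no. norm (integral (cbox a b) (\<lambda>x. f n x * m x * w x) - 0) < r"
  proof (intro exI allI impI)
    fix n assume n: "N \<le> n"
    have "norm (integral (cbox a b) (\<lambda>x. f n x * m x * w x)) \<le> integral (cbox a b) (\<lambda>x. ?g n x + \<epsilon> * (f n x * f n x * w x))"
    proof (rule integral_norm_bound_integral)
      fix x assume x: "x \<in> cbox a b"
      have "\<bar>f n x\<bar> \<le> min \<bar>f n x\<bar> (1 / \<epsilon>) + \<epsilon> * (f n x * f n x)"
      proof (cases "\<bar>f n x\<bar> \<le> 1 / \<epsilon>")
        case False
        then have "\<bar>f n x\<bar> * 1 \<le> \<bar>f n x\<bar> * (\<epsilon> * \<bar>f n x\<bar>)"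
          using \<epsilon> by (intro mult_left_mono) (auto simp: field_simps)
        also have "\<dots> = \<epsilon> * (f n x * f n x)" by (simp add: mult.left_commute flip: abs_mult)
        finally have "\<bar>f n x\<bar> \<le> \<epsilon> * (f n x * f n x)" by simp
        moreover have "0 \<le> min \<bar>f n x\<bar> (1 / \<epsilon>)" using \<epsilon> by simp
        ultimately show ?thesis by linarith
      qed (use \<epsilon> in auto)
      moreover have "\<bar>f n x * m x\<bar> \<le> \<bar>f n x\<bar> * 1"
        unfolding abs_mult using m1[OF x] by (intro mult_left_mono) auto
      ultimately have "\<bar>f n x * m x\<bar> * w x \<le> (min \<bar>f n x\<bar> (1 / \<epsilon>) + \<epsilon> * (f n x * f n x)) * w x"
        using w0[OF x] by (intro mult_right_mono) auto
      then show "norm (f n x * m x * w x) \<le> ?g n x + \<epsilon> * (f n x * f n x * w x)"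
        using w0[OF x] by (simp add: abs_mult algebra_simps)
    qed (intro integrable_continuous continuous_intros f m w)+
    also have "\<dots> = integral (cbox a b) (?g n) + \<epsilon> * integral (cbox a b) (\<lambda>x. f n x * f n x * w x)"
      by (subst Henstock_Kurzweil_Integration.integral_add)
         (simp_all only: Henstock_Kurzweil_Integration.integral_mult_right, (intro integrable_continuous continuous_intros f w)+)
    also have "\<dots> \<le> integral (cbox a b) (?g n) + \<epsilon> * C" using \<epsilon> bdd by simp
    also have "\<dots> < r" using N[OF n] \<epsilon>C by simp
    finally show "norm (integral (cbox a b) (\<lambda>x. f n x * m x * w x) - 0) < r" by simp
  qed
qed

lemma abs_monom3_le_1:
  assumes "v \<in> S2"
  shows "\<bar>monom3 a b c v\<bar> \<le> 1"
proof -
  have "\<bar>v $ i\<bar> \<le> 1" for i using component_le_norm_cart[of v i] assms by simp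
  then show ?thesis
    unfolding monom3_def abs_mult power_abs by (intro mult_le_one power_le_one mult_nonneg_nonneg) auto
qed

context wave_field
begin

lemma cont_slice: "cont3 F \<Longrightarrow> continuous_on A (\<lambda>z. F t s z)"
  by (rule cont3_compose) (auto intro: continuous_intros)

definition energy where
  "energy t s = sphere_integral (\<lambda>z. Ut t s z * Ut t s z + Us t s z * Us t s z + W s * (U t s z * U t s z)
     + V s * (Up t s z * Up t s z + h t s z * h t s z))"

definition energy_t where
  "energy_t t s = sphere_integral (\<lambda>z. 2 * (Ut t s z * Utt t s z + Us t s z * Uts t s z + W s * (U t s z * Ut t s z)
     + V s * (Up t s z * Utp t s z + h t s z * ht t s z)))"

text \<open>Counted towards decreasing \<open>s\<close>: the conservation law then reads
  \<open>energy_t\<close> equals the \<open>s\<close>-derivative of \<open>flux\<close>, without a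
  sign.\<close>

definition flux where "flux t s = sphere_integral (\<lambda>z. 2 * (Ut t s z * Us t s z))"

definition kinetic where "kinetic t s = sphere_integral (\<lambda>z. Ut t s z * Ut t s z)"

lemma cont_potentials: "continuous_on A f \<Longrightarrow> continuous_on A (\<lambda>x. W (f x))"
  "continuous_on A f \<Longrightarrow> continuous_on A (\<lambda>x. V (f x))"
  by (auto intro: continuous_on_compose2[OF cont_W] continuous_on_compose2[OF cont_V])

lemma continuous_energy:
  "continuous_on UNIV (\<lambda>(t, s). energy t s)" "continuous_on UNIV (\<lambda>(t, s). energy_t t s)"
  "continuous_on UNIV (\<lambda>(t, s). kinetic t s)"
  unfolding energy_def energy_t_def kinetic_def case_prod_beta
  by (rule continuous_sphere_integral,
      unfold case_prod_beta, intro continuous_intros cont3_intros cont_potentials)+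

lemma DERIV_energy: "((\<lambda>t. energy t s) has_real_derivative energy_t t s) (at t)"
  unfolding energy_def energy_t_def
  by (rule DERIV_sphere_integral)
     ((rule derivative_eq_intros U_t Ut_t Us_t Up_t h_t refl)+, simp add: algebra_simps,
      ((unfold case_prod_beta)?, intro continuous_intros cont3_intros cont_potentials)+)

text \<open>The difference of \<open>energy_t\<close> and the derivative of the flux consists of the
  radial wave operator tested with \<open>2 * Ut\<close> and of an angular product. By the wave
  equation and Green's formula with \<open>g = Ut\<close> the two cancel.\<close>

lemma DERIV_flux: "((\<lambda>s. flux t s) has_real_derivative energy_t t s) (at s)"
proof -
  have "((\<lambda>s. flux t s) has_real_derivative
      sphere_integral (\<lambda>z. 2 * (Uts t s z * Us t s z + Ut t s z * Uss t s z))) (at s)"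
    unfolding flux_def
    by (rule DERIV_sphere_integral)
       ((rule derivative_eq_intros Us_s Ut_s refl)+, simp add: algebra_simps,
        ((unfold case_prod_beta)?, intro continuous_intros cont3_intros cont_potentials)+)
  moreover have "sphere_integral (\<lambda>z. 2 * (Uts t s z * Us t s z + Ut t s z * Uss t s z)) = energy_t t s"
  proof -
    have g: "integral polar_box (\<lambda>z. (cos (fst z) * Up t s z + sin (fst z) * Upp t s z + hq t s z) * Ut t s z)
      = - sphere_integral (\<lambda>z. Up t s z * Utp t s z + h t s z * ht t s z)"
    proof (rule green_polar)
      show "Ut t s (p, 0) = Ut t s (p, 2 * pi)" for p
      proof -
        have "((\<lambda>t. U t s (p, 0)) has_real_derivative Ut t s (p, 2 * pi)) (at t)"
          using U_t[of s "(p, 2 * pi)" t] by (simp add: periodic)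
        then show ?thesis by (rule DERIV_unique[OF U_t])
      qed
    qed (auto intro: cont_slice cont Up_p h_q Ut_p Ut_q simp: periodic)
    have c: "continuous_on UNIV (\<lambda>z. Up t s z * Utp t s z + h t s z * ht t s z)"
      by (intro continuous_intros cont_slice cont)
    have "energy_t t s = sphere_integral (\<lambda>z. 2 * (Uts t s z * Us t s z + Ut t s z * Uss t s z)
        + (2 * (Ut t s z * (Utt t s z - Uss t s z + W s * U t s z))
          + 2 * V s * (Up t s z * Utp t s z + h t s z * ht t s z)))"
      unfolding energy_t_def by (simp add: algebra_simps)
    also have "\<dots> = sphere_integral (\<lambda>z. 2 * (Uts t s z * Us t s z + Ut t s z * Uss t s z))
        + (sphere_integral (\<lambda>z. 2 * (Ut t s z * (Utt t s z - Uss t s z + W s * U t s z)))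
          + 2 * V s * sphere_integral (\<lambda>z. Up t s z * Utp t s z + h t s z * ht t s z))"
      by (subst sphere_integral_add, (intro continuous_intros cont_slice cont)+,
          subst sphere_integral_add, (intro continuous_intros cont_slice cont)+,
          simp only: sphere_integral_cmult)
    also have "sphere_integral (\<lambda>z. 2 * (Ut t s z * (Utt t s z - Uss t s z + W s * U t s z)))
       = integral polar_box (\<lambda>z. 2 * V s * ((cos (fst z) * Up t s z + sin (fst z) * Upp t s z + hq t s z) * Ut t s z))"
      unfolding sphere_integral_def
    proof (rule integral_cong)
      fix z
      have "2 * (Ut t s z * (Utt t s z - Uss t s z + W s * U t s z)) * sin (fst z)
          = 2 * (Ut t s z * (sin (fst z) * (Utt t s z - Uss t s z + W s * U t s z)))" by (simp add: mult_ac)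
      then show "2 * (Ut t s z * (Utt t s z - Uss t s z + W s * U t s z)) * sin (fst z)
          = 2 * V s * ((cos (fst z) * Up t s z + sin (fst z) * Upp t s z + hq t s z) * Ut t s z)"
        unfolding wave_eq by (simp only: mult_ac)
    qed
    also have "\<dots> = 2 * V s * integral polar_box (\<lambda>z. (cos (fst z) * Up t s z + sin (fst z) * Upp t s z + hq t s z) * Ut t s z)"
      by (rule Henstock_Kurzweil_Integration.integral_mult_right)
    finally show ?thesis unfolding g by simp
  qed
  ultimately show ?thesis by simp
qed

lemma kinetic_le_energy: "0 \<le> kinetic t s" "kinetic t s \<le> energy t s"
proof -
  show "0 \<le> kinetic t s"
    using sphere_integral_mono[of "\<lambda>z. 0" "\<lambda>z. Ut t s z * Ut t s z"] cont_slice[OF cont(2)]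
    by (simp add: kinetic_def sphere_integral_def continuous_on_mult)
  show "kinetic t s \<le> energy t s"
    unfolding kinetic_def energy_def
    by (rule sphere_integral_mono)
       (intro continuous_intros cont_slice cont, intro continuous_intros cont_slice cont,
        simp add: W_nonneg V_nonneg add_nonneg_nonneg)
qed

lemma energy_zero_if_locally_zero:
  assumes "open A" "s \<in> A" "\<And>s z. s \<in> A \<Longrightarrow> U t s z = 0" "\<And>z. Ut t s z = 0"
  shows "energy t s = 0"
proof -
  have Us0: "Us t s z = 0" for z
  proof -
    have "((\<lambda>s. 0) has_real_derivative Us t s z) (at s)"
      by (rule has_field_derivative_transform_within_open[OF U_s assms(1,2)]) (use assms(3) in auto)
    then show ?thesis by (rule DERIV_unique) simp
  qed
  have Up0: "Up t s z = 0" for z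
    using U_p[of t s "snd z" "fst z"] assms(2,3) by (auto dest: DERIV_unique[of _ _ _ 0])
  \<comment> \<open>\<open>U_q\<close> determines \<open>h\<close> only up to the factor
    \<open>sin p\<close>, which vanishes at the poles. The weight of \<open>sphere_integral\<close>
    supplies that factor.\<close>
  have h0: "sin (fst z) * h t s z = 0" for z
    using U_q[of t s "fst z" "snd z"] assms(2,3) by (auto dest: DERIV_unique[of _ _ _ 0])
  have "energy t s = integral polar_box (\<lambda>z. 0)"
    unfolding energy_def sphere_integral_def
  proof (rule integral_cong)
    fix z
    have "(Ut t s z * Ut t s z + Us t s z * Us t s z + W s * (U t s z * U t s z)
        + V s * (Up t s z * Up t s z + h t s z * h t s z)) * sin (fst z) = V s * h t s z * (sin (fst z) * h t s z)"
      using assms by (simp add: Us0 Up0)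
    then show "(Ut t s z * Ut t s z + Us t s z * Us t s z + W s * (U t s z * U t s z)
        + V s * (Up t s z * Up t s z + h t s z * h t s z)) * sin (fst z) = 0" by (simp add: h0)
  qed
  then show ?thesis by simp
qed

end

section \<open>Compactly supported data: energy bound and radiation limits\<close>

lemma (in wave_field) outer_propagation:
  assumes data: "\<And>s z. R < \<bar>s\<bar> \<Longrightarrow> U 0 s z = 0" "\<And>s z. R < \<bar>s\<bar> \<Longrightarrow> Ut 0 s z = 0"
    and "R \<ge> 0" and s: "R + \<bar>t\<bar> < \<bar>s\<bar>"
  shows "U t s z = 0"
proof (cases "s < 0")
  case True
  show ?thesis
    by (rule left_propagation[of "- R"]) (use s True \<open>R \<ge> 0\<close> data in auto)
next
  case False
  have "U t (- (- s)) z = 0"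
    by (rule wave_field.left_propagation[OF space_reflected, of "- R"]) (use s False \<open>R \<ge> 0\<close> data in auto)
  then show ?thesis by simp
qed

locale compact_wave_field = wave_field +
  fixes R :: real
  assumes R: "R \<ge> 0"
    and data: "R < \<bar>s\<bar> \<Longrightarrow> U 0 s z = 0" "R < \<bar>s\<bar> \<Longrightarrow> Ut 0 s z = 0"
begin

lemma U_outside: "R + \<bar>t\<bar> < \<bar>s\<bar> \<Longrightarrow> U t s z = 0"
  by (rule outer_propagation[OF data R])

lemma Ut_outside:
  assumes "R + \<bar>t\<bar> < \<bar>s\<bar>"
  shows "Ut t s z = 0"
proof -
  have "((\<lambda>t. 0) has_real_derivative Ut t s z) (at t)"
    by (rule has_field_derivative_transform_within_open[OF U_t, of "{t. \<bar>t\<bar> < \<bar>s\<bar> - R}"])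
       (use assms U_outside in \<open>auto intro!: open_Collect_less continuous_intros\<close>)
  then show ?thesis by (rule DERIV_unique) simp
qed

lemma energy_initial_outside:
  assumes "R < \<bar>s\<bar>"
  shows "energy 0 s = 0"
  by (rule energy_zero_if_locally_zero[of "{s. R < \<bar>s\<bar>}"])
     (use assms data in \<open>auto intro!: open_Collect_less continuous_intros\<close>)

definition total_energy where "total_energy = integral {- (R + 1)..R + 1} (energy 0)"

lemma energy_integrable: "energy t integrable_on {a..b}" "kinetic t integrable_on {a..b}"
  by (intro integrable_continuous_real continuous_on_curry[OF continuous_energy(1)]
      continuous_on_curry[OF continuous_energy(3)] continuous_intros)+

text \<open>Conservation is applied on an interval so large that its ends lie outside the support at
  all times up to \<open>\<bar>t\<bar>\<close>, where no flux passes. The resulting bound is uniform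
  in \<open>t\<close> and in the interval.\<close>

lemma kinetic_integral_le: "integral {c..d} (kinetic t) \<le> total_energy"
proof -
  define A where "A = Max {\<bar>c\<bar>, \<bar>d\<bar>, R + \<bar>t\<bar> + 1}"
  have A: "\<bar>c\<bar> \<le> A" "\<bar>d\<bar> \<le> A" "R + \<bar>t\<bar> + 1 \<le> A" by (auto simp: A_def)
  have "integral {c..d} (kinetic t) \<le> integral {- A..A} (kinetic t)"
    by (rule integral_subset_le) (use A energy_integrable kinetic_le_energy(1) in auto)
  also have "\<dots> \<le> integral {- A..A} (energy t)"
    by (rule integral_le) (use energy_integrable kinetic_le_energy(2) in auto)
  also have "\<dots> = integral {- A..A} (energy 0)"
  proof (rule integral_conserved[OF continuous_energy(1,2) DERIV_energy DERIV_flux, of "\<bar>t\<bar>"])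
    fix t' assume "\<bar>t'\<bar> \<le> \<bar>t\<bar>"
    then show "flux t' (- A) = flux t' A" using A by (simp add: flux_def Ut_outside sphere_integral_def)
  qed (use A R in auto)
  also have "\<dots> = integral {- A..- (R + 1)} (energy 0) + integral {- (R + 1)..A} (energy 0)"
    by (rule Henstock_Kurzweil_Integration.integral_combine[symmetric]) (use A R energy_integrable in auto)
  also have "integral {- (R + 1)..A} (energy 0) = total_energy + integral {R + 1..A} (energy 0)"
    unfolding total_energy_def
    by (rule Henstock_Kurzweil_Integration.integral_combine[symmetric]) (use A R energy_integrable in auto)
  also have "integral {- A..- (R + 1)} (energy 0) = integral {- A..- (R + 1)} (\<lambda>s. 0)"
    by (rule integral_cong) (use R in \<open>auto intro!: energy_initial_outside\<close>)
  also have "integral {R + 1..A} (energy 0) = integral {R + 1..A} (\<lambda>s. 0)"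
    by (rule integral_cong) (use R in \<open>auto intro!: energy_initial_outside\<close>)
  finally show ?thesis by simp
qed

text \<open>Averaging the integral over \<open>s \<in> {S..S + 1}\<close> bounds it by the energy in a time slab of length \<open>b - a + 1\<close>.\<close>

lemma kinetic_null_integral_le:
  assumes ab: "a \<le> b"
  shows "\<exists>s\<in>{S..S + 1}. integral {a..b} (\<lambda>x. kinetic (x - s) s) \<le> (b - a + 1) * total_energy"
proof -
  let ?F = "\<lambda>s. integral {a - S - 1..b - S} (\<lambda>t. kinetic t s)"
  have ck: "continuous_on UNIV (\<lambda>(s, t). kinetic t s)"
    unfolding case_prod_beta by (intro continuous_on_curry[OF continuous_energy(3)] continuous_intros)
  have "continuous_on UNIV (\<lambda>s. integral (cbox (a - S - 1) (b - S)) (\<lambda>t. kinetic t s))"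
    by (rule integral_continuous_on_param) (rule continuous_on_subset[OF ck], simp)
  then have cF: "continuous_on UNIV ?F" by simp
  \<comment> \<open>For each \<open>s\<close> in \<open>{S..S + 1}\<close> the interval
    \<open>{a - s..b - s}\<close> lies in the fixed time interval of \<open>?F\<close>. At a
    minimiser, \<open>?F\<close> is at most its mean over the unit interval.\<close>
  obtain s where s: "s \<in> {S..S + 1}" "\<And>s'. s' \<in> {S..S + 1} \<Longrightarrow> ?F s \<le> ?F s'"
    using continuous_attains_inf[of "{S..S + 1}" ?F] continuous_on_subset[OF cF subset_UNIV] by auto
  have "integral {a..b} (\<lambda>x. kinetic (x - s) s) = integral {a - s..b - s} (\<lambda>t. kinetic t s)"
    using integral_shift_Icc_real[of a b "\<lambda>t. kinetic t s" "- s"] by (simp add: o_def)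
  also have "\<dots> \<le> ?F s"
    by (rule integral_subset_le)
       (use s kinetic_le_energy(1) in \<open>auto intro!: integrable_continuous_real continuous_on_curry[OF continuous_energy(3)] continuous_intros\<close>)
  also have "\<dots> = integral {S..S + 1} (\<lambda>s'. ?F s)" by simp
  also have "\<dots> \<le> integral {S..S + 1} ?F"
    by (rule integral_le) (use s in \<open>auto intro!: integrable_continuous_real continuous_on_subset[OF cF]\<close>)
  \<comment> \<open>Exchanging the integrals turns the mean into an integral over time of kinetic
    energies on slices, each at most \<open>total_energy\<close>.\<close>
  also have "\<dots> = integral {a - S - 1..b - S} (\<lambda>t. integral {S..S + 1} (kinetic t))"
    using integral_swap_continuous[OF continuous_on_subset[OF ck subset_UNIV], of S "S + 1" "a - S - 1" "b - S"]
    unfolding box_real .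
  also have "\<dots> \<le> integral {a - S - 1..b - S} (\<lambda>t. total_energy)"
  proof (rule integral_le)
    have "continuous_on UNIV (\<lambda>t. integral (cbox S (S + 1)) (kinetic t))"
      by (rule integral_continuous_on_param) (rule continuous_on_subset[OF continuous_energy(3)], simp)
    then show "(\<lambda>t. integral {S..S + 1} (kinetic t)) integrable_on {a - S - 1..b - S}"
      unfolding box_real by (rule integrable_continuous_real[OF continuous_on_subset[OF _ subset_UNIV]])
  qed (auto intro: kinetic_integral_le)
  also have "\<dots> = (b - a + 1) * total_energy" using ab by (simp add: algebra_simps)
  finally show ?thesis using s(1) by blast
qed

text \<open>At fixed \<open>s\<close>, integrating \<open>Ut\<close> in time from the null line
  \<open>t + s = a\<close>, where \<open>U\<close> vanishes near the horizon by finite speed,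
  recovers \<open>U\<close>. The moment is therefore an integral of \<open>Ut\<close> over a box in
  \<open>x\<close> and the angles, to which \<open>L2_bounded_limit\<close> applies.\<close>

lemma moment_null_tendsto:
  assumes sn: "filterlim sn at_bot sequentially"
    and bdd: "\<And>n. integral {a..b} (\<lambda>x. kinetic (x - sn n) (sn n)) \<le> C"
    and a: "a < - R"
    and rad: "\<And>x z. x \<le> b \<Longrightarrow> ((\<lambda>s. Ut (x - s) s z) \<longlongrightarrow> 0) at_bot"
    and x: "x \<in> {a..b}"
  shows "(\<lambda>n. moment U i j k (x - sn n) (sn n)) \<longlonglongrightarrow> 0"
proof -
  let ?B = "cbox (a, 0, 0) (x, pi, 2 * pi) :: (real \<times> real \<times> real) set"
  let ?m = "\<lambda>z. monom3 i j k (polar z)"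
  let ?f = "\<lambda>n p. Ut (fst p - sn n) (sn n) (snd p)"
  have cont_f: "continuous_on A (?f n)" for A n by (intro continuous_intros cont3_intros)
  have lim: "(\<lambda>n. integral ?B (\<lambda>p. ?f n p * ?m (snd p) * sin (fst (snd p)))) \<longlonglongrightarrow> 0"
  proof (rule L2_bounded_limit[OF cont_f])
    show "continuous_on ?B (\<lambda>p. ?m (snd p))" "continuous_on ?B (\<lambda>p. sin (fst (snd p)))"
      by (intro continuous_intros)+
    fix p assume p: "p \<in> ?B"
    then have pp: "snd p \<in> polar_box" "fst p \<in> {a..x}" by (cases p, auto simp only: cbox_Pair_iff fst_conv snd_conv box_real)+
    show "0 \<le> sin (fst (snd p))" using pp(1) by (rule sin_polar_nonneg)
    show "\<bar>?m (snd p)\<bar> \<le> 1" by (rule abs_monom3_le_1[OF polar_in_sphere])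
    show "(\<lambda>n. ?f n p) \<longlonglongrightarrow> 0"
      using filterlim_compose[OF rad sn, of "fst p" "snd p"] pp x by auto
  next
    fix n
    have c: "continuous_on ?B (\<lambda>p. ?f n p * ?f n p * sin (fst (snd p)))" by (intro continuous_intros cont_f)
    have "integral ?B (\<lambda>p. ?f n p * ?f n p * sin (fst (snd p)))
        = integral (cbox a x) (\<lambda>x. kinetic (x - sn n) (sn n))"
      using integral_prod_continuous[OF c] by (simp add: kinetic_def sphere_integral_def)
    also have "\<dots> \<le> integral {a..b} (\<lambda>x. kinetic (x - sn n) (sn n))"
      unfolding box_real
      by (rule integral_subset_le)
         (use x kinetic_le_energy(1) in \<open>auto intro!: integrable_continuous_real continuous_on_curry[OF continuous_energy(3)] continuous_intros\<close>)
    also have "\<dots> \<le> C" by (rule bdd)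
    finally show "integral ?B (\<lambda>p. ?f n p * ?f n p * sin (fst (snd p))) \<le> C" .
  qed
  \<comment> \<open>This places \<open>(a - sn n, sn n)\<close> in the region of
    \<open>left_propagation\<close>: its \<open>t + s\<close> is \<open>a < - R\<close> and its
    \<open>t - s\<close> is \<open>a - 2 * sn n > R\<close>.\<close>
  have "eventually (\<lambda>n. sn n < (a - R) / 2) sequentially"
    using sn unfolding filterlim_at_bot_dense by (rule spec)
  then have "eventually (\<lambda>n. integral ?B (\<lambda>p. ?f n p * ?m (snd p) * sin (fst (snd p))) = moment U i j k (x - sn n) (sn n)) sequentially"
  proof eventually_elim
    case (elim n)
    have U0: "U (a - sn n) (sn n) z = 0" for z
      using left_propagation[of "- R" "a - sn n" "sn n" z] data R elim a by simp
    have Ueq: "integral (cbox a x) (\<lambda>x. Ut (x - sn n) (sn n) z) = U (x - sn n) (sn n) z" for z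
    proof -
      have "((\<lambda>x. Ut (x - sn n) (sn n) z) has_integral U (x - sn n) (sn n) z - U (a - sn n) (sn n) z) {a..x}"
      proof (rule fundamental_theorem_of_calculus)
        fix y
        have "((\<lambda>x. U (x - sn n) (sn n) z) has_real_derivative Ut (y - sn n) (sn n) z * 1) (at y)"
          by (rule DERIV_chain2[OF U_t]) (auto intro!: derivative_eq_intros)
        then show "((\<lambda>x. U (x - sn n) (sn n) z) has_vector_derivative Ut (y - sn n) (sn n) z) (at y within {a..x})"
          by (simp add: has_real_derivative_iff_has_vector_derivative has_vector_derivative_at_within)
      qed (use x in auto)
      then show ?thesis by (simp add: U0 integral_unique)
    qed
    have c: "continuous_on ?B (\<lambda>p. ?f n p * ?m (snd p) * sin (fst (snd p)))" by (intro continuous_intros cont_f)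
    have c': "continuous_on (cbox (a, 0, 0) (x, pi, 2 * pi)) (\<lambda>(y, z). Ut (y - sn n) (sn n) z * ?m z * sin (fst z))"
      unfolding case_prod_beta by (intro continuous_intros cont3_intros)
    have "integral ?B (\<lambda>p. ?f n p * ?m (snd p) * sin (fst (snd p)))
       = integral (cbox a x) (\<lambda>y. integral polar_box (\<lambda>z. Ut (y - sn n) (sn n) z * ?m z * sin (fst z)))"
      using integral_prod_continuous[OF c] by simp
    also have "\<dots> = integral polar_box (\<lambda>z. integral (cbox a x) (\<lambda>y. Ut (y - sn n) (sn n) z * ?m z * sin (fst z)))"
      by (rule integral_swap_continuous[OF c'])
    also have "\<dots> = moment U i j k (x - sn n) (sn n)"
      unfolding moment_def sphere_integral_def
      by (simp only: mult.assoc Henstock_Kurzweil_Integration.integral_mult_left Ueq)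
    finally show ?case .
  qed
  then show ?thesis using lim by (rule Lim_transform_eventually[rotated])
qed

lemma radiation_moment_sequence:
  assumes rad: "\<And>x z. x \<le> b \<Longrightarrow> ((\<lambda>s. Ut (x - s) s z) \<longlongrightarrow> 0) at_bot"
  shows "\<exists>sn. filterlim sn at_bot sequentially \<and>
      (\<forall>i j k. \<forall>x\<in>{- R - 1..b}. (\<lambda>n. moment U i j k (x - sn n) (sn n)) \<longlonglongrightarrow> 0)"
proof (cases "- R - 1 \<le> b")
  case True
  define C where "C = (b - (- R - 1) + 1) * total_energy"
  have "\<exists>s. s \<in> {- real n - 1..- real n - 1 + 1} \<and> integral {- R - 1..b} (\<lambda>x. kinetic (x - s) s) \<le> C" for n
    using kinetic_null_integral_le[OF True, of "- real n - 1"] unfolding C_def by blast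
  then obtain sn where sn: "\<And>n. sn n \<in> {- real n - 1..- real n - 1 + 1}"
    "\<And>n. integral {- R - 1..b} (\<lambda>x. kinetic (x - sn n) (sn n)) \<le> C" by metis
  have "filterlim sn at_bot sequentially"
  proof (rule filterlim_at_bot_mono)
    show "filterlim (\<lambda>n. - real n) at_bot sequentially"
      using filterlim_real_sequentially by (simp add: filterlim_uminus_at_bot)
  qed (use sn(1) in auto)
  with moment_null_tendsto[OF _ sn(2) _ rad] show ?thesis by (intro exI[of _ sn]) auto
next
  case False
  \<comment> \<open>The range of \<open>x\<close> is empty here, so any sequence tending to
    \<open>- \<infinity>\<close> will do.\<close>
  have "filterlim (\<lambda>n. - real n) at_bot sequentially"
    using filterlim_real_sequentially by (simp add: filterlim_uminus_at_bot)
  with False show ?thesis by (intro exI[of _ "\<lambda>n. - real n"]) auto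
qed

lemma radiation_vanishing:
  assumes future: "\<And>x z. x \<le> \<tau>0 \<Longrightarrow> ((\<lambda>s. Ut (x - s) s z) \<longlongrightarrow> 0) at_bot"
    and past: "\<And>x z. x \<le> \<tau>0 \<Longrightarrow> ((\<lambda>s. Ut (- (x - s)) s z) \<longlongrightarrow> 0) at_bot"
    and ts: "t + s < \<tau>0" "- \<tau>0 < t - s"
  shows "U t s z = 0"
proof (rule quadrant_vanishing[of "- R" \<tau>0])
  interpret rev: compact_wave_field W V HW HV "\<lambda>t s. U (- t) s" "\<lambda>t s z. - Ut (- t) s z" "\<lambda>t s. Us (- t) s"
    "\<lambda>t s. Utt (- t) s" "\<lambda>t s z. - Uts (- t) s z" "\<lambda>t s. Uss (- t) s" "\<lambda>t s. Up (- t) s" "\<lambda>t s. Upp (- t) s"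
    "\<lambda>t s z. - Utp (- t) s z" "\<lambda>t s. h (- t) s" "\<lambda>t s. hq (- t) s" "\<lambda>t s z. - ht (- t) s z"
    by (intro compact_wave_field.intro time_reversed compact_wave_field_axioms.intro) (use R data in auto)
  fix b assume b: "b < \<tau>0"
  show "\<exists>sn. filterlim sn at_bot sequentially \<and>
      (\<forall>i j k. \<forall>x\<in>{- R - 1..b}. (\<lambda>n. moment U i j k (x - sn n) (sn n)) \<longlonglongrightarrow> 0)"
    by (rule radiation_moment_sequence) (use future b in auto)
  have "\<exists>sn. filterlim sn at_bot sequentially \<and>
      (\<forall>i j k. \<forall>x\<in>{- R - 1..b}. (\<lambda>n. rev.moment (\<lambda>t s. U (- t) s) i j k (x - sn n) (sn n)) \<longlonglongrightarrow> 0)"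
    by (rule rev.radiation_moment_sequence) (use tendsto_minus[OF past] b in auto)
  then show "\<exists>sn. filterlim sn at_bot sequentially \<and>
      (\<forall>i j k. \<forall>x\<in>{- R - 1..b}. (\<lambda>n. moment U i j k (- (x - sn n)) (sn n)) \<longlonglongrightarrow> 0)"
    by (simp only: moment_def rev.moment_def)
qed (use data R ts in auto)

lemma reflected: "compact_wave_field (\<lambda>s. W (- s)) (\<lambda>s. V (- s)) (\<lambda>s. - HW (- s)) (\<lambda>s. - HV (- s))
    (\<lambda>t s. U t (- s)) (\<lambda>t s z. Ut t (- s) z) (\<lambda>t s z. - Us t (- s) z) (\<lambda>t s. Utt t (- s))
    (\<lambda>t s z. - Uts t (- s) z) (\<lambda>t s. Uss t (- s)) (\<lambda>t s. Up t (- s)) (\<lambda>t s. Upp t (- s)) (\<lambda>t s z. Utp t (- s) z)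
    (\<lambda>t s. h t (- s)) (\<lambda>t s. hq t (- s)) (\<lambda>t s z. ht t (- s) z) R"
  by (intro compact_wave_field.intro space_reflected compact_wave_field_axioms.intro) (use R data in auto)

end

section \<open>The tortoise coordinate\<close>

context
  fixes M :: real
  assumes M: "M > 0"
begin

lemma tortoise_deriv:
  assumes "2 * M < r"
  shows "(tortoise M has_real_derivative r / (r - 2 * M)) (at r)"
  unfolding tortoise_def
  using assms by (auto intro!: derivative_eq_intros simp: field_simps)

lemma tortoise_less:
  assumes "2 * M < r" "r < r'"
  shows "tortoise M r < tortoise M r'"
proof (rule DERIV_pos_imp_increasing[OF assms(2)])
  fix x assume "r \<le> x" "x \<le> r'"
  then have "2 * M < x" using assms by simp
  then show "\<exists>y. DERIV (tortoise M) x :> y \<and> 0 < y"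
    using tortoise_deriv[of x] M by (intro exI[of _ "x / (x - 2 * M)"]) auto
qed

lemma tortoise_less_iff:
  assumes "2 * M < r" "2 * M < r'"
  shows "tortoise M r < tortoise M r' \<longleftrightarrow> r < r'"
  using tortoise_less assms by (metis linorder_neqE_linordered_idom order_less_asym order_less_irrefl)

lemma tortoise_surj: "\<exists>r>2 * M. tortoise M r = s"
proof -
  \<comment> \<open>Capping the exponent at \<open>0\<close> keeps the exponential at most
    \<open>1\<close>, while the logarithmic term is at most \<open>s - 2 * M - 1\<close>; the sum is
    at most \<open>s\<close>. At \<open>b\<close> the logarithm is nonnegative and \<open>b\<close>
    itself is at least \<open>s\<close>.\<close>
  define a where "a = 2 * M + exp (min 0 ((s - 2 * M - 1) / (2 * M)))"
  define b where "b = 2 * M + 1 + \<bar>s\<bar>"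
  have a: "2 * M < a" by (simp add: a_def)
  have "tortoise M a = 2 * M + exp (min 0 ((s - 2 * M - 1) / (2 * M))) + 2 * M * min 0 ((s - 2 * M - 1) / (2 * M))"
    by (simp add: tortoise_def a_def)
  moreover have "exp (min 0 ((s - 2 * M - 1) / (2 * M))) \<le> 1" by simp
  moreover have "2 * M * min 0 ((s - 2 * M - 1) / (2 * M)) \<le> s - 2 * M - 1"
  proof -
    have "2 * M * min 0 ((s - 2 * M - 1) / (2 * M)) \<le> 2 * M * ((s - 2 * M - 1) / (2 * M))"
      using M by (intro mult_left_mono) auto
    then show ?thesis using M by simp
  qed
  ultimately have "tortoise M a \<le> s" by linarith
  moreover have "s \<le> tortoise M b"
  proof -
    have "0 \<le> ln (b - 2 * M)" by (simp add: b_def)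
    then have "0 \<le> 2 * M * ln (b - 2 * M)" using M by simp
    moreover have "s \<le> b" using M by (simp add: b_def)
    ultimately show ?thesis unfolding tortoise_def by linarith
  qed
  moreover have "a \<le> b"
  proof -
    have "exp (min 0 ((s - 2 * M - 1) / (2 * M))) \<le> 1" by simp
    then show ?thesis unfolding a_def b_def using abs_ge_zero[of s] by linarith
  qed
  moreover have "continuous_on {a..b} (tortoise M)"
    using a by (intro continuous_at_imp_continuous_on ballI DERIV_isCont[OF tortoise_deriv]) auto
  ultimately obtain r where "a \<le> r" "r \<le> b" "tortoise M r = s" using IVT'[of "tortoise M" a s b] by blast
  then show ?thesis using a by (intro exI[of _ r]) auto
qed

definition rho :: "real \<Rightarrow> real" where "rho s = (THE r. 2 * M < r \<and> tortoise M r = s)"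

lemma rho: "2 * M < rho s" "tortoise M (rho s) = s"
proof -
  have "\<exists>!r. 2 * M < r \<and> tortoise M r = s"
    using tortoise_surj tortoise_less by (metis linorder_neqE_linordered_idom order_less_irrefl)
  from theI'[OF this] show "2 * M < rho s" "tortoise M (rho s) = s" by (auto simp: rho_def)
qed

lemma rho_tortoise: "2 * M < r \<Longrightarrow> rho (tortoise M r) = r"
  using rho[of "tortoise M r"] tortoise_less by (metis linorder_neqE_linordered_idom order_less_irrefl)

lemma rho_pos: "0 < rho s"
  using rho(1)[of s] M by linarith

lemma rho_deriv: "(rho has_real_derivative 1 - 2 * M / rho s) (at s)"
proof -
  have "(rho has_derivative (*) (inverse (rho s / (rho s - 2 * M)))) (at (tortoise M (rho s)))"
  proof (rule has_derivative_inverse_strong[where S = "{2 * M<..}" and f = "tortoise M"])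
    show "continuous_on {2 * M<..} (tortoise M)"
      by (intro continuous_at_imp_continuous_on ballI DERIV_isCont[OF tortoise_deriv]) auto
    show "(tortoise M has_derivative (*) (rho s / (rho s - 2 * M))) (at (rho s))"
      using tortoise_deriv[OF rho(1)] by (simp add: has_field_derivative_def)
  qed (use rho[of s] rho_pos[of s] rho_tortoise in \<open>auto simp: fun_eq_iff\<close>)
  moreover have "inverse (rho s / (rho s - 2 * M)) = 1 - 2 * M / rho s"
    using rho_pos[of s] by (simp add: field_simps)
  ultimately show ?thesis by (simp add: rho(2) has_field_derivative_def)
qed

lemma continuous_rho: "continuous_on A f \<Longrightarrow> continuous_on A (\<lambda>x. rho (f x))"
  by (rule continuous_on_compose2[of UNIV])
     (auto intro!: continuous_at_imp_continuous_on DERIV_isCont[OF rho_deriv])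

lemma rho_at_bot: "filterlim rho (at_right (2 * M)) at_bot"
proof -
  have "(rho \<longlongrightarrow> 2 * M) at_bot"
  proof (rule order_tendstoI)
    fix a assume "a < 2 * M"
    then show "eventually (\<lambda>s. a < rho s) at_bot" using rho(1) by (intro always_eventually) (auto intro: less_trans)
  next
    fix a assume a: "2 * M < a"
    have "rho s < a" if "s < tortoise M a" for s
      using tortoise_less_iff[OF rho(1) a, of s] that by (simp add: rho(2))
    then show "eventually (\<lambda>s. rho s < a) at_bot" unfolding eventually_at_bot_dense by blast
  qed
  moreover have "rho s \<noteq> 2 * M" for s using rho(1)[of s] by simp
  ultimately show ?thesis using rho(1) by (auto simp: filterlim_at intro!: always_eventually)
qed

lemma rho_at_top: "filterlim rho at_top at_top"
proof (rule filterlim_at_top_dense[THEN iffD2], rule allI)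
  fix K
  have "K < rho s" if "tortoise M (max K (2 * M + 1)) < s" for s
    using tortoise_less_iff[OF _ rho(1), of "max K (2 * M + 1)" s] that by (simp add: rho(2))
  then show "eventually (\<lambda>s. K < rho s) at_top" unfolding eventually_at_top_dense by blast
qed

definition pot_V where "pot_V s = (1 - 2 * M / rho s) / (rho s)\<^sup>2"
definition pot_W where "pot_W s = 2 * M * (1 - 2 * M / rho s) / (rho s) ^ 3"

lemma lapse_nonneg: "0 \<le> 1 - 2 * M / rho s"
  using rho(1)[of s] rho_pos[of s] by (simp add: field_simps)

lemma pot_nonneg: "0 \<le> pot_V s" "0 \<le> pot_W s"
  unfolding pot_V_def pot_W_def using lapse_nonneg[of s] rho_pos[of s] M
  by (auto intro!: divide_nonneg_pos mult_nonneg_nonneg)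

lemma continuous_pot: "continuous_on A pot_V" "continuous_on A pot_W"
  unfolding pot_V_def pot_W_def
  by (intro continuous_intros continuous_rho; use rho_pos in \<open>simp add: less_imp_neq[symmetric]\<close>)+

lemma pot_antiderivative:
  "((\<lambda>s. - 1 / rho s) has_real_derivative pot_V s) (at s)"
  "((\<lambda>s. - M / (rho s)\<^sup>2) has_real_derivative pot_W s) (at s)"
proof -
  have n: "rho s \<noteq> 0" using rho_pos[of s] by simp
  show "((\<lambda>s. - 1 / rho s) has_real_derivative pot_V s) (at s)"
    unfolding pot_V_def
    by (rule derivative_eq_intros rho_deriv refl n)+ (simp add: n power2_eq_square)
  show "((\<lambda>s. - M / (rho s)\<^sup>2) has_real_derivative pot_W s) (at s)"
    unfolding pot_W_def
    by (rule derivative_eq_intros rho_deriv refl | simp add: n)+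
       (simp add: n field_simps power2_eq_square power3_eq_cube power4_eq_xxxx)
qed

lemma pot_antiderivative_limits:
  "\<exists>L. ((\<lambda>s. - 1 / rho s) \<longlongrightarrow> L) at_bot" "\<exists>L. ((\<lambda>s. - M / (rho s)\<^sup>2) \<longlongrightarrow> L) at_bot"
  "\<exists>L. ((\<lambda>s. - 1 / rho s) \<longlongrightarrow> L) at_top" "\<exists>L. ((\<lambda>s. - M / (rho s)\<^sup>2) \<longlongrightarrow> L) at_top"
proof -
  have b: "(rho \<longlongrightarrow> 2 * M) at_bot" using rho_at_bot by (simp add: filterlim_at)
  show "\<exists>L. ((\<lambda>s. - 1 / rho s) \<longlongrightarrow> L) at_bot"
    by (rule exI[of _ "- 1 / (2 * M)"], intro tendsto_intros b) (use M in auto)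
  show "\<exists>L. ((\<lambda>s. - M / (rho s)\<^sup>2) \<longlongrightarrow> L) at_bot"
    by (rule exI[of _ "- M / (2 * M)\<^sup>2"], intro tendsto_intros b) (use M in auto)
  show "\<exists>L. ((\<lambda>s. - 1 / rho s) \<longlongrightarrow> L) at_top"
    by (rule exI[of _ 0], rule tendsto_divide_0[OF tendsto_const],
        rule filterlim_at_top_imp_at_infinity[OF rho_at_top])
  show "\<exists>L. ((\<lambda>s. - M / (rho s)\<^sup>2) \<longlongrightarrow> L) at_top"
    by (rule exI[of _ 0], rule tendsto_divide_0[OF tendsto_const],
        rule filterlim_at_top_imp_at_infinity, rule filterlim_pow_at_top[OF _ rho_at_top]) simp
qed

end

section \<open>The solution in tortoise and polar coordinates\<close>

lemma Ck_on_Pair: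
  fixes f :: "'a::euclidean_space \<Rightarrow> 'b::real_normed_vector" and g :: "'a \<Rightarrow> 'c::real_normed_vector"
  assumes "open U" "Ck_on k U f" "Ck_on k U g"
  shows "Ck_on k U (\<lambda>x. (f x, g x))"
proof -
  have l: "bounded_linear (\<lambda>x :: 'b. (x, 0 :: 'c))" and r: "bounded_linear (\<lambda>y :: 'c. (0 :: 'b, y))"
    by (intro bounded_linear_Pair bounded_linear_ident bounded_linear_zero)+
  have "Ck_on k U (\<lambda>x. (f x, 0) + (0, g x))"
    by (intro Ck_on_add[OF assms(1)] Ck_on_linear_compose[OF assms(1) l] Ck_on_linear_compose[OF assms(1) r] assms)
  then show ?thesis by simp
qed

lemma D1_eq: "(f has_vector_derivative d) (at x) \<Longrightarrow> D1 f x = d"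
  unfolding D1_def by (rule vector_derivative_at)

text \<open>The outer \<open>D1\<close> differentiates the function \<open>D1 f\<close>, so the
  first derivative has to be identified on a neighbourhood and not just at \<open>s\<close>.\<close>

lemma D1_D1_eq:
  assumes "open N" "s \<in> N" "\<And>x. x \<in> N \<Longrightarrow> (f has_vector_derivative f1 x) (at x)"
    and "(f1 has_vector_derivative f2) (at s)"
  shows "D1 (D1 f) s = f2"
proof (rule D1_eq)
  show "(D1 f has_vector_derivative f2) (at s)"
    by (rule has_vector_derivative_transform_within_open[OF assms(4,1,2)]) (simp add: D1_eq[OF assms(3)])
qed

lemma has_vector_derivative_chain:
  assumes "(f has_derivative f') (at (\<gamma> s))" "(\<gamma> has_vector_derivative d) (at s)"
  shows "((\<lambda>s. f (\<gamma> s)) has_vector_derivative f' d) (at s)"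
proof -
  interpret bounded_linear f' using assms(1) by (rule has_derivative_bounded_linear)
  show ?thesis
    using has_derivative_compose[OF assms(2)[unfolded has_vector_derivative_def] assms(1)]
    by (simp add: has_vector_derivative_def scaleR)
qed

lemma sum_Basis_vec3: "(\<Sum>b\<in>(Basis :: vec3 set). f b) = f (axis 1 1) + f (axis 2 1) + f (axis 3 1)"
proof -
  have "(Basis :: vec3 set) = (\<lambda>i. axis i 1) ` UNIV" by (auto simp: Basis_vec_def)
  moreover have "inj (\<lambda>i :: 3. axis i (1 :: real))" by (auto simp: inj_on_def axis_eq_axis)
  ultimately have "(\<Sum>b\<in>(Basis :: vec3 set). f b) = sum (f \<circ> (\<lambda>i. axis i 1)) UNIV"
    by (metis sum.reindex)
  then show ?thesis by (simp add: sum_3)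
qed

lemma vec3_eq_axis: "(v :: vec3) = v $ 1 *\<^sub>R axis 1 1 + v $ 2 *\<^sub>R axis 2 1 + v $ 3 *\<^sub>R axis 3 1"
  by (simp add: vec_eq_iff axis_def forall_3)

lemma linear_e_x:
  fixes f :: "real \<times> real \<times> vec3 \<Rightarrow> 'a::real_normed_vector"
  assumes "bounded_linear f"
  shows "f (0, 0, y) = y $ 1 *\<^sub>R f (0, 0, axis 1 1) + y $ 2 *\<^sub>R f (0, 0, axis 2 1) + y $ 3 *\<^sub>R f (0, 0, axis 3 1)"
proof -
  interpret bounded_linear f by fact
  have "(0, 0, y) = y $ 1 *\<^sub>R (0 :: real, 0 :: real, axis 1 1) + y $ 2 *\<^sub>R (0, 0, axis 2 1) + y $ 3 *\<^sub>R (0, 0, axis 3 1)"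
    by (simp flip: vec3_eq_axis)
  then have "f (0, 0, y) = f (y $ 1 *\<^sub>R (0, 0, axis 1 1) + y $ 2 *\<^sub>R (0, 0, axis 2 1) + y $ 3 *\<^sub>R (0, 0, axis 3 1))"
    by (rule arg_cong)
  then show ?thesis by (simp only: add scaleR)
qed

section \<open>The solution extended along rays\<close>

locale schwarzschild_solution =
  fixes M :: real and u :: "real \<times> real \<times> vec3 \<Rightarrow> complex"
  assumes M: "M > 0" and smooth: "smooth_on (UNIV \<times> exterior M) u"
    and box_zero: "p \<in> UNIV \<times> exterior M \<Longrightarrow> schwarzschild_box M u p = 0"
begin

definition dom :: "(real \<times> real \<times> vec3) set" where
  "dom = {p. 2 * M < fst (snd p) \<and> snd (snd p) \<noteq> 0}"

text \<open>This extension lives on the open set \<open>dom\<close>, where ordinary derivatives make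
  sense. It is also the one that \<open>sphere_laplacian\<close> differentiates, so the angular part
  of the equation becomes the flat Laplacian of \<open>G\<close> in the last variable.\<close>

definition G :: "real \<times> real \<times> vec3 \<Rightarrow> complex" where
  "G p = u (fst p, fst (snd p), snd (snd p) /\<^sub>R norm (snd (snd p)))"

definition G1 where "G1 v p = frechet_derivative G (at p) v"
definition G2 where "G2 v w p = frechet_derivative (G1 v) (at p) w"

abbreviation "e_t \<equiv> (1 :: real, 0 :: real, 0 :: vec3)"
abbreviation "e_r \<equiv> (0 :: real, 1 :: real, 0 :: vec3)"
abbreviation "e_x i \<equiv> (0 :: real, 0 :: real, axis i 1 :: vec3)"

lemma e_Basis: "e_t \<in> Basis" "e_r \<in> Basis" "e_x i \<in> Basis"
  by (auto simp: Basis_prod_def Basis_vec_def zero_prod_def)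

lemma open_dom: "open dom"
proof -
  have "open {p :: real \<times> real \<times> vec3. 2 * M < fst (snd p)}" "open {p :: real \<times> real \<times> vec3. snd (snd p) \<noteq> 0}"
    by (intro open_Collect_less open_Collect_neq continuous_intros)+
  then show ?thesis unfolding dom_def by (rule open_Collect_conj)
qed

lemma Ck_on_G: "Ck_on k dom G"
  unfolding G_def
proof (rule smooth_on_retract[OF smooth open_dom])
  have id: "Ck_on k dom (\<lambda>p. p)" for k by (rule Ck_on_id[OF open_dom])
  have x: "Ck_on k dom (\<lambda>p. snd (snd p))" and r: "Ck_on k dom (\<lambda>p. fst (snd p))" for k
    by (intro Ck_on_linear_compose[OF open_dom _ id] bounded_linear_compose[OF bounded_linear_snd bounded_linear_snd]
        bounded_linear_compose[OF bounded_linear_fst bounded_linear_snd])+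
  show "Ck_on k dom (\<lambda>p. (fst p, fst (snd p), snd (snd p) /\<^sub>R norm (snd (snd p))))" for k
    by (intro Ck_on_Pair[OF open_dom] Ck_on_normalize[OF open_dom x] r
        Ck_on_linear_compose[OF open_dom bounded_linear_fst id]) (simp add: dom_def)
  show "(\<lambda>p. (fst p, fst (snd p), snd (snd p) /\<^sub>R norm (snd (snd p)))) ` dom \<subseteq> UNIV \<times> exterior M"
    by (auto simp: dom_def exterior_def)
qed

lemma G_deriv: "p \<in> dom \<Longrightarrow> (G has_derivative (\<lambda>v. G1 v p)) (at p)"
  unfolding G1_def using Ck_on_SucD[OF Ck_on_G[of "Suc 0"]] by simp

lemma Ck_on_G1: "v \<in> Basis \<Longrightarrow> Ck_on k dom (G1 v)"
  using Ck_on_G[of "Suc k"] unfolding G1_def[abs_def] by simp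

lemma G1_deriv: "v \<in> Basis \<Longrightarrow> p \<in> dom \<Longrightarrow> (G1 v has_derivative (\<lambda>w. G2 v w p)) (at p)"
  unfolding G2_def using Ck_on_SucD[OF Ck_on_G1[of v "Suc 0"]] by simp

lemma continuous_G: "continuous_on dom G"
  using Ck_on_G[of 0] by simp

lemma continuous_G1: "v \<in> Basis \<Longrightarrow> continuous_on dom (G1 v)"
  using Ck_on_G1[of v 0] by simp

lemma continuous_G2: "v \<in> Basis \<Longrightarrow> w \<in> Basis \<Longrightarrow> continuous_on dom (G2 v w)"
  using Ck_on_G1[of v "Suc 0"] unfolding G2_def[abs_def] by simp

lemma curve_G:
  "(\<gamma> has_vector_derivative d) (at s) \<Longrightarrow> \<gamma> s \<in> dom \<Longrightarrow> ((\<lambda>s. G (\<gamma> s)) has_vector_derivative G1 d (\<gamma> s)) (at s)"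
  by (rule has_vector_derivative_chain[OF G_deriv])

lemma curve_G1:
  "v \<in> Basis \<Longrightarrow> (\<gamma> has_vector_derivative d) (at s) \<Longrightarrow> \<gamma> s \<in> dom \<Longrightarrow>
    ((\<lambda>s. G1 v (\<gamma> s)) has_vector_derivative G2 v d (\<gamma> s)) (at s)"
  by (rule has_vector_derivative_chain[OF G1_deriv])

lemma D1_line:
  assumes "d \<in> Basis" "p + s *\<^sub>R d \<in> dom"
  shows "D1 (\<lambda>s. G (p + s *\<^sub>R d)) s = G1 d (p + s *\<^sub>R d)"
    and "D1 (D1 (\<lambda>s. G (p + s *\<^sub>R d))) s = G2 d d (p + s *\<^sub>R d)"
proof -
  have line: "((\<lambda>s. p + s *\<^sub>R d) has_vector_derivative d) (at s)" for s
    by (auto intro!: derivative_eq_intros)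
  define N where "N = (\<lambda>s. p + s *\<^sub>R d) -` dom"
  have N: "open N" unfolding N_def by (intro open_vimage open_dom continuous_intros)
  show "D1 (\<lambda>s. G (p + s *\<^sub>R d)) s = G1 d (p + s *\<^sub>R d)"
    by (rule D1_eq[OF curve_G[OF line assms(2)]])
  show "D1 (D1 (\<lambda>s. G (p + s *\<^sub>R d))) s = G2 d d (p + s *\<^sub>R d)"
  proof (rule D1_D1_eq[OF N])
    show "((\<lambda>s. G (p + s *\<^sub>R d)) has_vector_derivative G1 d (p + x *\<^sub>R d)) (at x)" if "x \<in> N" for x
      using curve_G[OF line, of x] that by (simp add: N_def)
    show "((\<lambda>s. G1 d (p + s *\<^sub>R d)) has_vector_derivative G2 d d (p + s *\<^sub>R d)) (at s)"
      by (rule curve_G1[OF assms(1) line assms(2)])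
  qed (use assms in \<open>simp add: N_def\<close>)
qed

lemma u_eq_G: "\<omega> \<in> S2 \<Longrightarrow> u (t, r, \<omega>) = G (t, r, \<omega>)"
  by (simp add: G_def)

lemma D1_u_time: "2 * M < r \<Longrightarrow> \<omega> \<in> S2 \<Longrightarrow> D1 (\<lambda>s. u (s, r, \<omega>)) t = G1 e_t (t, r, \<omega>)"
  using D1_line(1)[OF e_Basis(1), of "(0, r, \<omega>)" t] by (cases "\<omega> = 0") (simp_all add: u_eq_G dom_def)

lemma wave_equation_G:
  assumes "2 * M < r" "\<omega> \<in> S2"
  shows "- (r / (r - 2 * M)) *\<^sub>R G2 e_t e_t (t, r, \<omega>) + ((r - 2 * M) / r) *\<^sub>R G2 e_r e_r (t, r, \<omega>)
    + (1 / r\<^sup>2) *\<^sub>R (G2 (e_x 1) (e_x 1) (t, r, \<omega>) + G2 (e_x 2) (e_x 2) (t, r, \<omega>) + G2 (e_x 3) (e_x 3) (t, r, \<omega>))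
    + (2 * (r - M) / r\<^sup>2) *\<^sub>R G1 e_r (t, r, \<omega>) = 0"
proof -
  have dom: "(t, r, \<omega>) \<in> dom" using assms by (auto simp: dom_def)
  have tt: "D1 (D1 (\<lambda>s. u (s, r, \<omega>))) t = G2 e_t e_t (t, r, \<omega>)"
    using D1_line(2)[OF e_Basis(1), of "(0, r, \<omega>)" t] dom by (simp add: u_eq_G[OF assms(2)])
  have r: "D1 (\<lambda>s. u (t, s, \<omega>)) r = G1 e_r (t, r, \<omega>)" "D1 (D1 (\<lambda>s. u (t, s, \<omega>))) r = G2 e_r e_r (t, r, \<omega>)"
    using D1_line[OF e_Basis(2), of "(t, 0, \<omega>)" r] dom by (simp_all add: u_eq_G[OF assms(2)])
  have x: "D1 (D1 (\<lambda>s. u (t, r, (\<omega> + s *\<^sub>R axis i 1) /\<^sub>R norm (\<omega> + s *\<^sub>R axis i 1)))) 0 = G2 (e_x i) (e_x i) (t, r, \<omega>)" for i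
    using D1_line(2)[OF e_Basis(3)[of i], of "(t, r, \<omega>)" 0] dom by (simp add: G_def)
  have "schwarzschild_box M u (t, r, \<omega>) = 0" using assms by (intro box_zero) (auto simp: exterior_def)
  then show ?thesis
    unfolding schwarzschild_box_def sphere_laplacian_def laplacian_def sum_Basis_vec3 prod.case tt r x .
qed

text \<open>Differentiating \<open>G (t, r, (1 + c) x) = G (t, r, x)\<close> along rays.\<close>

lemma radial_derivatives_zero:
  assumes "(t, r, x) \<in> dom"
  shows "x $ 1 *\<^sub>R G1 (e_x 1) (t, r, x) + x $ 2 *\<^sub>R G1 (e_x 2) (t, r, x) + x $ 3 *\<^sub>R G1 (e_x 3) (t, r, x) = 0" (is "?E x = 0")
    and "x $ 1 *\<^sub>R (x $ 1 *\<^sub>R G2 (e_x 1) (e_x 1) (t, r, x) + x $ 2 *\<^sub>R G2 (e_x 1) (e_x 2) (t, r, x) + x $ 3 *\<^sub>R G2 (e_x 1) (e_x 3) (t, r, x))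
     + x $ 2 *\<^sub>R (x $ 1 *\<^sub>R G2 (e_x 2) (e_x 1) (t, r, x) + x $ 2 *\<^sub>R G2 (e_x 2) (e_x 2) (t, r, x) + x $ 3 *\<^sub>R G2 (e_x 2) (e_x 3) (t, r, x))
     + x $ 3 *\<^sub>R (x $ 1 *\<^sub>R G2 (e_x 3) (e_x 1) (t, r, x) + x $ 2 *\<^sub>R G2 (e_x 3) (e_x 2) (t, r, x) + x $ 3 *\<^sub>R G2 (e_x 3) (e_x 3) (t, r, x)) = 0"
proof -
  have ray: "((\<lambda>c. (t, r, (1 + c) *\<^sub>R y)) has_vector_derivative (0, 0, y)) (at c)" for c y
  proof -
    have "((\<lambda>c. (t, r, y) + c *\<^sub>R (0, 0, y)) has_vector_derivative (0, 0, y)) (at c)"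
      by (auto intro!: derivative_eq_intros)
    then show ?thesis by (simp add: scaleR_add_left)
  qed
  have E: "?E x = 0" if x: "(t, r, x) \<in> dom" for x
  proof -
    have "((\<lambda>c. G (t, r, (1 + c) *\<^sub>R x)) has_vector_derivative G1 (0, 0, x) (t, r, x)) (at 0)"
      using curve_G[OF ray[of x 0]] x by simp
    moreover have "((\<lambda>c. G (t, r, (1 + c) *\<^sub>R x)) has_vector_derivative 0) (at 0)"
    proof (rule has_vector_derivative_transform_within_open[of "\<lambda>c. G (t, r, x)" _ _ "{-1<..}"])
      show "G (t, r, x) = G (t, r, (1 + c) *\<^sub>R x)" if "c \<in> {-1<..}" for c :: real
      proof -
        have eq: "inverse (1 + c) * inverse (norm x) * (1 + c) = inverse (norm x)" using that by simp
        show ?thesis using that by (simp add: G_def eq)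
      qed
    qed auto
    ultimately have "G1 (0, 0, x) (t, r, x) = 0" by (rule vector_derivative_unique_at)
    with linear_e_x[OF has_derivative_bounded_linear[OF G_deriv[OF x]], of x] show ?thesis by metis
  qed
  then show "?E x = 0" using assms .
  have d: "(t, r, x) \<in> dom" by fact
  \<comment> \<open>The product rule for the first-order identity \<open>?E = 0\<close> along the
    ray. The terms with a differentiated coefficient add up to \<open>?E x\<close> again, so only
    the second derivative in the radial direction is left.\<close>
  have S: "((\<lambda>c. ((1 + c) *\<^sub>R x) $ i *\<^sub>R G1 (e_x i) (t, r, (1 + c) *\<^sub>R x)) has_vector_derivative
      x $ i *\<^sub>R G2 (e_x i) (0, 0, x) (t, r, x) + x $ i *\<^sub>R G1 (e_x i) (t, r, x)) (at 0)" for i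
  proof -
    have a: "((\<lambda>c. (1 + c) * x $ i) has_real_derivative x $ i) (at 0)" by (auto intro!: derivative_eq_intros)
    have b: "((\<lambda>c. G1 (e_x i) (t, r, (1 + c) *\<^sub>R x)) has_vector_derivative G2 (e_x i) (0, 0, x) (t, r, x)) (at 0)"
      using curve_G1[OF e_Basis(3)[of i] ray[of x 0]] d by simp
    show ?thesis using has_vector_derivative_scaleR[OF a b] by simp
  qed
  have "((\<lambda>c. ?E ((1 + c) *\<^sub>R x)) has_vector_derivative 0) (at 0)"
  proof (rule has_vector_derivative_transform_within_open[of "\<lambda>c. 0" _ _ "{-1<..}"])
    show "0 = ?E ((1 + c) *\<^sub>R x)" if "c \<in> {-1<..}" for c :: real
      by (rule E[symmetric]) (use that d in \<open>auto simp: dom_def\<close>)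
  qed auto
  from vector_derivative_unique_at[OF this has_vector_derivative_add[OF has_vector_derivative_add[OF S[of 1] S[of 2]] S[of 3]]]
  have "x $ 1 *\<^sub>R G2 (e_x 1) (0, 0, x) (t, r, x) + x $ 2 *\<^sub>R G2 (e_x 2) (0, 0, x) (t, r, x) + x $ 3 *\<^sub>R G2 (e_x 3) (0, 0, x) (t, r, x)
      + ?E x = 0" by (simp add: algebra_simps)
  then have "x $ 1 *\<^sub>R G2 (e_x 1) (0, 0, x) (t, r, x) + x $ 2 *\<^sub>R G2 (e_x 2) (0, 0, x) (t, r, x) + x $ 3 *\<^sub>R G2 (e_x 3) (0, 0, x) (t, r, x) = 0"
    unfolding E[OF d] by (simp only: add_0_right)
  then show "x $ 1 *\<^sub>R (x $ 1 *\<^sub>R G2 (e_x 1) (e_x 1) (t, r, x) + x $ 2 *\<^sub>R G2 (e_x 1) (e_x 2) (t, r, x) + x $ 3 *\<^sub>R G2 (e_x 1) (e_x 3) (t, r, x))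
     + x $ 2 *\<^sub>R (x $ 1 *\<^sub>R G2 (e_x 2) (e_x 1) (t, r, x) + x $ 2 *\<^sub>R G2 (e_x 2) (e_x 2) (t, r, x) + x $ 3 *\<^sub>R G2 (e_x 2) (e_x 3) (t, r, x))
     + x $ 3 *\<^sub>R (x $ 1 *\<^sub>R G2 (e_x 3) (e_x 1) (t, r, x) + x $ 2 *\<^sub>R G2 (e_x 3) (e_x 2) (t, r, x) + x $ 3 *\<^sub>R G2 (e_x 3) (e_x 3) (t, r, x)) = 0"
    by (simp only: linear_e_x[OF has_derivative_bounded_linear[OF G1_deriv[OF e_Basis(3) d]], of _ x, symmetric])
qed

end

text \<open>The wave theory above is real-valued; \<open>B\<close> will range over functionals such
  as the real and imaginary part, which together detect whether a complex number is zero.\<close>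

locale schwarzschild_field = schwarzschild_solution +
  fixes B :: "complex \<Rightarrow> real"
  assumes B: "bounded_linear B"
begin

abbreviation "\<rho> \<equiv> rho M"

lemma in_dom: "(t, \<rho> s, polar z) \<in> dom"
  using rho(1)[OF M, of s] polar_in_sphere[of z] by (auto simp: dom_def)

lemma B_linear: "B (x + y) = B x + B y" "B (c *\<^sub>R x) = c * B x" "B 0 = 0"
proof -
  interpret bounded_linear B by (rule B)
  show "B (x + y) = B x + B y" "B (c *\<^sub>R x) = c * B x" "B 0 = 0" by (simp_all add: add scaleR zero)
qed

lemma DERIV_curve:
  assumes "(K has_derivative K') (at (\<gamma> s))" "(\<gamma> has_vector_derivative d) (at s)"
  shows "((\<lambda>s. B (K (\<gamma> s))) has_real_derivative B (K' d)) (at s)"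
  unfolding has_real_derivative_iff_has_vector_derivative
  by (rule bounded_linear.has_vector_derivative[OF B has_vector_derivative_chain[OF assms]])

lemma time_line: "((\<lambda>t. (t, r, v)) has_vector_derivative e_t) (at t)"
proof -
  have "((\<lambda>t. (0, r, v) + t *\<^sub>R e_t) has_vector_derivative e_t) (at t)"
    by (auto intro!: derivative_eq_intros simp: zero_prod_def)
  then show ?thesis by simp
qed

lemma radial_line: "((\<lambda>r. (t, r, v)) has_vector_derivative e_r) (at r)"
proof -
  have "((\<lambda>r. (t, 0, v) + r *\<^sub>R e_r) has_vector_derivative e_r) (at r)"
    by (auto intro!: derivative_eq_intros simp: zero_prod_def)
  then show ?thesis by simp
qed

lemma DERIV_time:
  assumes "\<And>p. p \<in> dom \<Longrightarrow> (K has_derivative (\<lambda>w. K' w p)) (at p)" "(t, r, v) \<in> dom"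
  shows "((\<lambda>t. B (K (t, r, v))) has_real_derivative B (K' e_t (t, r, v))) (at t)"
  by (rule DERIV_curve[OF assms(1)[OF assms(2)] time_line])

definition "lapse s = 1 - 2 * M / \<rho> s"

lemma rho_lapse: "(\<rho> has_real_derivative lapse s) (at s)"
  unfolding lapse_def by (rule rho_deriv[OF M])

lemma DERIV_tortoise:
  assumes "\<And>p. p \<in> dom \<Longrightarrow> (K has_derivative (\<lambda>w. K' w p)) (at p)" "(t, \<rho> s, v) \<in> dom"
  shows "((\<lambda>s. B (K (t, \<rho> s, v))) has_real_derivative B (K' e_r (t, \<rho> s, v)) * lapse s) (at s)"
  by (rule DERIV_chain2[OF DERIV_curve[OF assms(1)[OF assms(2)] radial_line] rho_lapse])

lemma has_grad3_section:
  assumes K: "\<And>p. p \<in> dom \<Longrightarrow> (K has_derivative (\<lambda>w. K' w p)) (at p)" and r: "2 * M < r"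
  shows "has_grad3 (\<lambda>v. c * B (K (t, r, v))) (\<lambda>v. c * B (K' (e_x 1) (t, r, v))) (\<lambda>v. c * B (K' (e_x 2) (t, r, v)))
    (\<lambda>v. c * B (K' (e_x 3) (t, r, v)))"
  unfolding has_grad3_def
proof
  fix v assume v: "v \<in> S2"
  then have d: "(t, r, v) \<in> dom" using r by (auto simp: dom_def)
  have "((\<lambda>v. (t, r, v)) has_derivative (\<lambda>w. (0, 0, w))) (at v)"
    by (intro has_derivative_Pair has_derivative_const has_derivative_ident)
  from bounded_linear.has_derivative[OF B has_derivative_compose[OF this K[OF d]]]
  have "((\<lambda>v. c * B (K (t, r, v))) has_derivative (\<lambda>w. c * B (K' (0, 0, w) (t, r, v)))) (at v)"
    by (rule has_derivative_mult_right)
  then show "((\<lambda>v. c * B (K (t, r, v))) has_derivative (\<lambda>d. d $ 1 * (c * B (K' (e_x 1) (t, r, v))) +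
      d $ 2 * (c * B (K' (e_x 2) (t, r, v))) + d $ 3 * (c * B (K' (e_x 3) (t, r, v))))) (at v)"
  proof (rule has_derivative_eq_rhs, intro ext)
    fix w
    show "c * B (K' (0, 0, w) (t, r, v)) = w $ 1 * (c * B (K' (e_x 1) (t, r, v))) +
      w $ 2 * (c * B (K' (e_x 2) (t, r, v))) + w $ 3 * (c * B (K' (e_x 3) (t, r, v)))"
      unfolding linear_e_x[OF has_derivative_bounded_linear[OF K[OF d]], of w]
      by (simp add: B_linear algebra_simps)
  qed
qed

text \<open>These are the entries of \<open>wave_field\<close> for \<open>r u\<close>. A derivative
  in \<open>s\<close> brings in \<open>lapse\<close>, the derivative of \<open>\<rho>\<close>. The
  angular entries are built from the Cartesian derivatives \<open>F1\<close>, \<open>F2\<close> and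
  \<open>F1t\<close>, which makes their continuity at the poles immediate.\<close>

definition "U t s z = \<rho> s * B (G (t, \<rho> s, polar z))"
definition "Ut t s z = \<rho> s * B (G1 e_t (t, \<rho> s, polar z))"
definition "Utt t s z = \<rho> s * B (G2 e_t e_t (t, \<rho> s, polar z))"
definition "Us t s z = lapse s * (B (G (t, \<rho> s, polar z)) + \<rho> s * B (G1 e_r (t, \<rho> s, polar z)))"
definition "Uts t s z = lapse s * (B (G1 e_t (t, \<rho> s, polar z)) + \<rho> s * B (G2 e_r e_t (t, \<rho> s, polar z)))"
definition "Uss t s z = lapse s * (2 * M / (\<rho> s)\<^sup>2 * (B (G (t, \<rho> s, polar z)) + \<rho> s * B (G1 e_r (t, \<rho> s, polar z)))
   + lapse s * (2 * B (G1 e_r (t, \<rho> s, polar z)) + \<rho> s * B (G2 e_r e_r (t, \<rho> s, polar z))))"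
definition "F1 i t s v = \<rho> s * B (G1 (e_x i) (t, \<rho> s, v))"
definition "F2 i j t s v = \<rho> s * B (G2 (e_x i) (e_x j) (t, \<rho> s, v))"
definition "F1t i t s v = \<rho> s * B (G2 (e_x i) e_t (t, \<rho> s, v))"
definition "Up t s = polar_dp (F1 1 t s) (F1 2 t s) (F1 3 t s)"
definition "h t s = polar_h (F1 1 t s) (F1 2 t s)"
definition "Utp t s = polar_dp (F1t 1 t s) (F1t 2 t s) (F1t 3 t s)"
definition "ht t s = polar_h (F1t 1 t s) (F1t 2 t s)"
definition "Upp t s = polar_dpp (F1 1 t s) (F1 2 t s) (F1 3 t s) (F2 1 1 t s) (F2 1 2 t s) (F2 1 3 t s)
   (F2 2 1 t s) (F2 2 2 t s) (F2 2 3 t s) (F2 3 1 t s) (F2 3 2 t s) (F2 3 3 t s)"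
definition "hq t s = polar_hq (F1 1 t s) (F1 2 t s) (F2 1 1 t s) (F2 1 2 t s) (F2 2 1 t s) (F2 2 2 t s)"

lemma cont_section:
  assumes "continuous_on dom K"
  shows "cont3 (\<lambda>t s z. B (K (t, \<rho> s, polar z)))"
proof (rule cont3I, rule bounded_linear.continuous_on[OF B], rule continuous_on_compose2[OF assms])
  show "continuous_on UNIV (\<lambda>x. (fst x, \<rho> (fst (snd x)), polar (snd (snd x))))"
    by (intro continuous_intros continuous_rho[OF M] continuous_on_compose2[OF continuous_polar[of UNIV]]) auto
qed (use in_dom in auto)

lemmas cont_sections =
  cont_section[OF continuous_G, THEN cont3_compose] cont_section[OF continuous_G1[OF e_Basis(1)], THEN cont3_compose]
  cont_section[OF continuous_G1[OF e_Basis(2)], THEN cont3_compose]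
  cont_section[OF continuous_G1[OF e_Basis(3)], THEN cont3_compose]
  cont_section[OF continuous_G2[OF e_Basis(1) e_Basis(1)], THEN cont3_compose]
  cont_section[OF continuous_G2[OF e_Basis(2) e_Basis(1)], THEN cont3_compose]
  cont_section[OF continuous_G2[OF e_Basis(2) e_Basis(2)], THEN cont3_compose]
  cont_section[OF continuous_G2[OF e_Basis(3) e_Basis(1)], THEN cont3_compose]
  cont_section[OF continuous_G2[OF e_Basis(3) e_Basis(3)], THEN cont3_compose]

lemma rho_nz: "\<rho> s \<noteq> 0"
  using rho_pos[OF M, of s] by simp

lemma fields_continuous:
  "cont3 U" "cont3 Ut" "cont3 Us" "cont3 Utt" "cont3 Uts" "cont3 Uss" "cont3 Up" "cont3 Upp" "cont3 Utp"
  "cont3 h" "cont3 hq" "cont3 ht"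
  unfolding U_def[abs_def] Ut_def[abs_def] Us_def[abs_def] Utt_def[abs_def] Uts_def[abs_def] Uss_def[abs_def]
    Up_def[abs_def] Upp_def[abs_def] Utp_def[abs_def] h_def[abs_def] hq_def[abs_def] ht_def[abs_def] lapse_def
    polar_dp_def[abs_def] polar_h_def[abs_def] polar_dpp_def[abs_def] polar_hq_def[abs_def] F1_def F2_def F1t_def
  by (rule cont3I, intro continuous_intros continuous_rho[OF M] cont_sections; simp add: rho_nz)+

lemma lapse_deriv: "(lapse has_real_derivative 2 * M / (\<rho> s)\<^sup>2 * lapse s) (at s)"
  unfolding lapse_def[abs_def]
  by (rule derivative_eq_intros rho_deriv[OF M] refl | simp add: rho_nz)+
     (simp add: rho_nz power2_eq_square field_simps)

lemma field_equation:
  "sin (fst z) * (Utt t s z - Uss t s z + pot_W M s * U t s z)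
    = pot_V M s * (cos (fst z) * Up t s z + sin (fst z) * Upp t s z + hq t s z)"
proof -
  define r where "r = \<rho> s"
  define v where "v = polar z"
  define b bt br where "b = B (G (t, r, v))" and "bt = B (G2 e_t e_t (t, r, v))" and "br = B (G1 e_r (t, r, v))"
  define brr where "brr = B (G2 e_r e_r (t, r, v))"
  define L where "L = B (G2 (e_x 1) (e_x 1) (t, r, v)) + B (G2 (e_x 2) (e_x 2) (t, r, v)) + B (G2 (e_x 3) (e_x 3) (t, r, v))"
  have r: "2 * M < r" "r \<noteq> 0" "r - 2 * M \<noteq> 0" using rho(1)[OF M, of s] rho_nz by (auto simp: r_def)
  have dom: "(t, r, v) \<in> dom" unfolding r_def v_def by (rule in_dom)
  have "- (r / (r - 2 * M)) * bt + ((r - 2 * M) / r) * brr + (1 / r\<^sup>2) * L + (2 * (r - M) / r\<^sup>2) * br = 0"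
    using arg_cong[OF wave_equation_G[OF r(1) polar_in_sphere[of z], of t], of B]
    by (simp only: B_linear v_def b_def bt_def br_def brr_def L_def)
  \<comment> \<open>Eliminating the second time derivative lets the next identity be checked as one
    between rational functions of \<open>r\<close>.\<close>
  then have rbt: "r * bt = (r - 2 * M) * (((r - 2 * M) / r) * brr + (1 / r\<^sup>2) * L + (2 * (r - M) / r\<^sup>2) * br)"
    using r by (simp add: field_simps)
  \<comment> \<open>The factor \<open>r\<close> in \<open>U\<close> makes the first-order terms
    \<open>br\<close> cancel, and the leftover multiple of \<open>b\<close> is cancelled by the
    potential \<open>pot_W\<close>; only the angular part survives.\<close>
  have radial: "r * bt - (1 - 2 * M / r) * (2 * M / r\<^sup>2 * (b + r * br) + (1 - 2 * M / r) * (2 * br + r * brr))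
      + 2 * M * (1 - 2 * M / r) / r ^ 3 * (r * b) = (1 - 2 * M / r) / r\<^sup>2 * (r * L)"
    unfolding rbt using r by (simp add: field_simps power2_eq_square power3_eq_cube)
  \<comment> \<open>\<open>N1\<close> and \<open>N2\<close> hold since \<open>G\<close> is constant
    along rays. They remove the radial terms of \<open>polar_laplacian\<close>, of which only the
    trace of the Hessian remains.\<close>
  have N1: "v $ 1 * F1 1 t s v + v $ 2 * F1 2 t s v + v $ 3 * F1 3 t s v = 0"
  proof -
    have "r * B (v $ 1 *\<^sub>R G1 (e_x 1) (t, r, v) + v $ 2 *\<^sub>R G1 (e_x 2) (t, r, v) + v $ 3 *\<^sub>R G1 (e_x 3) (t, r, v)) = 0"
      unfolding radial_derivatives_zero(1)[OF dom] by (simp add: B_linear)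
    then show ?thesis by (simp add: B_linear F1_def r_def algebra_simps)
  qed
  have N2: "v $ 1 * (v $ 1 * F2 1 1 t s v + v $ 2 * F2 1 2 t s v + v $ 3 * F2 1 3 t s v)
      + v $ 2 * (v $ 1 * F2 2 1 t s v + v $ 2 * F2 2 2 t s v + v $ 3 * F2 2 3 t s v)
      + v $ 3 * (v $ 1 * F2 3 1 t s v + v $ 2 * F2 3 2 t s v + v $ 3 * F2 3 3 t s v) = 0"
  proof -
    have "r * B (v $ 1 *\<^sub>R (v $ 1 *\<^sub>R G2 (e_x 1) (e_x 1) (t, r, v) + v $ 2 *\<^sub>R G2 (e_x 1) (e_x 2) (t, r, v) + v $ 3 *\<^sub>R G2 (e_x 1) (e_x 3) (t, r, v))
     + v $ 2 *\<^sub>R (v $ 1 *\<^sub>R G2 (e_x 2) (e_x 1) (t, r, v) + v $ 2 *\<^sub>R G2 (e_x 2) (e_x 2) (t, r, v) + v $ 3 *\<^sub>R G2 (e_x 2) (e_x 3) (t, r, v))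
     + v $ 3 *\<^sub>R (v $ 1 *\<^sub>R G2 (e_x 3) (e_x 1) (t, r, v) + v $ 2 *\<^sub>R G2 (e_x 3) (e_x 2) (t, r, v) + v $ 3 *\<^sub>R G2 (e_x 3) (e_x 3) (t, r, v))) = 0"
      unfolding radial_derivatives_zero(2)[OF dom] by (simp add: B_linear)
    then show ?thesis by (simp add: B_linear F2_def r_def algebra_simps)
  qed
  have ang: "cos (fst z) * Up t s z + sin (fst z) * Upp t s z + hq t s z
      = sin (fst z) * (F2 1 1 t s v + F2 2 2 t s v + F2 3 3 t s v)"
    unfolding Up_def Upp_def hq_def polar_laplacian v_def[symmetric] N1 N2 by simp
  have "F2 1 1 t s v + F2 2 2 t s v + F2 3 3 t s v = r * L"
    by (simp add: F2_def L_def r_def algebra_simps)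
  then show ?thesis
    unfolding ang pot_W_def[OF M] pot_V_def[OF M] Utt_def Uss_def U_def lapse_def
    unfolding r_def[symmetric] v_def[symmetric] b_def[symmetric] bt_def[symmetric] br_def[symmetric] brr_def[symmetric]
    by (simp only: radial) (simp only: mult_ac)
qed

sublocale wave_field "pot_W M" "pot_V M" "\<lambda>s. - M / (\<rho> s)\<^sup>2" "\<lambda>s. - 1 / \<rho> s"
  U Ut Us Utt Uts Uss Up Upp Utp h hq ht
proof
  fix t s p q and z :: "real \<times> real"
  have Gd: "(G has_derivative (\<lambda>w. G1 w p)) (at p)" if "p \<in> dom" for p using that by (rule G_deriv)
  have G1d: "(G1 e_t has_derivative (\<lambda>w. G2 e_t w p)) (at p)" "(G1 e_r has_derivative (\<lambda>w. G2 e_r w p)) (at p)"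
    "(G1 (e_x i) has_derivative (\<lambda>w. G2 (e_x i) w p)) (at p)" if "p \<in> dom" for p i
    using that by (auto intro: G1_deriv e_Basis)
  have r: "2 * M < \<rho> s" by (rule rho(1)[OF M])
  show "((\<lambda>t. U t s z) has_real_derivative Ut t s z) (at t)"
    unfolding U_def Ut_def by (rule DERIV_cmult[OF DERIV_time[OF Gd in_dom]])
  show "((\<lambda>t. Ut t s z) has_real_derivative Utt t s z) (at t)"
    unfolding Ut_def Utt_def by (rule DERIV_cmult[OF DERIV_time[OF G1d(1) in_dom]])
  show "((\<lambda>s. U t s z) has_real_derivative Us t s z) (at s)"
    unfolding U_def Us_def
    by (rule DERIV_cong[OF DERIV_mult[OF rho_lapse DERIV_tortoise[OF Gd in_dom]]])
       (simp_all add: algebra_simps)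
  show "((\<lambda>s. Us t s z) has_real_derivative Uss t s z) (at s)"
    unfolding Us_def Uss_def
    by (rule DERIV_cong[OF DERIV_mult[OF lapse_deriv DERIV_add[OF DERIV_tortoise[OF Gd in_dom]
          DERIV_mult[OF rho_lapse DERIV_tortoise[OF G1d(2) in_dom]]]]])
       (simp_all add: algebra_simps)
  show "((\<lambda>t. Us t s z) has_real_derivative Uts t s z) (at t)"
    unfolding Us_def Uts_def
    by (rule DERIV_cmult[OF DERIV_add[OF DERIV_time[OF Gd in_dom] DERIV_cmult[OF DERIV_time[OF G1d(2) in_dom]]]])
  have g1: "has_grad3 (\<lambda>v. \<rho> s * B (G (t, \<rho> s, v))) (F1 1 t s) (F1 2 t s) (F1 3 t s)"
    unfolding F1_def[abs_def] by (rule has_grad3_section[OF Gd r])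
  have g2: "has_grad3 (F1 i t s) (F2 i 1 t s) (F2 i 2 t s) (F2 i 3 t s)" for i
    unfolding F1_def[abs_def] F2_def[abs_def] by (rule has_grad3_section[OF G1d(3) r])
  show "((\<lambda>p. U t s (p, q)) has_real_derivative Up t s (p, q)) (at p)"
    unfolding U_def Up_def by (rule DERIV_polar(1)[OF g1])
  show "((\<lambda>p. Up t s (p, q)) has_real_derivative Upp t s (p, q)) (at p)"
    unfolding Up_def Upp_def by (rule DERIV_polar_dp[OF g2 g2 g2])
  show "((\<lambda>q. U t s (p, q)) has_real_derivative sin p * h t s (p, q)) (at q)"
    unfolding U_def h_def by (rule DERIV_polar(2)[OF g1])
  show "((\<lambda>q. h t s (p, q)) has_real_derivative hq t s (p, q)) (at q)"
    unfolding h_def hq_def by (rule DERIV_polar_h[OF g2 g2])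
  have F1t: "((\<lambda>t. F1 i t s (polar z)) has_real_derivative F1t i t s (polar z)) (at t)" for i
    unfolding F1_def F1t_def by (rule DERIV_cmult[OF DERIV_time[OF G1d(3) in_dom]])
  show "((\<lambda>t. Up t s z) has_real_derivative Utp t s z) (at t)"
    unfolding Up_def Utp_def polar_dp_def by (intro DERIV_add DERIV_diff DERIV_cmult F1t)
  show "((\<lambda>t. h t s z) has_real_derivative ht t s z) (at t)"
    unfolding h_def ht_def polar_h_def by (intro DERIV_diff DERIV_cmult F1t)
  have per: "polar (p, 2 * pi) = polar (p, 0)" by (simp add: polar_periodic)
  show "U t s (p, 2 * pi) = U t s (p, 0)" "h t s (p, 2 * pi) = h t s (p, 0)"
    by (simp_all add: U_def h_def polar_h_def per)
  show "\<exists>F. continuous_on S2 F \<and> (\<forall>z. U t s z = F (polar z))"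
  proof (intro exI conjI allI)
    show "continuous_on S2 (\<lambda>v. \<rho> s * B (G (t, \<rho> s, v)))"
      by (intro continuous_intros bounded_linear.continuous_on[OF B] continuous_on_compose2[OF continuous_G])
         (use r in \<open>auto simp: dom_def\<close>)
  qed (rule U_def)
qed (rule fields_continuous field_equation continuous_pot[OF M] pot_nonneg[OF M] pot_antiderivative[OF M]
    pot_antiderivative_limits[OF M])+

end

section \<open>The support theorem\<close>

text \<open>The support is compact inside the exterior, where \<open>tortoise M\<close> is
  continuous, so its values there are bounded: the data stay away from both ends of the
  line.\<close>

lemma compact_support_tortoise_bound:
  assumes M: "M > 0" and "Cc_infinity (exterior M) f"
  shows "\<exists>R\<ge>0. \<forall>r>2 * M. \<forall>\<omega>\<in>S2. R < \<bar>tortoise M r\<bar> \<longrightarrow> f (r, \<omega>) = 0"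
proof -
  define K where "K = supp_in (exterior M) f"
  have K: "compact K" using assms by (simp add: Cc_infinity_def K_def)
  have sub: "K \<subseteq> exterior M"
    using closure_of_subset_topspace[of "top_of_set (exterior M)"] by (simp add: K_def supp_in_def)
  have "continuous_on K (\<lambda>p. tortoise M (fst p))"
  proof (rule continuous_on_compose2[of "{2 * M<..}" "tortoise M"])
    show "continuous_on {2 * M<..} (tortoise M)"
      by (intro continuous_at_imp_continuous_on ballI DERIV_isCont[OF tortoise_deriv[OF M]]) auto
  qed (use sub in \<open>auto simp: exterior_def intro!: continuous_intros\<close>)
  then have "bounded ((\<lambda>p. tortoise M (fst p)) ` K)"
    using K by (intro compact_imp_bounded compact_continuous_image)
  then obtain R where R: "\<And>p. p \<in> K \<Longrightarrow> \<bar>tortoise M (fst p)\<bar> \<le> R"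
    unfolding bounded_iff by auto
  have "f (r, \<omega>) = 0" if "2 * M < r" "\<omega> \<in> S2" "max R 0 < \<bar>tortoise M r\<bar>" for r \<omega>
  proof (rule ccontr)
    assume "f (r, \<omega>) \<noteq> 0"
    then have "(r, \<omega>) \<in> {x \<in> exterior M. f x \<noteq> 0}" using that by (simp add: exterior_def)
    also have "\<dots> \<subseteq> K" unfolding K_def supp_in_def by (rule closure_of_subset) auto
    finally show False using R[of "(r, \<omega>)"] that by simp
  qed
  then show ?thesis by (intro exI[of _ "max R 0"]) auto
qed

lemma supp_in_subset:
  assumes "closed T" and "\<And>x. x \<in> S \<Longrightarrow> x \<notin> T \<Longrightarrow> f x = 0"
  shows "supp_in S f \<subseteq> S \<inter> T"
  unfolding supp_in_def
  by (rule closure_of_minimal) (use assms in \<open>auto intro: closedin_closed_Int\<close>)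

lemma complex_bounded_linear_zero:
  fixes x :: complex
  assumes "\<And>B :: complex \<Rightarrow> real. bounded_linear B \<Longrightarrow> B x = 0"
  shows "x = 0"
  using assms[OF bounded_linear_Re] assms[OF bounded_linear_Im] by (simp add: complex_eq_iff)

context schwarzschild_field
begin

lemma Ut_eq_D1: "Ut t s z = \<rho> s * B (D1 (\<lambda>t. u (t, \<rho> s, polar z)) t)"
  unfolding Ut_def using D1_u_time[OF rho(1)[OF M] polar_in_sphere] by simp

lemma U_eq_u: "U t s z = \<rho> s * B (u (t, \<rho> s, polar z))"
  unfolding U_def using u_eq_G[OF polar_in_sphere] by simp

lemma zero_near_imp_data_zero:
  assumes "open A" "0 \<in> A" "\<And>t. t \<in> A \<Longrightarrow> U t s z = 0"
  shows "B (u (0, \<rho> s, polar z)) = 0" "B (D1 (\<lambda>t. u (t, \<rho> s, polar z)) 0) = 0"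
proof -
  show "B (u (0, \<rho> s, polar z)) = 0" using assms(3)[OF assms(2)] by (simp add: U_eq_u rho_nz)
  have "((\<lambda>t. 0) has_real_derivative Ut 0 s z) (at 0)"
    by (rule has_field_derivative_transform_within_open[OF U_t assms(1,2)]) (use assms(3) in auto)
  then have "Ut 0 s z = 0" by (rule DERIV_unique) simp
  then show "B (D1 (\<lambda>t. u (t, \<rho> s, polar z)) 0) = 0" by (simp add: Ut_eq_D1 rho_nz)
qed

lemma compact_data:
  assumes "cauchy_solution M \<phi> \<psi> u" "Cc_infinity (exterior M) \<phi>" "Cc_infinity (exterior M) \<psi>"
  shows "\<exists>R. compact_wave_field (pot_W M) (pot_V M) (\<lambda>s. - M / (\<rho> s)\<^sup>2) (\<lambda>s. - 1 / \<rho> s)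
    U Ut Us Utt Uts Uss Up Upp Utp h hq ht R"
proof -
  obtain R1 where R1: "R1 \<ge> 0" "\<And>r \<omega>. r > 2 * M \<Longrightarrow> \<omega> \<in> S2 \<Longrightarrow> R1 < \<bar>tortoise M r\<bar> \<Longrightarrow> \<phi> (r, \<omega>) = 0"
    using compact_support_tortoise_bound[OF M assms(2)] by blast
  obtain R2 where R2: "R2 \<ge> 0" "\<And>r \<omega>. r > 2 * M \<Longrightarrow> \<omega> \<in> S2 \<Longrightarrow> R2 < \<bar>tortoise M r\<bar> \<Longrightarrow> \<psi> (r, \<omega>) = 0"
    using compact_support_tortoise_bound[OF M assms(3)] by blast
  have ini: "u (0, \<rho> s, polar z) = \<phi> (\<rho> s, polar z)" "D1 (\<lambda>t. u (t, \<rho> s, polar z)) 0 = \<psi> (\<rho> s, polar z)" for s z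
    using assms(1) rho(1)[OF M, of s] polar_in_sphere[of z] unfolding cauchy_solution_def exterior_def by auto
  have "compact_wave_field (pot_W M) (pot_V M) (\<lambda>s. - M / (\<rho> s)\<^sup>2) (\<lambda>s. - 1 / \<rho> s)
    U Ut Us Utt Uts Uss Up Upp Utp h hq ht (max R1 R2)"
  proof unfold_locales
    show "0 \<le> max R1 R2" using R1 by simp
    fix s z assume "max R1 R2 < \<bar>s\<bar>"
    then show "U 0 s z = 0" "Ut 0 s z = 0"
      using R1(2)[OF rho(1)[OF M] polar_in_sphere] R2(2)[OF rho(1)[OF M] polar_in_sphere]
      by (simp_all add: U_eq_u Ut_eq_D1 ini rho(2)[OF M] B_linear)
  qed
  then show ?thesis by blast
qed

text \<open>\<open>T\<close> is arbitrary so that both \<open>\<tau> - s\<close> and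
  \<open>\<tau> + s\<close> are covered. The factor \<open>\<rho> s\<close> between the radiation
  field and \<open>Ut\<close> tends to \<open>2 * M\<close> and does not disturb the zero
  limit.\<close>

lemma horizon_limit:
  assumes "((\<lambda>r. D1 (\<lambda>s. u (s, r, polar z)) (T (tortoise M r))) \<longlongrightarrow> 0) (at_right (2 * M))"
  shows "((\<lambda>s. Ut (T s) s z) \<longlongrightarrow> 0) at_bot"
proof -
  have "((\<lambda>s. D1 (\<lambda>t. u (t, \<rho> s, polar z)) (T s)) \<longlongrightarrow> 0) at_bot"
    using filterlim_compose[OF assms rho_at_bot[OF M]] by (simp add: rho(2)[OF M])
  then have "((\<lambda>s. B (D1 (\<lambda>t. u (t, \<rho> s, polar z)) (T s))) \<longlongrightarrow> B 0) at_bot"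
    by (rule bounded_linear.tendsto[OF B])
  moreover have "(\<rho> \<longlongrightarrow> 2 * M) at_bot" using rho_at_bot[OF M] by (simp add: filterlim_at)
  ultimately have "((\<lambda>s. \<rho> s * B (D1 (\<lambda>t. u (t, \<rho> s, polar z)) (T s))) \<longlongrightarrow> 2 * M * B 0) at_bot"
    by (intro tendsto_mult)
  then show ?thesis by (simp add: Ut_eq_D1 B_linear)
qed

text \<open>The weight \<open>r\<close> in the radiation field is exactly the factor
  \<open>\<rho> s\<close> in \<open>Ut\<close>. The conclusion is written at \<open>- s\<close> to
  fit the reflected field.\<close>

lemma scri_limit:
  assumes "((\<lambda>r. r *\<^sub>R D1 (\<lambda>s. u (s, r, polar z)) (T (tortoise M r))) \<longlongrightarrow> 0) at_top"
  shows "((\<lambda>s. Ut (T (- s)) (- s) z) \<longlongrightarrow> 0) at_bot"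
proof -
  have "((\<lambda>s. \<rho> s *\<^sub>R D1 (\<lambda>t. u (t, \<rho> s, polar z)) (T s)) \<longlongrightarrow> 0) at_top"
    using filterlim_compose[OF assms rho_at_top[OF M]] by (simp add: rho(2)[OF M])
  then have "((\<lambda>s. B (\<rho> s *\<^sub>R D1 (\<lambda>t. u (t, \<rho> s, polar z)) (T s))) \<longlongrightarrow> B 0) at_top"
    by (rule bounded_linear.tendsto[OF B])
  then have "((\<lambda>s. Ut (T s) s z) \<longlongrightarrow> 0) at_top" by (simp add: Ut_eq_D1 B_linear)
  then show ?thesis by (rule filterlim_compose[OF _ filterlim_uminus_at_top_at_bot])
qed

lemma horizon_support:
  assumes sol: "cauchy_solution M \<phi> \<psi> u" "Cc_infinity (exterior M) \<phi>" "Cc_infinity (exterior M) \<psi>"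
    and plus: "\<And>\<tau> \<omega>. \<tau> \<le> \<tau>0 \<Longrightarrow> \<omega> \<in> S2 \<Longrightarrow> has_radiation_E_plus M u \<tau> \<omega> 0"
    and minus: "\<And>\<tau> \<omega>. - \<tau>0 \<le> \<tau> \<Longrightarrow> \<omega> \<in> S2 \<Longrightarrow> has_radiation_E_minus M u \<tau> \<omega> 0"
    and s: "s < \<tau>0"
  shows "B (u (0, \<rho> s, polar z)) = 0" "B (D1 (\<lambda>t. u (t, \<rho> s, polar z)) 0) = 0"
proof -
  obtain R where "compact_wave_field (pot_W M) (pot_V M) (\<lambda>s. - M / (\<rho> s)\<^sup>2) (\<lambda>s. - 1 / \<rho> s)
    U Ut Us Utt Uts Uss Up Upp Utp h hq ht R" using compact_data[OF sol] by blast
  then interpret c: compact_wave_field "pot_W M" "pot_V M" "\<lambda>s. - M / (\<rho> s)\<^sup>2" "\<lambda>s. - 1 / \<rho> s"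
    U Ut Us Utt Uts Uss Up Upp Utp h hq ht R .
  have van: "U t s z = 0" if "t + s < \<tau>0" "- \<tau>0 < t - s" for t s z
  proof (rule c.radiation_vanishing[OF _ _ that])
    fix x z assume x: "x \<le> \<tau>0"
    show "((\<lambda>s. Ut (x - s) s z) \<longlongrightarrow> 0) at_bot"
      using plus[OF x polar_in_sphere] unfolding has_radiation_E_plus_def by (rule horizon_limit)
    have "((\<lambda>s. Ut (- x + s) s z) \<longlongrightarrow> 0) at_bot"
      using minus[OF _ polar_in_sphere, of "- x"] x unfolding has_radiation_E_minus_def by (intro horizon_limit) simp
    then show "((\<lambda>s. Ut (- (x - s)) s z) \<longlongrightarrow> 0) at_bot" by (simp add: algebra_simps)
  qed
  show "B (u (0, \<rho> s, polar z)) = 0" "B (D1 (\<lambda>t. u (t, \<rho> s, polar z)) 0) = 0"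
    \<comment> \<open>For \<open>s < \<tau>0\<close> the quadrant contains the whole open time
      interval \<open>\<bar>t\<bar> < \<tau>0 - s\<close>, so the time derivative vanishes as
      well.\<close>
    by (rule zero_near_imp_data_zero[of "{s - \<tau>0<..<\<tau>0 - s}"]; use s van in auto)+
qed

lemma scri_support:
  assumes sol: "cauchy_solution M \<phi> \<psi> u" "Cc_infinity (exterior M) \<phi>" "Cc_infinity (exterior M) \<psi>"
    and plus: "\<And>\<tau> \<omega>. \<tau> \<le> - \<tau>0 \<Longrightarrow> \<omega> \<in> S2 \<Longrightarrow> has_radiation_S_plus M u \<tau> \<omega> 0"
    and minus: "\<And>\<tau> \<omega>. \<tau>0 \<le> \<tau> \<Longrightarrow> \<omega> \<in> S2 \<Longrightarrow> has_radiation_S_minus M u \<tau> \<omega> 0"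
    and s: "\<tau>0 < s"
  shows "B (u (0, \<rho> s, polar z)) = 0" "B (D1 (\<lambda>t. u (t, \<rho> s, polar z)) 0) = 0"
proof -
  obtain R where c: "compact_wave_field (pot_W M) (pot_V M) (\<lambda>s. - M / (\<rho> s)\<^sup>2) (\<lambda>s. - 1 / \<rho> s)
    U Ut Us Utt Uts Uss Up Upp Utp h hq ht R" using compact_data[OF sol] by blast
  \<comment> \<open>In the reflected coordinate the threshold is \<open>- \<tau>0\<close>, and the
    statement for the horizon applies with that value.\<close>
  have van: "U t (- s) z = 0" if "t + s < - \<tau>0" "- (- \<tau>0) < t - s" for t s z
  proof (rule compact_wave_field.radiation_vanishing[OF compact_wave_field.reflected[OF c] _ _ that])
    fix x z assume x: "x \<le> - \<tau>0"
    have "((\<lambda>s. Ut (x + - s) (- s) z) \<longlongrightarrow> 0) at_bot"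
      using plus[OF x polar_in_sphere] unfolding has_radiation_S_plus_def by (rule scri_limit)
    then show "((\<lambda>s. Ut (x - s) (- s) z) \<longlongrightarrow> 0) at_bot" by simp
    have "((\<lambda>s. Ut (- x - - s) (- s) z) \<longlongrightarrow> 0) at_bot"
      using minus[OF _ polar_in_sphere, of "- x"] x unfolding has_radiation_S_minus_def by (intro scri_limit) simp
    then show "((\<lambda>s. Ut (- (x - s)) (- s) z) \<longlongrightarrow> 0) at_bot" by (simp add: algebra_simps)
  qed
  have "U t s z = 0" if "t \<in> {\<tau>0 - s<..<s - \<tau>0}" for t
    using van[of t "- s" z] that by simp
  then show "B (u (0, \<rho> s, polar z)) = 0" "B (D1 (\<lambda>t. u (t, \<rho> s, polar z)) 0) = 0"
    by (intro zero_near_imp_data_zero[of "{\<tau>0 - s<..<s - \<tau>0}"]; use s in auto)+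
qed

end

theorem theorem1p4:
  fixes M :: real
    and \<phi> \<psi> :: "real \<times> vec3 \<Rightarrow> complex"
    and u :: "real \<times> real \<times> vec3 \<Rightarrow> complex"
  assumes "M > 0"
    and "Cc_infinity (exterior M) \<phi>"
    and "Cc_infinity (exterior M) \<psi>"
    and "cauchy_solution M \<phi> \<psi> u"
  shows "(\<forall>\<tau>0.
           (\<forall>\<tau>\<le>\<tau>0. \<forall>\<omega>\<in>S2. has_radiation_E_plus M u \<tau> \<omega> 0) \<and>
           (\<forall>\<tau>\<ge>-\<tau>0. \<forall>\<omega>\<in>S2. has_radiation_E_minus M u \<tau> \<omega> 0) \<longrightarrow>
           (\<exists>r0>2*M. r0 + 2*M * ln (r0 - 2*M) = \<tau>0 \<and>
              supp_in (exterior M) \<phi> \<subseteq> {r0..} \<times> S2 \<and>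
              supp_in (exterior M) \<psi> \<subseteq> {r0..} \<times> S2)) \<and>
         (\<forall>\<tau>0.
           (\<forall>\<tau>\<le>-\<tau>0. \<forall>\<omega>\<in>S2. has_radiation_S_plus M u \<tau> \<omega> 0) \<and>
           (\<forall>\<tau>\<ge>\<tau>0. \<forall>\<omega>\<in>S2. has_radiation_S_minus M u \<tau> \<omega> 0) \<longrightarrow>
           (\<exists>r0>2*M. r0 + 2*M * ln (r0 - 2*M) = \<tau>0 \<and>
              supp_in (exterior M) \<phi> \<subseteq> {2*M<..r0} \<times> S2 \<and>
              supp_in (exterior M) \<psi> \<subseteq> {2*M<..r0} \<times> S2))"
proof -
  note M = \<open>M > 0\<close>
  have sol: "schwarzschild_solution M u"
    using assms by unfold_locales (auto simp: cauchy_solution_def)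
  have ini: "\<phi> (r, \<omega>) = u (0, r, \<omega>)" "\<psi> (r, \<omega>) = D1 (\<lambda>t. u (t, r, \<omega>)) 0" if "2 * M < r" "\<omega> \<in> S2" for r \<omega>
    using assms(4) that unfolding cauchy_solution_def exterior_def by auto
  have field: "schwarzschild_field M u B" if "bounded_linear B" for B
    by (rule schwarzschild_field.intro[OF sol schwarzschild_field_axioms.intro[OF that]])
  have point: "\<exists>z. polar z = \<omega>" if "\<omega> \<in> S2" for \<omega>
    using polar_surj[OF that] by metis
  have data_zero: "\<phi> (r, \<omega>) = 0 \<and> \<psi> (r, \<omega>) = 0"
    if r: "2 * M < r" and \<omega>: "\<omega> \<in> S2"
      and z: "\<And>B z. bounded_linear B \<Longrightarrow> B (u (0, rho M (tortoise M r), polar z)) = (0 :: real)"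
        "\<And>B z. bounded_linear B \<Longrightarrow> B (D1 (\<lambda>t. u (t, rho M (tortoise M r), polar z)) 0) = (0 :: real)" for r \<omega>
  proof -
    obtain z where pz: "polar z = \<omega>" using point[OF \<omega>] by blast
    have "u (0, r, \<omega>) = 0" "D1 (\<lambda>t. u (t, r, \<omega>)) 0 = 0"
      using z(1)[of _ z] z(2)[of _ z] unfolding rho_tortoise[OF M r] pz by (blast intro: complex_bounded_linear_zero)+
    then show ?thesis using ini[OF r \<omega>] by simp
  qed
  show ?thesis
  proof (intro conjI allI impI; elim conjE)
    fix \<tau>0
    assume plus: "\<forall>\<tau>\<le>\<tau>0. \<forall>\<omega>\<in>S2. has_radiation_E_plus M u \<tau> \<omega> 0"
      and minus: "\<forall>\<tau>\<ge>-\<tau>0. \<forall>\<omega>\<in>S2. has_radiation_E_minus M u \<tau> \<omega> 0"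
    obtain r0 where r0: "2 * M < r0" "tortoise M r0 = \<tau>0" using tortoise_surj[OF M] by blast
    have zero: "\<phi> x = 0 \<and> \<psi> x = 0" if xx: "x \<in> exterior M" "x \<notin> {r0..} \<times> UNIV" for x
    proof -
      obtain r \<omega> where x: "x = (r, \<omega>)" "2 * M < r" "\<omega> \<in> S2" "r < r0"
        using xx by (cases x) (auto simp: exterior_def)
      have "tortoise M r < \<tau>0" using tortoise_less[OF M x(2,4)] r0(2) by simp
      then show ?thesis
        unfolding x(1) using plus minus
        by (intro data_zero x(2,3) schwarzschild_field.horizon_support[OF field assms(4,2,3)]) auto
    qed
    have "supp_in (exterior M) \<phi> \<subseteq> exterior M \<inter> {r0..} \<times> UNIV" "supp_in (exterior M) \<psi> \<subseteq> exterior M \<inter> {r0..} \<times> UNIV"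
      by (rule supp_in_subset; use zero in \<open>auto intro: closed_Times\<close>)+
    then show "\<exists>r0>2*M. r0 + 2*M * ln (r0 - 2*M) = \<tau>0 \<and>
              supp_in (exterior M) \<phi> \<subseteq> {r0..} \<times> S2 \<and> supp_in (exterior M) \<psi> \<subseteq> {r0..} \<times> S2"
      using r0 unfolding tortoise_def exterior_def by (intro exI[of _ r0]) blast
  next
    fix \<tau>0
    assume plus: "\<forall>\<tau>\<le>-\<tau>0. \<forall>\<omega>\<in>S2. has_radiation_S_plus M u \<tau> \<omega> 0"
      and minus: "\<forall>\<tau>\<ge>\<tau>0. \<forall>\<omega>\<in>S2. has_radiation_S_minus M u \<tau> \<omega> 0"
    obtain r0 where r0: "2 * M < r0" "tortoise M r0 = \<tau>0" using tortoise_surj[OF M] by blast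
    \<comment> \<open>\<open>{2*M<..r0}\<close> is not closed in the ambient line. The closed set
      \<open>{..r0}\<close> replaces it, and intersecting with the exterior restores the lower
      bound.\<close>
    have zero: "\<phi> x = 0 \<and> \<psi> x = 0" if xx: "x \<in> exterior M" "x \<notin> {..r0} \<times> UNIV" for x
    proof -
      obtain r \<omega> where x: "x = (r, \<omega>)" "2 * M < r" "\<omega> \<in> S2" "r0 < r"
        using xx by (cases x) (auto simp: exterior_def)
      have "\<tau>0 < tortoise M r" using tortoise_less[OF M r0(1) x(4)] r0(2) by simp
      then show ?thesis
        unfolding x(1) using plus minus
        by (intro data_zero x(2,3) schwarzschild_field.scri_support[OF field assms(4,2,3)]) auto
    qed
    have "supp_in (exterior M) \<phi> \<subseteq> exterior M \<inter> {..r0} \<times> UNIV" "supp_in (exterior M) \<psi> \<subseteq> exterior M \<inter> {..r0} \<times> UNIV"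
      by (rule supp_in_subset; use zero in \<open>auto intro: closed_Times\<close>)+
    then show "\<exists>r0>2*M. r0 + 2*M * ln (r0 - 2*M) = \<tau>0 \<and>
              supp_in (exterior M) \<phi> \<subseteq> {2*M<..r0} \<times> S2 \<and> supp_in (exterior M) \<psi> \<subseteq> {2*M<..r0} \<times> S2"
      using r0 unfolding tortoise_def exterior_def by (intro exI[of _ r0]) fastforce
  qed
qed

end
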